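(* Let $(\pi,\mathcal V)=\mathbf{St}_e(\tau)$ be the level $0$ discrete series representation of $G=\mathrm{GL}_n(F)$ attached to $\tau$, let $(J,\lambda)$ be the associated simple type, and let $\chi$ be the character of $\mathcal H_\lambda$ afforded by the one-dimensional module $\mathrm{Hom}_J(W,\mathcal V)$. Let $${}_\chi\bar{\mathcal H}_\lambda=\{\Psi\in\bar{\mathcal H}_\lambda\ ;\ \varphi\star\Psi=\chi(\varphi)\Psi\ \text{ for all }\varphi\in\mathcal H_\lambda\}.$$ Then $\dim_{\mathbb C}\,{}_\chi\bar{\mathcal H}_\lambda=1$.
   Context: $F$ is a non-archimedean, non-discrete, locally compact field of any characteristic, with ring of integers $\mathfrak o_F$, maximal ideal $\mathfrak p_F$, uniformizer $\varpi_F$, residue field $k_F$ of cardinality $q$, normalized absolute value $\|\ \|$. All representations are on complex vector spaces. Fix $n\geqslant 2$, positive integers $e,f$ with $ef=n$, and put $G=\mathrm{GL}_n(F)$. Representation: $\tau$ is an irreducible unitary level $0$ supercuspidal representation of $\mathrm{GL}_f(F)$ with central character $\omega_\tau$; that is, there are an irreducible cuspidal representation $\bar\lambda_0$ of $\mathrm{GL}_f(k_F)$, with inflation $\lambda_0$ to $\mathrm{GL}_f(\mathfrak o_F)$ (space $X_0$), and an extension $\Lambda_0$ of $\lambda_0$ to $F^\times\mathrm{GL}_f(\mathfrak o_F)$ with $\tau\simeq \mathrm{ind}_{F^\times \mathrm{GL}_f(\mathfrak o_F)}^{\mathrm{GL}_f(F)}\Lambda_0$. Write $\tau^a=\|\det\|^a\tau$.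 $(\pi,\mathcal V)=\mathbf{St}_e(\tau)$ is the unique irreducible quotient of the representation of $G$ obtained by normalized parabolic induction from $\tau^{(1-e)/2}\otimes\tau^{(3-e)/2}\otimes\cdots\otimes\tau^{(e-1)/2}$ on the standard Levi subgroup $\mathrm{GL}_f(F)^{e}$. Type: $\mathfrak A$ is the $\mathfrak o_F$-order of $f\times f$ block matrices $(a_{ij})_{1\le i,j\le e}$ with $a_{ij}\in M_f(\mathfrak o_F)$ if $j\ge i$ and $a_{ij}\in\mathfrak p_F M_f(\mathfrak o_F)$ if $j<i$; $\mathfrak P$ is its Jacobson radical, $J=\mathfrak A^\times$, $J^1=1+\mathfrak P$, so $J/J^1\simeq\mathrm{GL}_f(k_F)^e$. $\lambda$ is the inflation of $\bar\lambda_0^{\otimes e}$ to $J$, with space $W=X_0^{\otimes e}$; $(\tilde\lambda,\tilde W)$ is its contragredient. Hecke algebra: $\bar{\mathcal H}_\lambda$ is the space of all functions $\Psi:G\to\mathrm{End}_{\mathbb C}(\tilde W)$ (no support condition) with $\Psi(j_1gj_2)=\tilde\lambda(j_1)\circ\Psi(g)\circ\tilde\lambda(j_2)$ for $j_1,j_2\in J$, $g\in G$; $\mathcal H_\lambda\subset\bar{\mathcal H}_\lambda$ is the subspace of compactly supported ones. For $\varphi\in\mathcal H_\lambda,\Psi\in\bar{\mathcal H}_\lambda$, $(\varphi\star\Psi)(g)=\sum_{x\in J\backslash G}\varphi(gx^{-1})\Psi(x)$ (a finite sum); this makes $\mathcal H_\lambda$ an algebra (convolution for the Haar measure on $G$ giving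 $J$ volume $1$). Module: $\mathrm{ind}_J^G\lambda$ is the space of compactly supported $f:G\to W$ with $f(jg)=\lambda(j)f(g)$, $G$ acting by right translation. For $\varphi\in\mathcal H_\lambda$ put $\tilde\varphi(g)={}^t\varphi(g^{-1})\in\mathrm{End}_{\mathbb C}(W)$ and $(\tilde\varphi\star f)(g)=\sum_{x\in G/J}\tilde\varphi(x)f(x^{-1}g)$. $\mathrm{Hom}_J(W,\mathcal V)\simeq\mathrm{Hom}_G(\mathrm{ind}_J^G\lambda,\mathcal V)$ is a left $\mathcal H_\lambda$-module by $(\varphi\cdot\alpha)(f)=\alpha(\tilde\varphi\star f)$. It is known to be one-dimensional; $\chi$ is the resulting character of $\mathcal H_\lambda$. *)

theory Defs
  imports
    "HOL-Analysis.Analysis"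
    "HOL-Algebra.Left_Coset"
    "HOL-Library.Function_Algebras"
    "Jordan_Normal_Form.Determinant"
begin

section \<open>Complex vector spaces\<close>

text \<open>A complex vector space is a subspace of a type of class \<open>complex_vector\<close>.  Functions into such
  a type form one again, with pointwise operations; a function that is only meaningful on a set is
  required to vanish outside it, so that spaces of functions have the right dimension.\<close>

class complex_vector = ab_group_add +
  fixes scaleC :: "complex \<Rightarrow> 'a \<Rightarrow> 'a"  (infixr "*\<^sub>C" 75)
  assumes scaleC_add_right: "a *\<^sub>C (x + y) = a *\<^sub>C x + a *\<^sub>C y"
    and scaleC_add_left: "(a + b) *\<^sub>C x = a *\<^sub>C x + b *\<^sub>C x"
    and scaleC_scaleC: "a *\<^sub>C (b *\<^sub>C x) = (a * b) *\<^sub>C x"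
    and scaleC_one: "1 *\<^sub>C x = x"

instantiation complex :: complex_vector
begin
definition scaleC_complex :: "complex \<Rightarrow> complex \<Rightarrow> complex" where "scaleC_complex a x = a * x"
instance by standard (simp_all add: scaleC_complex_def algebra_simps)
end

instantiation "fun" :: (type, complex_vector) complex_vector
begin
definition scaleC_fun :: "complex \<Rightarrow> ('a \<Rightarrow> 'b) \<Rightarrow> 'a \<Rightarrow> 'b" where "scaleC_fun a h = (\<lambda>x. a *\<^sub>C h x)"
instance
  by standard
    (simp_all add: scaleC_fun_def fun_eq_iff scaleC_add_right scaleC_add_left scaleC_scaleC scaleC_one)
end

interpretation cvec: vector_space "scaleC :: complex \<Rightarrow> 'a \<Rightarrow> 'a::complex_vector"
  by unfold_locales (simp_all add: scaleC_add_right scaleC_add_left scaleC_scaleC scaleC_one)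

definition linear_from_to ::
    "'v::complex_vector set \<Rightarrow> 'w::complex_vector set \<Rightarrow> ('v \<Rightarrow> 'w) \<Rightarrow> bool" where
  "linear_from_to V W A \<longleftrightarrow>
     (\<forall>x\<in>V. A x \<in> W) \<and> (\<forall>x\<in>V. \<forall>y\<in>V. A (x + y) = A x + A y) \<and> (\<forall>c. \<forall>x\<in>V. A (c *\<^sub>C x) = c *\<^sub>C A x)"

definition lin_maps ::
    "'v::complex_vector set \<Rightarrow> 'w::complex_vector set \<Rightarrow> ('v \<Rightarrow> 'w) set" where
  "lin_maps V W = {A. linear_from_to V W A \<and> (\<forall>x. x \<notin> V \<longrightarrow> A x = 0)}"


subsection \<open>Tensor powers\<close>

definition tuples :: "nat \<Rightarrow> 'v set \<Rightarrow> 'v list set" where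
  "tuples e V = {xs. length xs = e \<and> set xs \<subseteq> V}"

definition multilinear_forms :: "nat \<Rightarrow> 'v::complex_vector set \<Rightarrow> ('v list \<Rightarrow> complex) set" where
  "multilinear_forms e V = {\<beta>. (\<forall>xs. xs \<notin> tuples e V \<longrightarrow> \<beta> xs = 0) \<and>
     (\<forall>xs\<in>tuples e V. \<forall>i<e. \<forall>x\<in>V.
        (\<forall>y\<in>V. \<beta> (xs[i := x + y]) = \<beta> (xs[i := x]) + \<beta> (xs[i := y])) \<and>
        (\<forall>c. \<beta> (xs[i := c *\<^sub>C x]) = c * \<beta> (xs[i := x])))}"

text \<open>The tensor power of \<open>V\<close> is realised inside the dual of the space of multilinear forms on
  \<open>V\<close>, as the span of the evaluations at tuples.  Over a field this is the usual tensor power, also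
  in infinite dimension, because multilinear forms separate the elements of the latter.\<close>

definition pure_tensor ::
    "nat \<Rightarrow> 'v::complex_vector set \<Rightarrow> 'v list \<Rightarrow> ('v list \<Rightarrow> complex) \<Rightarrow> complex" where
  "pure_tensor e V xs = (\<lambda>\<beta>. if \<beta> \<in> multilinear_forms e V then \<beta> xs else 0)"

definition tensor_power ::
    "nat \<Rightarrow> 'v::complex_vector set \<Rightarrow> (('v list \<Rightarrow> complex) \<Rightarrow> complex) set" where
  "tensor_power e V = cvec.span (pure_tensor e V ` tuples e V)"

text \<open>\<open>tensor_op e V A\<close> is the operator \<open>A 0 \<otimes> \<dots> \<otimes> A (e - 1)\<close>, see \<open>tensor_op_pure_tensor\<close>.\<close>

definition tensor_op ::
    "nat \<Rightarrow> 'v::complex_vector set \<Rightarrow> (nat \<Rightarrow> 'v \<Rightarrow> 'v) \<Rightarrow>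
     (('v list \<Rightarrow> complex) \<Rightarrow> complex) \<Rightarrow> ('v list \<Rightarrow> complex) \<Rightarrow> complex" where
  "tensor_op e V A w = (\<lambda>\<beta>. if \<beta> \<in> multilinear_forms e V
     then w (\<lambda>xs. if xs \<in> tuples e V then \<beta> (map (\<lambda>i. A i (xs ! i)) [0..<e]) else 0)
     else 0)"

lemma multilinear_forms_pullback:
  assumes A: "\<And>i. i < e \<Longrightarrow> linear_from_to V V (A i)"
    and V: "cvec.subspace V" and b: "\<beta> \<in> multilinear_forms e V"
  shows "(\<lambda>xs. if xs \<in> tuples e V then \<beta> (map (\<lambda>i. A i (xs ! i)) [0..<e]) else 0)
           \<in> multilinear_forms e V"
proof -
  let ?m = "\<lambda>xs. map (\<lambda>i. A i (xs ! i)) [0..<e]"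
  have upd: "?m (xs[i := z]) = (?m xs)[i := A i z]" if "xs \<in> tuples e V" "i < e" for xs i z
    using that by (intro nth_equalityI) (auto simp: tuples_def nth_list_update)
  have m: "?m xs \<in> tuples e V" if "xs \<in> tuples e V" for xs
  proof -
    have "A i (xs ! i) \<in> V" if "i < e" for i
      using A[OF that] \<open>xs \<in> tuples e V\<close> that
      by (auto simp: tuples_def linear_from_to_def subset_iff)
    then show ?thesis
      by (auto simp: tuples_def)
  qed
  have t: "xs[i := z] \<in> tuples e V" if "xs \<in> tuples e V" "z \<in> V" for xs i z
    using that set_update_subset_insert[of xs i z] by (auto simp: tuples_def)
  let ?p = "\<lambda>xs. if xs \<in> tuples e V then \<beta> (?m xs) else 0"
  have add: "\<beta> (ys[i := x + y]) = \<beta> (ys[i := x]) + \<beta> (ys[i := y])"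
    and scale: "\<beta> (ys[i := c *\<^sub>C x]) = c * \<beta> (ys[i := x])"
    if "ys \<in> tuples e V" "i < e" "x \<in> V" "y \<in> V" for ys i x y c
    using b that unfolding multilinear_forms_def by blast+
  have p_add: "?p (xs[i := x + y]) = ?p (xs[i := x]) + ?p (xs[i := y])"
    if h: "xs \<in> tuples e V" "i < e" "x \<in> V" "y \<in> V" for xs i x y
  proof -
    have "A i x \<in> V" "A i y \<in> V" "A i (x + y) = A i x + A i y"
      using A[OF h(2)] h by (auto simp: linear_from_to_def)
    then show ?thesis
      using add[OF m[OF h(1)] h(2)] t[OF h(1)] cvec.subspace_add[OF V h(3,4)] h upd[OF h(1,2)]
      by simp
  qed
  have p_scale: "?p (xs[i := c *\<^sub>C x]) = c * ?p (xs[i := x])"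
    if h: "xs \<in> tuples e V" "i < e" "x \<in> V" for xs i x c
  proof -
    have "A i x \<in> V" "A i (c *\<^sub>C x) = c *\<^sub>C A i x"
      using A[OF h(2)] h by (auto simp: linear_from_to_def)
    then show ?thesis
      using scale[OF m[OF h(1)] h(2)] t[OF h(1)] cvec.subspace_scale[OF V h(3)] h upd[OF h(1,2)]
      by simp
  qed
  show ?thesis
    unfolding multilinear_forms_def
    by (intro CollectI conjI allI ballI impI) (simp, rule p_add, assumption+, rule p_scale)
qed

lemma tensor_op_pure_tensor:
  assumes "\<And>i. i < e \<Longrightarrow> linear_from_to V V (A i)"
    and "cvec.subspace V" and "xs \<in> tuples e V"
  shows "tensor_op e V A (pure_tensor e V xs) = pure_tensor e V (map (\<lambda>i. A i (xs ! i)) [0..<e])"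
  using assms multilinear_forms_pullback[of e V A]
  by (auto simp: tensor_op_def pure_tensor_def fun_eq_iff)


section \<open>Representations\<close>

definition representation ::
    "('g, 'm) monoid_scheme \<Rightarrow> 'v::complex_vector set \<Rightarrow> ('g \<Rightarrow> 'v \<Rightarrow> 'v) \<Rightarrow> bool" where
  "representation G V \<rho> \<longleftrightarrow> cvec.subspace V \<and>
     (\<forall>g\<in>carrier G. linear_from_to V V (\<rho> g)) \<and>
     (\<forall>v\<in>V. \<rho> \<one>\<^bsub>G\<^esub> v = v) \<and>
     (\<forall>g\<in>carrier G. \<forall>h\<in>carrier G. \<forall>v\<in>V. \<rho> (g \<otimes>\<^bsub>G\<^esub> h) v = \<rho> g (\<rho> h v))"

definition irreducible_rep ::
    "('g, 'm) monoid_scheme \<Rightarrow> 'v::complex_vector set \<Rightarrow> ('g \<Rightarrow> 'v \<Rightarrow> 'v) \<Rightarrow> bool" where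
  "irreducible_rep G V \<rho> \<longleftrightarrow> representation G V \<rho> \<and> V \<noteq> {0} \<and>
     (\<forall>U. cvec.subspace U \<and> U \<subseteq> V \<and> (\<forall>g\<in>carrier G. \<forall>u\<in>U. \<rho> g u \<in> U) \<longrightarrow> U = {0} \<or> U = V)"

definition intertwiners ::
    "('g, 'm) monoid_scheme \<Rightarrow> 'v::complex_vector set \<Rightarrow> ('g \<Rightarrow> 'v \<Rightarrow> 'v) \<Rightarrow>
     'w::complex_vector set \<Rightarrow> ('g \<Rightarrow> 'w \<Rightarrow> 'w) \<Rightarrow> ('v \<Rightarrow> 'w) set" where
  "intertwiners G V \<rho> W \<sigma> =
     {A \<in> lin_maps V W. \<forall>g\<in>carrier G. \<forall>v\<in>V. A (\<rho> g v) = \<sigma> g (A v)}"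

definition isomorphic_rep ::
    "('g, 'm) monoid_scheme \<Rightarrow> 'v::complex_vector set \<Rightarrow> ('g \<Rightarrow> 'v \<Rightarrow> 'v) \<Rightarrow>
     'w::complex_vector set \<Rightarrow> ('g \<Rightarrow> 'w \<Rightarrow> 'w) \<Rightarrow> bool" where
  "isomorphic_rep G V \<rho> W \<sigma> \<longleftrightarrow> (\<exists>A\<in>intertwiners G V \<rho> W \<sigma>. bij_betw A V W)"

definition smooth_rep ::
    "('g, 'm) monoid_scheme \<Rightarrow> 'g topology \<Rightarrow> 'v::complex_vector set \<Rightarrow> ('g \<Rightarrow> 'v \<Rightarrow> 'v) \<Rightarrow> bool" where
  "smooth_rep G X V \<rho> \<longleftrightarrow> representation G V \<rho> \<and>
     (\<forall>v\<in>V. openin X {g \<in> carrier G. \<rho> g v = v})"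

definition unitary_rep ::
    "('g, 'm) monoid_scheme \<Rightarrow> 'v::complex_vector set \<Rightarrow> ('g \<Rightarrow> 'v \<Rightarrow> 'v) \<Rightarrow> bool" where
  "unitary_rep G V \<rho> \<longleftrightarrow> (\<exists>B :: 'v \<Rightarrow> 'v \<Rightarrow> complex.
     (\<forall>y\<in>V. linear_from_to V UNIV (\<lambda>x. B x y)) \<and>
     (\<forall>x\<in>V. \<forall>y\<in>V. B y x = cnj (B x y)) \<and>
     (\<forall>x\<in>V. x \<noteq> 0 \<longrightarrow> Re (B x x) > 0) \<and>
     (\<forall>g\<in>carrier G. \<forall>x\<in>V. \<forall>y\<in>V. B (\<rho> g x) (\<rho> g y) = B x y))"

text \<open>The contragredient is only used for finite-dimensional representations that are trivial on an
  open subgroup; there the smooth dual is the full dual.\<close>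

definition dual_space :: "'v::complex_vector set \<Rightarrow> ('v \<Rightarrow> complex) set" where
  "dual_space V = lin_maps V UNIV"

definition contragredient ::
    "('g, 'm) monoid_scheme \<Rightarrow> 'v::complex_vector set \<Rightarrow> ('g \<Rightarrow> 'v \<Rightarrow> 'v) \<Rightarrow>
     'g \<Rightarrow> ('v \<Rightarrow> complex) \<Rightarrow> 'v \<Rightarrow> complex" where
  "contragredient G V \<rho> g \<xi> = (\<lambda>v. if v \<in> V then \<xi> (\<rho> (inv\<^bsub>G\<^esub> g) v) else 0)"

text \<open>The transpose of an endomorphism \<open>B\<close> of the dual of a finite-dimensional \<open>V\<close>, as an
  endomorphism of \<open>V\<close>.\<close>

definition transpose_end ::
    "'v::complex_vector set \<Rightarrow> (('v \<Rightarrow> complex) \<Rightarrow> 'v \<Rightarrow> complex) \<Rightarrow> 'v \<Rightarrow> 'v" where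
  "transpose_end V B v =
     (if v \<in> V then (THE v'. v' \<in> V \<and> (\<forall>\<xi>\<in>dual_space V. \<xi> v' = B \<xi> v)) else 0)"


subsection \<open>Induced representations\<close>

definition equivariant_funs ::
    "('g, 'm) monoid_scheme \<Rightarrow> 'g set \<Rightarrow> 'v::complex_vector set \<Rightarrow> ('g \<Rightarrow> 'v \<Rightarrow> 'v) \<Rightarrow>
     ('g \<Rightarrow> 'v) set" where
  "equivariant_funs G H V \<rho> = {h. (\<forall>g. g \<notin> carrier G \<longrightarrow> h g = 0) \<and> (\<forall>g\<in>carrier G. h g \<in> V) \<and>
     (\<forall>x\<in>H. \<forall>g\<in>carrier G. h (x \<otimes>\<^bsub>G\<^esub> g) = \<rho> x (h g))}"

definition right_translation ::
    "('g, 'm) monoid_scheme \<Rightarrow> 'g \<Rightarrow> ('g \<Rightarrow> 'v::complex_vector) \<Rightarrow> 'g \<Rightarrow> 'v" where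
  "right_translation G g h = (\<lambda>x. if x \<in> carrier G then h (x \<otimes>\<^bsub>G\<^esub> g) else 0)"

definition smooth_fun ::
    "('g, 'm) monoid_scheme \<Rightarrow> 'g topology \<Rightarrow> ('g \<Rightarrow> 'v::complex_vector) \<Rightarrow> bool" where
  "smooth_fun G X h \<longleftrightarrow> openin X {g \<in> carrier G. right_translation G g h = h}"

definition compactly_supported :: "'g topology \<Rightarrow> ('g \<Rightarrow> 'v::zero) \<Rightarrow> bool" where
  "compactly_supported X h \<longleftrightarrow> (\<exists>K. compactin X K \<and> {g. h g \<noteq> 0} \<subseteq> K)"

text \<open>Compact induction from a subgroup \<open>H\<close>: supports are compact modulo \<open>H\<close>.\<close>

definition compact_induction ::
    "('g, 'm) monoid_scheme \<Rightarrow> 'g topology \<Rightarrow> 'g set \<Rightarrow> 'v::complex_vector set \<Rightarrow>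
     ('g \<Rightarrow> 'v \<Rightarrow> 'v) \<Rightarrow> ('g \<Rightarrow> 'v) set" where
  "compact_induction G X H V \<rho> = {h \<in> equivariant_funs G H V \<rho>. smooth_fun G X h \<and>
     (\<exists>K. compactin X K \<and> {g. h g \<noteq> 0} \<subseteq> H <#>\<^bsub>G\<^esub> K)}"


section \<open>Hecke modules\<close>

text \<open>Throughout, \<open>J\<close> is a compact open subgroup of \<open>G\<close> and \<open>(W, lam)\<close> a finite-dimensional
  representation of \<open>J\<close>.  The sums below run over cosets and are computed with arbitrary
  representatives, on which the summands do not depend; only finitely many summands are nonzero.\<close>

definition coset_sum :: "'g set set \<Rightarrow> ('g \<Rightarrow> 'v::comm_monoid_add) \<Rightarrow> 'v" where
  "coset_sum C t = (\<Sum>c\<in>{c \<in> C. t (SOME x. x \<in> c) \<noteq> 0}. t (SOME x. x \<in> c))"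

definition hecke_bar ::
    "('g, 'm) monoid_scheme \<Rightarrow> 'g set \<Rightarrow> 'w::complex_vector set \<Rightarrow> ('g \<Rightarrow> 'w \<Rightarrow> 'w) \<Rightarrow>
     ('g \<Rightarrow> ('w \<Rightarrow> complex) \<Rightarrow> 'w \<Rightarrow> complex) set" where
  "hecke_bar G J W lam = {\<Psi>. (\<forall>g. g \<notin> carrier G \<longrightarrow> \<Psi> g = 0) \<and>
     (\<forall>g\<in>carrier G. \<Psi> g \<in> lin_maps (dual_space W) (dual_space W)) \<and>
     (\<forall>j1\<in>J. \<forall>j2\<in>J. \<forall>g\<in>carrier G. \<forall>\<xi>\<in>dual_space W.
        \<Psi> (j1 \<otimes>\<^bsub>G\<^esub> g \<otimes>\<^bsub>G\<^esub> j2) \<xi> =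
        contragredient G W lam j1 (\<Psi> g (contragredient G W lam j2 \<xi>)))}"

definition hecke_algebra ::
    "('g, 'm) monoid_scheme \<Rightarrow> 'g topology \<Rightarrow> 'g set \<Rightarrow> 'w::complex_vector set \<Rightarrow>
     ('g \<Rightarrow> 'w \<Rightarrow> 'w) \<Rightarrow> ('g \<Rightarrow> ('w \<Rightarrow> complex) \<Rightarrow> 'w \<Rightarrow> complex) set" where
  "hecke_algebra G X J W lam = {\<phi> \<in> hecke_bar G J W lam. compactly_supported X \<phi>}"

definition hecke_conv ::
    "('g, 'm) monoid_scheme \<Rightarrow> 'g set \<Rightarrow>
     ('g \<Rightarrow> ('w \<Rightarrow> complex) \<Rightarrow> 'w \<Rightarrow> complex) \<Rightarrow> ('g \<Rightarrow> ('w \<Rightarrow> complex) \<Rightarrow> 'w \<Rightarrow> complex) \<Rightarrow>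
     'g \<Rightarrow> ('w \<Rightarrow> complex) \<Rightarrow> 'w \<Rightarrow> complex" where
  "hecke_conv G J \<phi> \<Psi> = (\<lambda>g. if g \<in> carrier G
     then coset_sum (rcosets\<^bsub>G\<^esub> J) (\<lambda>x. \<phi> (g \<otimes>\<^bsub>G\<^esub> inv\<^bsub>G\<^esub> x) \<circ> \<Psi> x) else 0)"

definition ind_space ::
    "('g, 'm) monoid_scheme \<Rightarrow> 'g topology \<Rightarrow> 'g set \<Rightarrow> 'w::complex_vector set \<Rightarrow>
     ('g \<Rightarrow> 'w \<Rightarrow> 'w) \<Rightarrow> ('g \<Rightarrow> 'w) set" where
  "ind_space G X J W lam = {h \<in> equivariant_funs G J W lam. compactly_supported X h}"

definition hecke_tilde ::
    "('g, 'm) monoid_scheme \<Rightarrow> 'w::complex_vector set \<Rightarrow>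
     ('g \<Rightarrow> ('w \<Rightarrow> complex) \<Rightarrow> 'w \<Rightarrow> complex) \<Rightarrow> 'g \<Rightarrow> 'w \<Rightarrow> 'w" where
  "hecke_tilde G W \<phi> = (\<lambda>g. transpose_end W (\<phi> (inv\<^bsub>G\<^esub> g)))"

definition ind_conv ::
    "('g, 'm) monoid_scheme \<Rightarrow> 'g set \<Rightarrow> ('g \<Rightarrow> 'w::complex_vector \<Rightarrow> 'w) \<Rightarrow>
     ('g \<Rightarrow> 'w) \<Rightarrow> 'g \<Rightarrow> 'w" where
  "ind_conv G J \<psi> h = (\<lambda>g. if g \<in> carrier G
     then coset_sum (lcosets\<^bsub>G\<^esub> J) (\<lambda>x. \<psi> x (h (inv\<^bsub>G\<^esub> x \<otimes>\<^bsub>G\<^esub> g))) else 0)"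

definition Hom_G_ind ::
    "('g, 'm) monoid_scheme \<Rightarrow> 'g topology \<Rightarrow> 'g set \<Rightarrow> 'w::complex_vector set \<Rightarrow>
     ('g \<Rightarrow> 'w \<Rightarrow> 'w) \<Rightarrow> 'v::complex_vector set \<Rightarrow> ('g \<Rightarrow> 'v \<Rightarrow> 'v) \<Rightarrow> (('g \<Rightarrow> 'w) \<Rightarrow> 'v) set" where
  "Hom_G_ind G X J W lam V \<pi> =
     intertwiners G (ind_space G X J W lam) (right_translation G) V \<pi>"

definition hecke_act_ind ::
    "('g, 'm) monoid_scheme \<Rightarrow> 'g topology \<Rightarrow> 'g set \<Rightarrow> 'w::complex_vector set \<Rightarrow>
     ('g \<Rightarrow> 'w \<Rightarrow> 'w) \<Rightarrow> ('g \<Rightarrow> ('w \<Rightarrow> complex) \<Rightarrow> 'w \<Rightarrow> complex) \<Rightarrow>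
     (('g \<Rightarrow> 'w) \<Rightarrow> 'v::complex_vector) \<Rightarrow> ('g \<Rightarrow> 'w) \<Rightarrow> 'v" where
  "hecke_act_ind G X J W lam \<phi> \<alpha> =
     (\<lambda>h. if h \<in> ind_space G X J W lam then \<alpha> (ind_conv G J (hecke_tilde G W \<phi>) h) else 0)"

definition Hom_J ::
    "('g, 'm) monoid_scheme \<Rightarrow> 'g set \<Rightarrow> 'w::complex_vector set \<Rightarrow> ('g \<Rightarrow> 'w \<Rightarrow> 'w) \<Rightarrow>
     'v::complex_vector set \<Rightarrow> ('g \<Rightarrow> 'v \<Rightarrow> 'v) \<Rightarrow> ('w \<Rightarrow> 'v) set" where
  "Hom_J G J W lam V \<pi> = intertwiners (G\<lparr>carrier := J\<rparr>) W lam V \<pi>"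

text \<open>Frobenius reciprocity: \<open>\<alpha>\<close> corresponds to \<open>w \<mapsto> \<alpha> h\<^sub>w\<close>, where \<open>h\<^sub>w\<close> is supported on \<open>J\<close> and
  \<open>h\<^sub>w j = lam j w\<close> there.\<close>

definition frobenius ::
    "'g set \<Rightarrow> 'w::complex_vector set \<Rightarrow> ('g \<Rightarrow> 'w \<Rightarrow> 'w) \<Rightarrow>
     (('g \<Rightarrow> 'w) \<Rightarrow> 'v::complex_vector) \<Rightarrow> 'w \<Rightarrow> 'v" where
  "frobenius J W lam \<alpha> = (\<lambda>w. if w \<in> W then \<alpha> (\<lambda>g. if g \<in> J then lam g w else 0) else 0)"

definition hecke_act ::
    "('g, 'm) monoid_scheme \<Rightarrow> 'g topology \<Rightarrow> 'g set \<Rightarrow> 'w::complex_vector set \<Rightarrow>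
     ('g \<Rightarrow> 'w \<Rightarrow> 'w) \<Rightarrow> 'v::complex_vector set \<Rightarrow> ('g \<Rightarrow> 'v \<Rightarrow> 'v) \<Rightarrow>
     ('g \<Rightarrow> ('w \<Rightarrow> complex) \<Rightarrow> 'w \<Rightarrow> complex) \<Rightarrow> ('w \<Rightarrow> 'v) \<Rightarrow> 'w \<Rightarrow> 'v" where
  "hecke_act G X J W lam V \<pi> \<phi> \<alpha> = frobenius J W lam
     (hecke_act_ind G X J W lam \<phi> (the_inv_into (Hom_G_ind G X J W lam V \<pi>) (frobenius J W lam) \<alpha>))"

definition afforded_character ::
    "('g, 'm) monoid_scheme \<Rightarrow> 'g topology \<Rightarrow> 'g set \<Rightarrow> 'w::complex_vector set \<Rightarrow>
     ('g \<Rightarrow> 'w \<Rightarrow> 'w) \<Rightarrow> 'v::complex_vector set \<Rightarrow> ('g \<Rightarrow> 'v \<Rightarrow> 'v) \<Rightarrow>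
     (('g \<Rightarrow> ('w \<Rightarrow> complex) \<Rightarrow> 'w \<Rightarrow> complex) \<Rightarrow> complex) \<Rightarrow> bool" where
  "afforded_character G X J W lam V \<pi> chi \<longleftrightarrow> cvec.dim (Hom_J G J W lam V \<pi>) = 1 \<and>
     (\<forall>\<phi>\<in>hecke_algebra G X J W lam. \<forall>\<alpha>\<in>Hom_J G J W lam V \<pi>.
        hecke_act G X J W lam V \<pi> \<phi> \<alpha> = chi \<phi> *\<^sub>C \<alpha>)"

definition hecke_bar_eigenspace ::
    "('g, 'm) monoid_scheme \<Rightarrow> 'g topology \<Rightarrow> 'g set \<Rightarrow> 'w::complex_vector set \<Rightarrow>
     ('g \<Rightarrow> 'w \<Rightarrow> 'w) \<Rightarrow> (('g \<Rightarrow> ('w \<Rightarrow> complex) \<Rightarrow> 'w \<Rightarrow> complex) \<Rightarrow> complex) \<Rightarrow>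
     ('g \<Rightarrow> ('w \<Rightarrow> complex) \<Rightarrow> 'w \<Rightarrow> complex) set" where
  "hecke_bar_eigenspace G X J W lam chi =
     {\<Psi> \<in> hecke_bar G J W lam. \<forall>\<phi>\<in>hecke_algebra G X J W lam. hecke_conv G J \<phi> \<Psi> = chi \<phi> *\<^sub>C \<Psi>}"


section \<open>Local fields\<close>

text \<open>The field is given with its normalised absolute value, and the residue field with the
  reduction map on the ring of integers.\<close>

locale nonarch_local_field =
  fixes nv :: "'a::field \<Rightarrow> real" and red :: "'a \<Rightarrow> 'k::field"
  assumes nv_nonneg: "nv x \<ge> 0"
    and nv_eq_0_iff: "nv x = 0 \<longleftrightarrow> x = 0"
    and nv_mult: "nv (x * y) = nv x * nv y"
    and nv_ultrametric: "nv (x + y) \<le> max (nv x) (nv y)"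
    and nv_nontrivial: "\<exists>x. x \<noteq> 0 \<and> nv x \<noteq> 1"
    and nv_locally_compact:
      "locally_compact_space (Metric_space.mtopology UNIV (\<lambda>x y. nv (x - y)))"
    and red_one: "red 1 = 1"
    and red_add: "nv x \<le> 1 \<Longrightarrow> nv y \<le> 1 \<Longrightarrow> red (x + y) = red x + red y"
    and red_mult: "nv x \<le> 1 \<Longrightarrow> nv y \<le> 1 \<Longrightarrow> red (x * y) = red x * red y"
    and red_surj: "\<exists>x. nv x \<le> 1 \<and> red x = z"
    and red_eq_0_iff: "nv x \<le> 1 \<Longrightarrow> red x = 0 \<longleftrightarrow> nv x < 1"
    and nv_normalized:
      "{x. nv x < 1} = {w * y | y. nv y \<le> 1} \<Longrightarrow> nv w = 1 / real (card (UNIV :: 'k set))"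

definition GL :: "nat \<Rightarrow> 'a::field mat monoid" where
  "GL m = units_of (ring_mat TYPE('a) m ())"

definition mat_metric :: "('a::field \<Rightarrow> real) \<Rightarrow> nat \<Rightarrow> 'a mat \<Rightarrow> 'a mat \<Rightarrow> real" where
  "mat_metric nv m A B =
     Max (insert 0 ((\<lambda>(i, j). nv (A $$ (i, j) - B $$ (i, j))) ` ({..<m} \<times> {..<m})))"

definition GL_topology :: "('a::field \<Rightarrow> real) \<Rightarrow> nat \<Rightarrow> 'a mat topology" where
  "GL_topology nv m =
     subtopology (Metric_space.mtopology (carrier_mat m m) (mat_metric nv m)) (carrier (GL m))"

definition mat_units :: "nat \<Rightarrow> 'a::field mat set \<Rightarrow> 'a mat set" where
  "mat_units m S = {A \<in> S. \<exists>B\<in>S. A * B = 1\<^sub>m m \<and> B * A = 1\<^sub>m m}"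

definition integral_mats :: "('a::field \<Rightarrow> real) \<Rightarrow> nat \<Rightarrow> 'a mat set" where
  "integral_mats nv m = {A \<in> carrier_mat m m. \<forall>i<m. \<forall>j<m. nv (A $$ (i, j)) \<le> 1}"

definition GL_int :: "('a::field \<Rightarrow> real) \<Rightarrow> nat \<Rightarrow> 'a mat set" where
  "GL_int nv m = mat_units m (integral_mats nv m)"

definition scalars_GL_int :: "('a::field \<Rightarrow> real) \<Rightarrow> nat \<Rightarrow> 'a mat set" where
  "scalars_GL_int nv m = {c \<cdot>\<^sub>m k | c k. c \<noteq> 0 \<and> k \<in> GL_int nv m}"


subsection \<open>Standard parabolic subgroups\<close>

text \<open>Block structures on \<open>{0..<m}\<close> are encoded by nondecreasing maps \<open>b\<close>, where \<open>b i\<close> is the label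
  of the block containing \<open>i\<close>.  Standard parabolic subgroups are block upper triangular.\<close>

definition std_parabolic :: "nat \<Rightarrow> (nat \<Rightarrow> nat) \<Rightarrow> 'a::field mat set" where
  "std_parabolic m b = {g \<in> carrier (GL m). \<forall>i<m. \<forall>j<m. b j < b i \<longrightarrow> g $$ (i, j) = 0}"

definition unipotent_radical :: "nat \<Rightarrow> (nat \<Rightarrow> nat) \<Rightarrow> 'a::field mat set" where
  "unipotent_radical m b =
     {g \<in> carrier (GL m). \<forall>i<m. \<forall>j<m. b j \<le> b i \<longrightarrow> g $$ (i, j) = (if i = j then 1 else 0)}"

definition cuspidal_rep ::
    "nat \<Rightarrow> 'v::complex_vector set \<Rightarrow> ('k::field mat \<Rightarrow> 'v \<Rightarrow> 'v) \<Rightarrow> bool" where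
  "cuspidal_rep m V \<rho> \<longleftrightarrow>
     (\<forall>b. mono b \<and> (\<exists>i<m. \<exists>j<m. b i \<noteq> b j) \<longrightarrow>
        {v \<in> V. \<forall>u\<in>unipotent_radical m b. \<rho> u v = v} = {0})"

definition diag_block :: "nat \<Rightarrow> nat \<Rightarrow> 'a mat \<Rightarrow> 'a mat" where
  "diag_block f i A = Matrix.mat f f (\<lambda>(r, s). A $$ (i * f + r, i * f + s))"

text \<open>The modulus \<open>p \<mapsto> \<parallel>det Ad p\<parallel>\<close>, on the Lie algebra of the unipotent radical, of the parabolic
  subgroup with \<open>e\<close> diagonal blocks of size \<open>f\<close>: its \<open>(i, j)\<close> block contributes
  \<open>\<parallel>det p\<^sub>i\<parallel>\<^sup>f \<parallel>det p\<^sub>j\<parallel>\<^sup>-\<^sup>f\<close>.\<close>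

definition parabolic_modulus :: "('a::field \<Rightarrow> real) \<Rightarrow> nat \<Rightarrow> nat \<Rightarrow> 'a mat \<Rightarrow> real" where
  "parabolic_modulus nv e f p = (\<Prod>i<e. \<Prod>j\<in>{i<..<e}.
     (nv (Determinant.det (diag_block f i p)) / nv (Determinant.det (diag_block f j p))) ^ f)"

text \<open>Normalised parabolic induction of \<open>\<sigma> 0 \<otimes> \<dots> \<otimes> \<sigma> (e - 1)\<close>, all on the space \<open>T\<close>.\<close>

definition parabolic_induction ::
    "('a::field \<Rightarrow> real) \<Rightarrow> nat \<Rightarrow> nat \<Rightarrow> 't::complex_vector set \<Rightarrow>
     (nat \<Rightarrow> 'a mat \<Rightarrow> 't \<Rightarrow> 't) \<Rightarrow> ('a mat \<Rightarrow> ('t list \<Rightarrow> complex) \<Rightarrow> complex) set" where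
  "parabolic_induction nv e f T \<sigma> =
     {h \<in> equivariant_funs (GL (e * f)) (std_parabolic (e * f) (\<lambda>i. i div f)) (tensor_power e T)
            (\<lambda>p w. complex_of_real (sqrt (parabolic_modulus nv e f p)) *\<^sub>C
                   tensor_op e T (\<lambda>i. \<sigma> i (diag_block f i p)) w).
        smooth_fun (GL (e * f)) (GL_topology nv (e * f)) h}"


section \<open>Level zero discrete series and their types\<close>

definition inflation :: "('a \<Rightarrow> 'k) \<Rightarrow> ('k mat \<Rightarrow> 'x \<Rightarrow> 'x) \<Rightarrow> 'a mat \<Rightarrow> 'x \<Rightarrow> 'x" where
  "inflation red \<rho> A = \<rho> (map_mat red A)"

definition det_twist ::
    "('a::field \<Rightarrow> real) \<Rightarrow> real \<Rightarrow> ('a mat \<Rightarrow> 't::complex_vector \<Rightarrow> 't) \<Rightarrow> 'a mat \<Rightarrow> 't \<Rightarrow> 't" where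
  "det_twist nv a \<tau> g t = complex_of_real (nv (Determinant.det g) powr a) *\<^sub>C \<tau> g t"

definition level_zero_supercuspidal ::
    "('a::field \<Rightarrow> real) \<Rightarrow> ('a \<Rightarrow> 'k::field) \<Rightarrow> nat \<Rightarrow>
     'x::complex_vector set \<Rightarrow> ('k mat \<Rightarrow> 'x \<Rightarrow> 'x) \<Rightarrow> ('a mat \<Rightarrow> 'x \<Rightarrow> 'x) \<Rightarrow>
     't::complex_vector set \<Rightarrow> ('a mat \<Rightarrow> 't \<Rightarrow> 't) \<Rightarrow> bool" where
  "level_zero_supercuspidal nv red f X0 lam0 Lam0 T \<tau> \<longleftrightarrow>
     irreducible_rep (GL f) X0 lam0 \<and> cuspidal_rep f X0 lam0 \<and>
     representation ((GL f)\<lparr>carrier := scalars_GL_int nv f\<rparr>) X0 Lam0 \<and>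
     (\<forall>k\<in>GL_int nv f. \<forall>x\<in>X0. Lam0 k x = inflation red lam0 k x) \<and>
     smooth_rep (GL f) (GL_topology nv f) T \<tau> \<and> irreducible_rep (GL f) T \<tau> \<and>
     isomorphic_rep (GL f) T \<tau>
       (compact_induction (GL f) (GL_topology nv f) (scalars_GL_int nv f) X0 Lam0)
       (right_translation (GL f))"

text \<open>\<open>(V, \<pi>)\<close> is (isomorphic to) the irreducible quotient of the representation induced from
  \<open>\<tau>\<^sup>(\<^sup>1\<^sup>-\<^sup>e\<^sup>)\<^sup>/\<^sup>2 \<otimes> \<dots> \<otimes> \<tau>\<^sup>(\<^sup>e\<^sup>-\<^sup>1\<^sup>)\<^sup>/\<^sup>2\<close>; that quotient is unique for supercuspidal \<open>\<tau>\<close>.\<close>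

definition generalized_steinberg ::
    "('a::field \<Rightarrow> real) \<Rightarrow> nat \<Rightarrow> nat \<Rightarrow> 't::complex_vector set \<Rightarrow> ('a mat \<Rightarrow> 't \<Rightarrow> 't) \<Rightarrow>
     'v::complex_vector set \<Rightarrow> ('a mat \<Rightarrow> 'v \<Rightarrow> 'v) \<Rightarrow> bool" where
  "generalized_steinberg nv e f T \<tau> V \<pi> \<longleftrightarrow> irreducible_rep (GL (e * f)) V \<pi> \<and>
     (let I = parabolic_induction nv e f T (\<lambda>i. det_twist nv ((1 - real e) / 2 + real i) \<tau>)
      in \<exists>A\<in>intertwiners (GL (e * f)) I (right_translation (GL (e * f))) V \<pi>. A ` I = V)"

definition block_order :: "('a::field \<Rightarrow> real) \<Rightarrow> nat \<Rightarrow> nat \<Rightarrow> 'a mat set" where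
  "block_order nv e f = {A \<in> integral_mats nv (e * f).
     \<forall>i<e * f. \<forall>j<e * f. j div f < i div f \<longrightarrow> nv (A $$ (i, j)) < 1}"

definition type_group :: "('a::field \<Rightarrow> real) \<Rightarrow> nat \<Rightarrow> nat \<Rightarrow> 'a mat set" where
  "type_group nv e f = mat_units (e * f) (block_order nv e f)"

text \<open>Reduction of the diagonal blocks is the projection of \<open>type_group nv e f\<close> onto its quotient
  by \<open>1 + \<PP>\<close>, which is a product of \<open>e\<close> copies of \<open>GL f\<close> over the residue field.\<close>

definition type_rep ::
    "('a::field \<Rightarrow> 'k::field) \<Rightarrow> nat \<Rightarrow> nat \<Rightarrow> 'x::complex_vector set \<Rightarrow> ('k mat \<Rightarrow> 'x \<Rightarrow> 'x) \<Rightarrow>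
     'a mat \<Rightarrow> (('x list \<Rightarrow> complex) \<Rightarrow> complex) \<Rightarrow> ('x list \<Rightarrow> complex) \<Rightarrow> complex" where
  "type_rep red e f X0 lam0 j =
     tensor_op e X0 (\<lambda>i. inflation red lam0 (diag_block f i j))"

end

theory Submission
  imports Defs
begin

text \<open>Why the theorem is true.  Write \<open>H\<close> for the Hecke algebra.  The form
  \<open>(\<phi>, \<Psi>) \<mapsto> tr ((\<phi> \<star> \<Psi>) 1)\<close> identifies the space of all bi-equivariant functions with the full
  linear dual of \<open>H\<close>: functions supported on one double coset \<open>J g\<^sup>-\<^sup>1 J\<close> pair perfectly
  with functions on \<open>J g J\<close>, and there is no condition that links different double cosets.  Under
  this identification \<open>\<phi> \<star> \<Psi> = \<chi>(\<phi>) \<Psi>\<close> says that the functional \<open>L\<close> belonging to \<open>\<Psi>\<close> satisfies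
  \<open>L(\<phi>) = \<chi>(\<phi>) L(1)\<close>.  So the eigenspace corresponds to the line spanned by \<open>\<chi>\<close>.

  Uniqueness is proved in this way.  For an operator \<open>A\<close>, the function \<open>double_coset_op A g\<^sup>-\<^sup>1\<close> is an
  element of \<open>H\<close> supported on \<open>J g\<^sup>-\<^sup>1 J\<close>, and \<open>trace_hecke_conv\<close> shows that pairing with it
  gives a nonzero multiple of the trace of \<open>A \<circ> \<Psi> g\<close>.  Hence the number \<open>tr (\<Psi> 1)\<close> determines an
  eigenfunction \<open>\<Psi>\<close> completely (\<open>eigenfunction_unique\<close>).

  For existence no functional has to be inverted: a matrix coefficient does it.  Take \<open>\<alpha> \<noteq> 0\<close>
  in \<open>Hom\<^sub>J(W, V)\<close>, a \<open>J\<close>-equivariant linear map \<open>P\<close> to \<open>W\<close>, defined on vectors of \<open>V\<close> with finite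
  \<open>J\<close>-orbit, and let \<open>\<Psi> g\<close> be the transpose of \<open>P \<circ> \<pi>(g\<^sup>-\<^sup>1) \<circ> \<alpha>\<close>.  Frobenius reciprocity, made explicit,
  gives \<open>\<chi>(\<phi>) \<alpha> w = \<Sum> \<pi>(x\<^sup>-\<^sup>1) \<alpha> (\<phi>\<^sup>~(x) w)\<close>, the sum being over \<open>J\G\<close>
  (\<open>hecke_act_formula\<close>), and substituting this in the convolution shows that \<open>\<Psi>\<close> is an
  eigenfunction (\<open>coefficient_eigenfunction\<close>).  For \<open>P\<close> one takes the average over \<open>J\<close> of a rank one
  map \<open>v \<mapsto> l(v) w\<^sub>0\<close> with \<open>l(\<alpha> w\<^sub>0) = 1\<close>; then \<open>tr (\<Psi> 1) = 1\<close>, so \<open>\<Psi> \<noteq> 0\<close>.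

  All this takes place for a group with a compact open subgroup \<open>J\<close> and a finite-dimensional
  representation of \<open>J\<close> with finite image (\<open>dim_hecke_bar_eigenspace\<close>).  The remaining work is to see
  that the simple type is of this kind.  Compactness of \<open>type_group\<close> comes from that of the ring of
  integers, openness from the ultrametric inequality; the residue field is finite, and \<open>type_rep\<close> is
  a tensor power of representations that factor through a finite matrix group over it.\<close>

(* In this theory the symbol below denotes left cosets only. *)
no_notation subset_mset (infix "<#" 50)


section \<open>Finite-dimensional linear algebra on subspaces\<close>

lemma sum_fun_apply: "(\<Sum>i\<in>I. F i) x = (\<Sum>i\<in>I. F i x :: 'b::comm_monoid_add)"
  by (induction I rule: infinite_finite_induct) auto

lemma linear_from_to_0:
  assumes "linear_from_to V W A" "cvec.subspace V"
  shows "A 0 = 0"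
proof -
  have "A (0 *\<^sub>C 0) = 0 *\<^sub>C A 0"
    using assms cvec.subspace_0 unfolding linear_from_to_def by blast
  then show ?thesis by simp
qed

lemma linear_from_to_sum:
  assumes A: "linear_from_to V W A" and V: "cvec.subspace V" and x: "\<And>i. i \<in> I \<Longrightarrow> x i \<in> V"
  shows "A (\<Sum>i\<in>I. x i) = (\<Sum>i\<in>I. A (x i))"
  using x
proof (induction I rule: infinite_finite_induct)
  case (insert i I)
  have "(\<Sum>i\<in>I. x i) \<in> V"
    using insert.prems by (intro cvec.subspace_sum[OF V]) auto
  moreover have "x i \<in> V"
    using insert.prems by auto
  ultimately have "A (x i + (\<Sum>i\<in>I. x i)) = A (x i) + A (\<Sum>i\<in>I. x i)"
    using A unfolding linear_from_to_def by blast
  then show ?case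
    using insert by simp
qed (simp_all add: linear_from_to_0[OF A V])

lemma lin_mapsD:
  assumes "A \<in> lin_maps V W"
  shows "linear_from_to V W A"
    and "x \<in> V \<Longrightarrow> A x \<in> W"
    and "x \<in> V \<Longrightarrow> y \<in> V \<Longrightarrow> A (x + y) = A x + A y"
    and "x \<in> V \<Longrightarrow> A (c *\<^sub>C x) = c *\<^sub>C A x"
    and "x \<notin> V \<Longrightarrow> A x = 0"
  using assms unfolding lin_maps_def linear_from_to_def by blast+

lemma subspace_dual_space: "cvec.subspace V \<Longrightarrow> cvec.subspace (dual_space V)"
  unfolding cvec.subspace_def dual_space_def lin_maps_def linear_from_to_def
  by (simp add: scaleC_fun_def scaleC_complex_def algebra_simps)

text \<open>Bases extend to the whole space, so coordinates with respect to an extended basis give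
  functionals that do not vanish at a given nonzero vector.\<close>

lemma separating_functional:
  fixes x :: "'v::complex_vector"
  assumes "x \<noteq> 0"
  obtains l where "linear_from_to UNIV UNIV l" "l x = (1 :: complex)"
proof
  let ?B = "cvec.extend_basis {x}"
  let ?l = "\<lambda>v. cvec.representation ?B v x"
  have ind: "cvec.independent {x}"
    using assms by simp
  have B: "cvec.independent ?B" "cvec.span ?B = UNIV"
    using cvec.independent_extend_basis[OF ind] cvec.span_extend_basis[OF ind] by auto
  show "linear_from_to UNIV UNIV ?l"
    by (simp add: linear_from_to_def cvec.representation_add[OF B(1)]
        cvec.representation_scale[OF B(1)] B(2) scaleC_complex_def)
  have "x \<in> ?B"
    using cvec.extend_basis_superset[OF ind] by auto
  then show "?l x = 1"
    using cvec.representation_basis[OF B(1)] by simp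
qed

locale based_space =
  fixes W :: "'w::complex_vector set" and B :: "'w set"
  assumes indep: "cvec.independent B" and finite_basis: "finite B" and span_basis: "cvec.span B = W"
begin

definition dual_basis :: "'w \<Rightarrow> 'w \<Rightarrow> complex" where
  "dual_basis b = (\<lambda>w. if w \<in> W then cvec.representation B w b else 0)"

text \<open>The summand is the diagonal coefficient of \<open>A\<close>, an endomorphism of the dual space, at the dual
  basis vector of \<open>b\<close>.\<close>

definition tr :: "(('w \<Rightarrow> complex) \<Rightarrow> 'w \<Rightarrow> complex) \<Rightarrow> complex" where
  "tr A = (\<Sum>b\<in>B. A (dual_basis b) b)"

lemma subspace_W: "cvec.subspace W"
  using span_basis cvec.subspace_span by metis

lemma basis_in: "b \<in> B \<Longrightarrow> b \<in> W"
  using span_basis cvec.span_base by metis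

lemma expand: "w \<in> W \<Longrightarrow> (\<Sum>b\<in>B. dual_basis b w *\<^sub>C b) = w"
  using cvec.sum_representation_eq[OF indep _ finite_basis] span_basis
  by (simp add: dual_basis_def)

lemma dual_basis_in: "dual_basis b \<in> dual_space W"
  using cvec.subspace_add[OF subspace_W] cvec.subspace_scale[OF subspace_W]
  by (simp add: dual_space_def lin_maps_def linear_from_to_def dual_basis_def span_basis
      cvec.representation_add[OF indep] cvec.representation_scale[OF indep] scaleC_complex_def)

lemma dual_expand:
  assumes "\<xi> \<in> dual_space W"
  shows "(\<Sum>b\<in>B. \<xi> b *\<^sub>C dual_basis b) = \<xi>"
proof
  fix w
  have lin: "linear_from_to W UNIV \<xi>" and off: "w \<notin> W \<Longrightarrow> \<xi> w = 0"
    using lin_mapsD[OF assms[unfolded dual_space_def]] by auto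
  show "(\<Sum>b\<in>B. \<xi> b *\<^sub>C dual_basis b) w = \<xi> w"
  proof (cases "w \<in> W")
    case True
    have "\<xi> w = \<xi> (\<Sum>b\<in>B. dual_basis b w *\<^sub>C b)"
      using expand[OF True] by simp
    also have "\<dots> = (\<Sum>b\<in>B. \<xi> (dual_basis b w *\<^sub>C b))"
      using basis_in cvec.subspace_scale[OF subspace_W]
      by (intro linear_from_to_sum[OF lin subspace_W]) auto
    also have "\<dots> = (\<Sum>b\<in>B. dual_basis b w * \<xi> b)"
      using lin basis_in by (intro sum.cong) (auto simp: linear_from_to_def scaleC_complex_def)
    finally show ?thesis
      by (simp add: sum_fun_apply scaleC_fun_def scaleC_complex_def mult.commute)
  next
    case False
    then show ?thesis
      using off by (simp add: sum_fun_apply scaleC_fun_def scaleC_complex_def dual_basis_def)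
  qed
qed

lemma dual_separates:
  assumes "v \<in> W" "w \<in> W" "\<And>\<xi>. \<xi> \<in> dual_space W \<Longrightarrow> \<xi> v = \<xi> w"
  shows "v = w"
proof -
  have "dual_basis b v = dual_basis b w" for b
    using assms(3)[OF dual_basis_in] .
  then have "(\<Sum>b\<in>B. dual_basis b v *\<^sub>C b) = (\<Sum>b\<in>B. dual_basis b w *\<^sub>C b)"
    by (simp only:)
  then show ?thesis
    by (simp only: expand[OF assms(1)] expand[OF assms(2)])
qed

lemma end_expand:
  assumes A: "A \<in> lin_maps (dual_space W) (dual_space W)" and "\<xi> \<in> dual_space W"
  shows "A \<xi> = (\<Sum>b\<in>B. \<xi> b *\<^sub>C A (dual_basis b))"
proof -
  have "A \<xi> = A (\<Sum>b\<in>B. \<xi> b *\<^sub>C dual_basis b)"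
    using dual_expand[OF assms(2)] by simp
  also have "\<dots> = (\<Sum>b\<in>B. A (\<xi> b *\<^sub>C dual_basis b))"
    using dual_basis_in cvec.subspace_scale[OF subspace_dual_space[OF subspace_W]]
    by (intro linear_from_to_sum[OF lin_mapsD(1)[OF A] subspace_dual_space[OF subspace_W]]) auto
  finally show ?thesis
    using lin_mapsD(4)[OF A dual_basis_in] by simp
qed

lemma tr_comp_commute:
  assumes "A \<in> lin_maps (dual_space W) (dual_space W)" "C \<in> lin_maps (dual_space W) (dual_space W)"
  shows "tr (A \<circ> C) = tr (C \<circ> A)"
proof -
  have "tr (A \<circ> C) = (\<Sum>b\<in>B. \<Sum>c\<in>B. C (dual_basis b) c * A (dual_basis c) b)"
    if "A \<in> lin_maps (dual_space W) (dual_space W)" "C \<in> lin_maps (dual_space W) (dual_space W)" for A C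
    unfolding tr_def
    by (intro sum.cong refl)
      (simp add: end_expand[OF that(1) lin_mapsD(2)[OF that(2) dual_basis_in]] sum_fun_apply
        scaleC_fun_def scaleC_complex_def)
  note eq = this
  show ?thesis
    unfolding eq[OF assms] eq[OF assms(2,1)]
    by (subst sum.swap) (simp add: mult.commute)
qed

definition rank_one :: "'w \<Rightarrow> ('w \<Rightarrow> complex) \<Rightarrow> ('w \<Rightarrow> complex) \<Rightarrow> 'w \<Rightarrow> complex" where
  "rank_one w \<eta> = (\<lambda>\<xi>. if \<xi> \<in> dual_space W then \<xi> w *\<^sub>C \<eta> else 0)"

lemma rank_one_in:
  assumes "\<eta> \<in> dual_space W"
  shows "rank_one w \<eta> \<in> lin_maps (dual_space W) (dual_space W)"
proof -
  have sub: "cvec.subspace (dual_space W)"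
    using subspace_dual_space[OF subspace_W] .
  have "linear_from_to (dual_space W) (dual_space W) (rank_one w \<eta>)"
    unfolding linear_from_to_def
  proof (intro conjI ballI allI)
    show "rank_one w \<eta> \<xi> \<in> dual_space W" if "\<xi> \<in> dual_space W" for \<xi>
      using that assms cvec.subspace_scale[OF sub] by (simp add: rank_one_def)
    show "rank_one w \<eta> (\<xi> + \<zeta>) = rank_one w \<eta> \<xi> + rank_one w \<eta> \<zeta>"
      if "\<xi> \<in> dual_space W" "\<zeta> \<in> dual_space W" for \<xi> \<zeta>
      using that cvec.subspace_add[OF sub] by (simp add: rank_one_def scaleC_add_left)
    show "rank_one w \<eta> (c *\<^sub>C \<xi>) = c *\<^sub>C rank_one w \<eta> \<xi>" if "\<xi> \<in> dual_space W" for c \<xi>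
    proof -
      have "(c *\<^sub>C \<xi>) w = c * \<xi> w"
        by (simp add: scaleC_fun_def scaleC_complex_def)
      then show ?thesis
        using that cvec.subspace_scale[OF sub] by (simp add: rank_one_def scaleC_scaleC)
    qed
  qed
  then show ?thesis
    by (simp add: lin_maps_def rank_one_def)
qed

text \<open>Pairing with rank one operators recovers all matrix coefficients of \<open>C\<close>, so the trace form is
  nondegenerate.\<close>

lemma tr_rank_one:
  assumes C: "C \<in> lin_maps (dual_space W) (dual_space W)" and \<eta>: "\<eta> \<in> dual_space W"
  shows "tr (rank_one w \<eta> \<circ> C) = C \<eta> w"
  using lin_mapsD(2)[OF C dual_basis_in]
  by (simp add: tr_def rank_one_def end_expand[OF C \<eta>] sum_fun_apply scaleC_fun_def scaleC_complex_def
      mult.commute)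

text \<open>A finite-dimensional space is its own bidual: the functional \<open>\<xi> \<mapsto> C \<xi> w\<close> on the dual space is the
  evaluation at a vector, which is written down in terms of the basis.\<close>

lemma transpose_end:
  assumes C: "C \<in> lin_maps (dual_space W) (dual_space W)" and w: "w \<in> W"
  shows "transpose_end W C w \<in> W"
    and "\<xi> \<in> dual_space W \<Longrightarrow> \<xi> (transpose_end W C w) = C \<xi> w"
proof -
  let ?P = "\<lambda>v. v \<in> W \<and> (\<forall>\<xi>\<in>dual_space W. \<xi> v = C \<xi> w)"
  let ?v = "\<Sum>b\<in>B. C (dual_basis b) w *\<^sub>C b"
  have inW: "?v \<in> W"
    using basis_in by (intro cvec.subspace_sum[OF subspace_W] cvec.subspace_scale[OF subspace_W])
  have "\<xi> ?v = C \<xi> w" if \<xi>: "\<xi> \<in> dual_space W" for \<xi>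
  proof -
    note lin = lin_mapsD[OF \<xi>[unfolded dual_space_def]]
    have "\<xi> ?v = (\<Sum>b\<in>B. \<xi> (C (dual_basis b) w *\<^sub>C b))"
      using basis_in cvec.subspace_scale[OF subspace_W]
      by (intro linear_from_to_sum[OF lin(1) subspace_W]) auto
    also have "\<dots> = (\<Sum>b\<in>B. C (dual_basis b) w * \<xi> b)"
      using lin(4)[OF basis_in] by (simp add: scaleC_complex_def)
    finally show ?thesis
      by (simp add: end_expand[OF C \<xi>] sum_fun_apply scaleC_fun_def scaleC_complex_def mult.commute)
  qed
  then have ex: "?P ?v"
    using inW by blast
  have "?P (THE v. ?P v)"
  proof (rule theI[of ?P, OF ex])
    fix v assume v: "?P v"
    show "v = ?v"
      by (rule dual_separates) (use v ex in auto)
  qed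
  then have "?P (transpose_end W C w)"
    unfolding transpose_end_def if_P[OF w] .
  then show "transpose_end W C w \<in> W"
    and "\<xi> \<in> dual_space W \<Longrightarrow> \<xi> (transpose_end W C w) = C \<xi> w"
    by blast+
qed

lemma transpose_end_unique:
  assumes "C \<in> lin_maps (dual_space W) (dual_space W)" "w \<in> W" "v \<in> W"
    and "\<And>\<xi>. \<xi> \<in> dual_space W \<Longrightarrow> \<xi> v = C \<xi> w"
  shows "transpose_end W C w = v"
proof (rule dual_separates)
  show "\<xi> (transpose_end W C w) = \<xi> v" if "\<xi> \<in> dual_space W" for \<xi>
    using that assms(4) transpose_end(2)[OF assms(1,2)] by metis
qed (use assms transpose_end in blast)+

end

lemma based_space_exists:
  assumes "finite S" "cvec.span S = W"
  obtains B where "based_space W B"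
proof -
  obtain B where B: "B \<subseteq> S" "cvec.independent B" "S \<subseteq> cvec.span B"
    using cvec.maximal_independent_subset by blast
  have "cvec.span B = W"
    using B assms by (metis cvec.span_minimal cvec.span_mono cvec.subspace_span subset_antisym)
  then show thesis
    using that B assms(1) finite_subset by (metis based_space.intro)
qed


section \<open>Sums over cosets\<close>

text \<open>The index set of \<open>coset_sum\<close> depends on the summand; a common finite index set makes sums with
  different supports comparable.\<close>

lemma coset_sum_eq:
  assumes "finite D" "D \<subseteq> C" "\<And>c. c \<in> C \<Longrightarrow> c \<notin> D \<Longrightarrow> t (SOME x. x \<in> c) = 0"
  shows "coset_sum C t = (\<Sum>c\<in>D. t (SOME x. x \<in> c))"
  unfolding coset_sum_def using assms by (intro sum.mono_neutral_left) auto

lemma coset_sum_in_subspace: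
  assumes "cvec.subspace V" "\<And>c. c \<in> C \<Longrightarrow> t (SOME x. x \<in> c) \<in> V"
  shows "coset_sum C t \<in> V"
  unfolding coset_sum_def using assms by (intro cvec.subspace_sum) auto

lemma coset_sum_linear:
  assumes L: "linear_from_to V U L" and V: "cvec.subspace V"
    and t: "\<And>c. c \<in> C \<Longrightarrow> t (SOME x. x \<in> c) \<in> V"
    and fin: "finite {c \<in> C. t (SOME x. x \<in> c) \<noteq> 0}"
  shows "L (coset_sum C t) = coset_sum C (\<lambda>x. L (t x))"
proof -
  have "coset_sum C (\<lambda>x. L (t x)) = (\<Sum>c\<in>{c \<in> C. t (SOME x. x \<in> c) \<noteq> 0}. L (t (SOME x. x \<in> c)))"
    using fin linear_from_to_0[OF L V] by (intro coset_sum_eq) auto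
  then show ?thesis
    unfolding coset_sum_def[of C t] using t by (subst linear_from_to_sum[OF L V]) auto
qed

lemma coset_sum_add:
  assumes "finite {c \<in> C. t (SOME x. x \<in> c) \<noteq> 0}" "finite {c \<in> C. s (SOME x. x \<in> c) \<noteq> 0}"
  shows "coset_sum C (\<lambda>x. t x + s x) = coset_sum C t + coset_sum C s"
proof -
  let ?D = "{c \<in> C. t (SOME x. x \<in> c) \<noteq> 0} \<union> {c \<in> C. s (SOME x. x \<in> c) \<noteq> 0}"
  have D: "finite ?D" "?D \<subseteq> C"
    using assms by auto
  show ?thesis
    by (subst (1 2 3) coset_sum_eq[OF D]) (auto simp: sum.distrib)
qed

locale group_with_subgroup = group G for G (structure) +
  fixes J :: "'a set"
  assumes sub: "subgroup J G"
begin

abbreviation coset_rep :: "'a set \<Rightarrow> 'a" where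
  "coset_rep c \<equiv> SOME x. x \<in> c"

lemma J_closed [simp]: "j \<in> J \<Longrightarrow> j \<in> carrier G" "\<one> \<in> J" "j \<in> J \<Longrightarrow> inv j \<in> J"
    "i \<in> J \<Longrightarrow> j \<in> J \<Longrightarrow> i \<otimes> j \<in> J"
  using sub by (auto simp: subgroup.mem_carrier subgroup.one_closed subgroup.m_inv_closed subgroup.m_closed)

lemma cancel_inv [simp]:
  assumes "x \<in> carrier G" "y \<in> carrier G"
  shows "inv x \<otimes> (x \<otimes> y) = y" "x \<otimes> (inv x \<otimes> y) = y"
  using assms by (simp_all add: m_assoc[symmetric])

lemma rep_rcoset:
  assumes "c \<in> rcosets J"
  shows "coset_rep c \<in> c" "coset_rep c \<in> carrier G" "J #> coset_rep c = c"
proof -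
  obtain a where a: "a \<in> carrier G" "c = J #> a"
    using assms by (auto simp: RCOSETS_def)
  then have "a \<in> c"
    using rcos_self[OF a(1) sub] by simp
  then show r: "coset_rep c \<in> c"
    by (rule someI)
  then show "coset_rep c \<in> carrier G"
    using a by (auto simp: r_coset_def)
  show "J #> coset_rep c = c"
    using repr_independence[OF _ a(1) sub] r a by simp
qed

lemma rep_r_coset:
  assumes "x \<in> carrier G"
  obtains j where "j \<in> J" "coset_rep (J #> x) = j \<otimes> x"
proof -
  have "coset_rep (J #> x) \<in> J #> x"
    using rep_rcoset(1) assms by (auto simp: RCOSETS_def)
  then show thesis
    using that by (auto simp: r_coset_def)
qed

lemma finite_rcoset_support:
  assumes "finite F" "F \<subseteq> carrier G"
    and "\<And>x. x \<in> carrier G \<Longrightarrow> t x \<noteq> 0 \<Longrightarrow> x \<in> (\<Union>y\<in>F. J #> y)"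
  shows "finite {c \<in> rcosets J. t (coset_rep c) \<noteq> 0}"
proof (rule finite_subset)
  show "{c \<in> rcosets J. t (coset_rep c) \<noteq> 0} \<subseteq> (\<lambda>y. J #> y) ` F"
  proof
    fix c assume "c \<in> {c \<in> rcosets J. t (coset_rep c) \<noteq> 0}"
    then have c: "c \<in> rcosets J" "t (coset_rep c) \<noteq> 0" by auto
    then obtain y where y: "y \<in> F" "coset_rep c \<in> J #> y"
      using assms(3) rep_rcoset by blast
    then have "J #> y = J #> coset_rep c"
      using repr_independence[OF y(2) _ sub] assms(2) by auto
    then show "c \<in> (\<lambda>y. J #> y) ` F"
      using y rep_rcoset(3)[OF c(1)] by auto
  qed
qed (use assms in auto)

lemma coset_sum_cong:
  assumes "\<And>x. x \<in> carrier G \<Longrightarrow> t x = s x"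
  shows "coset_sum (rcosets J) t = coset_sum (rcosets J) s"
  unfolding coset_sum_def using assms rep_rcoset(2) by (intro sum.cong) auto

text \<open>Right translation by \<open>g\<close> permutes the cosets \<open>J x\<close>.  It does not preserve the chosen
  representatives, but moves them by elements of \<open>J\<close>, which the invariance of \<open>t\<close> absorbs.\<close>

lemma coset_sum_shift:
  assumes g: "g \<in> carrier G" and t: "\<And>j x. j \<in> J \<Longrightarrow> x \<in> carrier G \<Longrightarrow> t (j \<otimes> x) = t x"
  shows "coset_sum (rcosets J) (\<lambda>x. t (x \<otimes> g)) = coset_sum (rcosets J) t"
proof -
  have eq: "t (coset_rep (c #> g)) = t (coset_rep c \<otimes> g)" if c: "c \<in> rcosets J" for c
  proof -
    note r = rep_rcoset[OF c]
    have "c #> g = J #> (coset_rep c \<otimes> g)"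
      using coset_mult_assoc[OF subgroup.subset[OF sub] r(2) g] r(3) by simp
    moreover obtain j where "j \<in> J" "coset_rep (J #> (coset_rep c \<otimes> g)) = j \<otimes> (coset_rep c \<otimes> g)"
      using rep_r_coset[of "coset_rep c \<otimes> g"] r(2) g by blast
    ultimately show ?thesis
      using t r g by simp
  qed
  have mem: "c #> h \<in> rcosets J" "c #> h #> inv h = c" if "c \<in> rcosets J" "h \<in> carrier G" for c h
  proof -
    note r = rep_rcoset[OF that(1)]
    have "c #> h = J #> (coset_rep c \<otimes> h)"
      using coset_mult_assoc[OF subgroup.subset[OF sub] r(2) that(2)] r(3) by simp
    then show "c #> h \<in> rcosets J"
      using r that by (auto simp: RCOSETS_def)
    have "c \<subseteq> carrier G"
      using that(1) subgroup.rcosets_carrier[OF sub is_group] by blast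
    then show "c #> h #> inv h = c"
      using that by (simp add: coset_mult_assoc)
  qed
  have "bij_betw (\<lambda>c. c #> g) {c \<in> rcosets J. t (coset_rep c \<otimes> g) \<noteq> 0} {c \<in> rcosets J. t (coset_rep c) \<noteq> 0}"
  proof (rule bij_betw_byWitness[where f' = "\<lambda>c. c #> inv g"])
    show "\<forall>c\<in>{c \<in> rcosets J. t (coset_rep c \<otimes> g) \<noteq> 0}. c #> g #> inv g = c"
      using mem g by blast
    have unshift: "c #> inv g #> g = c" if "c \<in> rcosets J" for c
      using mem(2)[OF that inv_closed[OF g]] g by simp
    then show "\<forall>c\<in>{c \<in> rcosets J. t (coset_rep c) \<noteq> 0}. c #> inv g #> g = c"
      by blast
    show "(\<lambda>c. c #> g) ` {c \<in> rcosets J. t (coset_rep c \<otimes> g) \<noteq> 0} \<subseteq> {c \<in> rcosets J. t (coset_rep c) \<noteq> 0}"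
      using mem(1) g eq by auto
    show "(\<lambda>c. c #> inv g) ` {c \<in> rcosets J. t (coset_rep c) \<noteq> 0} \<subseteq> {c \<in> rcosets J. t (coset_rep c \<otimes> g) \<noteq> 0}"
    proof
      fix d assume "d \<in> (\<lambda>c. c #> inv g) ` {c \<in> rcosets J. t (coset_rep c) \<noteq> 0}"
      then obtain c where c: "c \<in> rcosets J" "t (coset_rep c) \<noteq> 0" "d = c #> inv g" by blast
      have d: "d \<in> rcosets J"
        using mem(1) c g by simp
      show "d \<in> {c \<in> rcosets J. t (coset_rep c \<otimes> g) \<noteq> 0}"
        using d eq[OF d] unshift[OF c(1)] c by simp
    qed
  qed
  from sum.reindex_bij_betw[OF this, of "\<lambda>c. t (coset_rep c)"] show ?thesis
    unfolding coset_sum_def using eq by (auto intro!: sum.cong)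
qed

lemma coset_sum_supported_on_subgroup:
  assumes "\<And>x. x \<in> carrier G \<Longrightarrow> x \<notin> J \<Longrightarrow> t x = 0" "\<And>j. j \<in> J \<Longrightarrow> t j = v"
  shows "coset_sum (rcosets J) t = v"
proof -
  have J: "coset_rep J \<in> J"
    using J_closed(2) by (rule someI)
  have Jr: "J \<in> rcosets J"
    using coset_join2[OF one_closed sub] by (force simp: RCOSETS_def)
  have "coset_sum (rcosets J) t = (\<Sum>c\<in>{J}. t (coset_rep c))"
  proof (rule coset_sum_eq)
    fix c assume c: "c \<in> rcosets J" "c \<notin> {J}"
    then have "coset_rep c \<notin> J"
      using rep_rcoset[OF c(1)] coset_join2[OF _ sub] by auto
    then show "t (coset_rep c) = 0"
      using assms rep_rcoset[OF c(1)] by simp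
  qed (use Jr in auto)
  then show ?thesis
    using assms(2) J by simp
qed

lemma coset_sum_supported_on_lcoset:
  assumes g: "g \<in> carrier G" and off: "\<And>x. x \<in> carrier G \<Longrightarrow> inv x \<otimes> g \<notin> J \<Longrightarrow> t x = 0"
    and on: "\<And>j. j \<in> J \<Longrightarrow> t (g \<otimes> j) = v"
  shows "coset_sum (lcosets J) t = v"
proof -
  have C: "g <# J \<in> lcosets J"
    using g by (auto simp: LCOSETS_def)
  have r: "\<exists>j\<in>J. coset_rep (a <# J) = a \<otimes> j" if "a \<in> carrier G" for a
    using someI[of "\<lambda>x. x \<in> a <# J", OF lcos_self[OF that sub]] by (auto simp: l_coset_def)
  have "coset_sum (lcosets J) t = (\<Sum>c\<in>{g <# J}. t (coset_rep c))"
  proof (rule coset_sum_eq)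
    fix c assume c: "c \<in> lcosets J" "c \<notin> {g <# J}"
    then obtain a where a: "a \<in> carrier G" "c = a <# J"
      by (auto simp: LCOSETS_def)
    obtain j where j: "j \<in> J" "coset_rep c = a \<otimes> j"
      using r a by blast
    have "inv (coset_rep c) \<otimes> g \<notin> J"
    proof
      assume "inv (coset_rep c) \<otimes> g \<in> J"
      then have "j \<otimes> (inv (coset_rep c) \<otimes> g) \<in> J"
        by (rule J_closed(4)[OF j(1)])
      then have "inv a \<otimes> g \<in> J"
        using j a g by (simp add: inv_mult_group m_assoc[symmetric])
      then have "a \<otimes> (inv a \<otimes> g) \<in> a <# J"
        by (auto simp: l_coset_def)
      then have "g \<in> a <# J"
        using a g by (simp add: m_assoc[symmetric])
      then have "c = g <# J"
        using l_repr_independence[OF _ a(1) sub] a(2) by blast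
      then show False
        using c by simp
    qed
    then show "t (coset_rep c) = 0"
      using off j a by simp
  qed (use C in auto)
  then show ?thesis
    using on r[OF g] by auto
qed

end


section \<open>Averages over a subgroup\<close>

context group_with_subgroup
begin

text \<open>The functions \<open>u\<close> to be averaged are invariant under a subgroup of finite index of \<open>J\<close>.  Such
  an invariance is recorded by a map \<open>a\<close> with finite image through which \<open>u\<close> factors and whose
  fibres are permuted by right translation, so that they are the cosets of a subgroup.\<close>

definition orbit_mean :: "('a \<Rightarrow> 's) \<Rightarrow> ('a \<Rightarrow> 'v::complex_vector) \<Rightarrow> 'v" where
  "orbit_mean a u = (1 / of_nat (card (a ` J))) *\<^sub>C (\<Sum>s\<in>a ` J. u (SOME j. j \<in> J \<and> a j = s))"

definition right_stable :: "('a \<Rightarrow> 's) \<Rightarrow> bool" where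
  "right_stable a \<longleftrightarrow> (\<forall>i\<in>J. \<forall>j\<in>J. \<forall>h\<in>J. a i = a j \<longrightarrow> a (i \<otimes> h) = a (j \<otimes> h))"

text \<open>Right translation permutes the fibres of \<open>a ` J \<rightarrow> b ` J\<close> transitively; they all have the same
  size.\<close>

lemma orbit_mean_refine:
  assumes fin: "finite (a ` J)" and a: "right_stable a" and b: "right_stable b"
    and ab: "\<And>i j. i \<in> J \<Longrightarrow> j \<in> J \<Longrightarrow> a i = a j \<Longrightarrow> b i = b j"
    and bu: "\<And>i j. i \<in> J \<Longrightarrow> j \<in> J \<Longrightarrow> b i = b j \<Longrightarrow> u i = u j"
  shows "orbit_mean a u = orbit_mean b u"
proof -
  define ra where "ra s = (SOME j. j \<in> J \<and> a j = s)" for s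
  define rb where "rb s = (SOME j. j \<in> J \<and> b j = s)" for s
  have ra: "ra (a j) \<in> J" "a (ra (a j)) = a j" if "j \<in> J" for j
    using someI[of "\<lambda>i. i \<in> J \<and> a i = a j" j] that by (auto simp: ra_def)
  have rb: "rb (b j) \<in> J" "b (rb (b j)) = b j" if "j \<in> J" for j
    using someI[of "\<lambda>i. i \<in> J \<and> b i = b j" j] that by (auto simp: rb_def)
  have b_ra: "b (ra (a j)) = b j" if "j \<in> J" for j
    using ab ra that by blast
  define fib where "fib t = {s \<in> a ` J. b (ra s) = t}" for t
  have finb: "finite (b ` J)"
  proof (rule finite_subset)
    show "b ` J \<subseteq> (\<lambda>s. b (ra s)) ` a ` J"
      using b_ra by force
  qed (use fin in auto)
  have le: "card (fib (b i)) \<le> card (fib (b (i \<otimes> h)))" if i: "i \<in> J" and h: "h \<in> J" for i h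
  proof (rule card_inj_on_le)
    show "inj_on (\<lambda>s. a (ra s \<otimes> h)) (fib (b i))"
    proof (rule inj_onI)
      fix s s' assume s: "s \<in> fib (b i)" "s' \<in> fib (b i)" and eq: "a (ra s \<otimes> h) = a (ra s' \<otimes> h)"
      have r: "ra s \<in> J" "a (ra s) = s" "ra s' \<in> J" "a (ra s') = s'"
        using s ra by (auto simp: fib_def)
      have "ra s \<otimes> h \<in> J" "ra s' \<otimes> h \<in> J" "inv h \<in> J"
        using r h by auto
      then have "a (ra s \<otimes> h \<otimes> inv h) = a (ra s' \<otimes> h \<otimes> inv h)"
        using a eq unfolding right_stable_def by blast
      moreover have "ra s \<otimes> h \<otimes> inv h = ra s" "ra s' \<otimes> h \<otimes> inv h = ra s'"
        using r(1,3) h by (simp_all add: m_assoc)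
      ultimately show "s = s'"
        using r(2,4) by (simp only:)
    qed
    show "(\<lambda>s. a (ra s \<otimes> h)) ` fib (b i) \<subseteq> fib (b (i \<otimes> h))"
    proof
      fix s' assume "s' \<in> (\<lambda>s. a (ra s \<otimes> h)) ` fib (b i)"
      then obtain s where s: "s \<in> fib (b i)" "s' = a (ra s \<otimes> h)" by blast
      have r: "ra s \<in> J" "b (ra s) = b i"
        using s ra by (auto simp: fib_def)
      have "b (ra s') = b (ra s \<otimes> h)"
        using b_ra r h s by simp
      also have "\<dots> = b (i \<otimes> h)"
        using b r i h unfolding right_stable_def by blast
      finally show "s' \<in> fib (b (i \<otimes> h))"
        using s r h by (auto simp: fib_def)
    qed
    show "finite (fib (b (i \<otimes> h)))"
      using fin by (auto simp: fib_def)
  qed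
  define m where "m = card (fib (b \<one>))"
  have const: "card (fib t) = m" if "t \<in> b ` J" for t
  proof -
    from that obtain j where j: "j \<in> J" "t = b j" by blast
    show ?thesis
      using le[of \<one> j] le[of j "inv j"] j by (simp add: m_def)
  qed
  have "card (a ` J) = (\<Sum>s\<in>a ` J. 1)" by simp
  also have "\<dots> = (\<Sum>t\<in>b ` J. \<Sum>s\<in>fib t. 1)"
    unfolding fib_def using b_ra by (intro sum.group[symmetric] fin finb) auto
  also have "\<dots> = m * card (b ` J)"
    using const by simp
  finally have card: "card (a ` J) = m * card (b ` J)" .
  have "a ` J \<noteq> {}"
    using J_closed(2) by blast
  then have m0: "m \<noteq> 0"
    using card fin by (metis card_eq_0_iff mult_is_0)
  have u: "u (ra s) = u (rb t)" if "s \<in> fib t" for s t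
    using that ra rb bu by (auto simp: fib_def)
  have "(\<Sum>s\<in>a ` J. u (ra s)) = (\<Sum>t\<in>b ` J. \<Sum>s\<in>fib t. u (ra s))"
    unfolding fib_def using b_ra by (intro sum.group[symmetric] fin finb) auto
  also have "\<dots> = (\<Sum>t\<in>b ` J. \<Sum>s\<in>fib t. u (rb t))"
    using u by (intro sum.cong refl) auto
  also have "\<dots> = (\<Sum>t\<in>b ` J. of_nat m *\<^sub>C u (rb t))"
    using const by (intro sum.cong refl) (simp add: cvec.sum_constant_scale)
  also have "\<dots> = of_nat m *\<^sub>C (\<Sum>t\<in>b ` J. u (rb t))"
    by (simp add: cvec.scale_sum_right)
  finally have "(\<Sum>s\<in>a ` J. u (ra s)) = of_nat m *\<^sub>C (\<Sum>t\<in>b ` J. u (rb t))" .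
  moreover have "(1 / (of_nat m * of_nat (card (b ` J)))) * of_nat m = (1 / of_nat (card (b ` J)) :: complex)"
    using m0 by simp
  ultimately show ?thesis
    by (simp add: orbit_mean_def ra_def[symmetric] rb_def[symmetric] card scaleC_scaleC)
qed

lemma orbit_mean_add: "orbit_mean a (\<lambda>j. u j + v j) = orbit_mean a u + orbit_mean a v"
  by (simp add: orbit_mean_def sum.distrib scaleC_add_right)

lemma orbit_mean_cong:
  assumes "\<And>j. j \<in> J \<Longrightarrow> u j = v j"
  shows "orbit_mean a u = orbit_mean a v"
proof -
  have "(SOME j. j \<in> J \<and> a j = s) \<in> J" if "s \<in> a ` J" for s
    using that someI_ex[of "\<lambda>j. j \<in> J \<and> a j = s"] by blast
  then show ?thesis
    using assms by (simp add: orbit_mean_def)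
qed

lemma orbit_mean_const:
  assumes "finite (a ` J)"
  shows "orbit_mean a (\<lambda>_. v) = v"
proof -
  have "card (a ` J) \<noteq> 0"
    using assms J_closed(2) by (metis card_0_eq empty_iff image_is_empty)
  then show ?thesis
    by (simp add: orbit_mean_def cvec.sum_constant_scale scaleC_scaleC)
qed

lemma orbit_mean_sum:
  assumes "finite (a ` J)"
  shows "orbit_mean a (\<lambda>j. \<Sum>i\<in>I. u i j) = (\<Sum>i\<in>I. orbit_mean a (u i))"
  by (induction I rule: infinite_finite_induct)
    (simp_all add: orbit_mean_const[OF assms] orbit_mean_add)

lemma orbit_mean_linear:
  assumes L: "linear_from_to V U L" and V: "cvec.subspace V" and u: "\<And>j. j \<in> J \<Longrightarrow> u j \<in> V"
  shows "orbit_mean a u \<in> V" "L (orbit_mean a u) = orbit_mean a (\<lambda>j. L (u j))"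
proof -
  have r: "(SOME j. j \<in> J \<and> a j = s) \<in> J" if "s \<in> a ` J" for s
    using that someI_ex[of "\<lambda>j. j \<in> J \<and> a j = s"] by blast
  then have s: "(\<Sum>s\<in>a ` J. u (SOME j. j \<in> J \<and> a j = s)) \<in> V"
    using u by (intro cvec.subspace_sum[OF V]) auto
  then show "orbit_mean a u \<in> V"
    using cvec.subspace_scale[OF V] by (simp add: orbit_mean_def)
  have "L (orbit_mean a u) = (1 / of_nat (card (a ` J))) *\<^sub>C L (\<Sum>s\<in>a ` J. u (SOME j. j \<in> J \<and> a j = s))"
    using L s by (simp add: orbit_mean_def linear_from_to_def)
  then show "L (orbit_mean a u) = orbit_mean a (\<lambda>j. L (u j))"
    using r u by (subst (asm) linear_from_to_sum[OF L V]) (auto simp: orbit_mean_def)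
qed

text \<open>Left translation permutes \<open>J\<close>, so \<open>a\<close> and its translate have the same image; only the
  representatives of the fibres change.\<close>

lemma orbit_mean_left_translate:
  assumes h: "h \<in> J" and au: "\<And>i j. i \<in> J \<Longrightarrow> j \<in> J \<Longrightarrow> a i = a j \<Longrightarrow> u i = u j"
  shows "orbit_mean (\<lambda>j. a (h \<otimes> j)) (\<lambda>j. u (h \<otimes> j)) = orbit_mean a u"
proof -
  have "(\<lambda>j. h \<otimes> j) ` J = J"
  proof
    show "J \<subseteq> (\<lambda>j. h \<otimes> j) ` J"
    proof
      fix j assume "j \<in> J"
      then have "j = h \<otimes> (inv h \<otimes> j)" "inv h \<otimes> j \<in> J"
        using h by (simp_all add: m_assoc[symmetric])
      then show "j \<in> (\<lambda>j. h \<otimes> j) ` J" by blast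
    qed
  qed (use h in auto)
  then have img: "(\<lambda>j. a (h \<otimes> j)) ` J = a ` J"
    by (metis image_image)
  have "u (h \<otimes> (SOME j. j \<in> J \<and> a (h \<otimes> j) = s)) = u (SOME j. j \<in> J \<and> a j = s)" if "s \<in> a ` J" for s
  proof -
    have "s \<in> (\<lambda>j. a (h \<otimes> j)) ` J"
      using that by (simp only: img)
    then have 1: "\<exists>j. j \<in> J \<and> a (h \<otimes> j) = s"
      by (elim imageE) metis
    from that have 2: "\<exists>j. j \<in> J \<and> a j = s"
      by (elim imageE) metis
    note s = someI_ex[OF 1] someI_ex[OF 2]
    show ?thesis
    proof (rule au)
      show "h \<otimes> (SOME j. j \<in> J \<and> a (h \<otimes> j) = s) \<in> J" "(SOME j. j \<in> J \<and> a j = s) \<in> J"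
        using s h J_closed(4) by blast+
      show "a (h \<otimes> (SOME j. j \<in> J \<and> a (h \<otimes> j) = s)) = a (SOME j. j \<in> J \<and> a j = s)"
        by (simp only: conjunct2[OF s(1)] conjunct2[OF s(2)])
    qed
  qed
  then show ?thesis
    by (simp add: orbit_mean_def img)
qed

end


section \<open>Eigenfunctions of a Hecke algebra are determined by a trace\<close>

lemma subspace_lin_maps:
  assumes "cvec.subspace U"
  shows "cvec.subspace (lin_maps V U)"
  unfolding cvec.subspace_def
proof (intro conjI ballI allI)
  show "0 \<in> lin_maps V U"
    using cvec.subspace_0[OF assms] by (simp add: lin_maps_def linear_from_to_def)
  show "A + C \<in> lin_maps V U" if A: "A \<in> lin_maps V U" and C: "C \<in> lin_maps V U" for A C
    using lin_mapsD[OF A] lin_mapsD[OF C] cvec.subspace_add[OF assms]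
    by (simp add: lin_maps_def linear_from_to_def scaleC_add_right algebra_simps)
  show "c *\<^sub>C A \<in> lin_maps V U" if A: "A \<in> lin_maps V U" for c A
    using lin_mapsD[OF A] cvec.subspace_scale[OF assms]
    by (simp add: lin_maps_def linear_from_to_def scaleC_fun_def scaleC_add_right scaleC_scaleC mult.commute)
qed

lemma lin_maps_comp:
  assumes "A \<in> lin_maps V U" "C \<in> lin_maps T V" "cvec.subspace V"
  shows "A \<circ> C \<in> lin_maps T U"
  using lin_mapsD[OF assms(1)] lin_mapsD[OF assms(2)] linear_from_to_0[OF lin_mapsD(1)[OF assms(1)] assms(3)]
  by (simp add: lin_maps_def linear_from_to_def)

context based_space
begin

lemma tr_sum: "tr (\<Sum>i\<in>I. F i) = (\<Sum>i\<in>I. tr (F i))"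
  unfolding tr_def by (subst sum.swap) (simp add: sum_fun_apply)

lemma tr_scale: "tr (c *\<^sub>C A) = c * tr A"
  by (simp add: tr_def scaleC_fun_def scaleC_complex_def sum_distrib_left)

end

text \<open>The topology enters through coverings of compact sets by finitely many cosets.  Finiteness of
  the image of \<open>lam\<close> turns averages of operators over \<open>J\<close> into finite sums.\<close>

locale hecke_pair = group_with_subgroup G J + based_space W B
  for G (structure) and J :: "'a set" and W :: "'w::complex_vector set" and B +
  fixes X :: "'a topology" and lam :: "'a \<Rightarrow> 'w \<Rightarrow> 'w"
  assumes compact_rcosets:
      "compactin X K \<Longrightarrow> \<exists>F. finite F \<and> F \<subseteq> carrier G \<and> K \<subseteq> (\<Union>x\<in>F. J #> x)"
    and compact_lcosets:
      "compactin X K \<Longrightarrow> \<exists>F. finite F \<and> F \<subseteq> carrier G \<and> K \<subseteq> (\<Union>x\<in>F. x <# J)"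
    and rcoset_compact: "x \<in> carrier G \<Longrightarrow> compactin X (J #> x)"
    and lcoset_compact: "x \<in> carrier G \<Longrightarrow> compactin X (x <# J)"
    and lam_rep: "representation (G\<lparr>carrier := J\<rparr>) W lam"
    and finite_lam: "finite (lam ` J)"
begin

abbreviation U :: "('w \<Rightarrow> complex) set" where
  "U \<equiv> dual_space W"

lemma lam_simps:
  assumes "i \<in> J"
  shows "w \<in> W \<Longrightarrow> lam i w \<in> W"
    and "linear_from_to W W (lam i)"
    and "w \<in> W \<Longrightarrow> lam \<one> w = w"
    and "j \<in> J \<Longrightarrow> w \<in> W \<Longrightarrow> lam (i \<otimes> j) w = lam i (lam j w)"
  using lam_rep assms unfolding representation_def linear_from_to_def by auto

lemma lam_inv:
  assumes "i \<in> J" "w \<in> W"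
  shows "lam i (lam (inv i) w) = w" "lam (inv i) (lam i w) = w"
  using lam_simps(3,4)[OF assms(1)] lam_simps(4)[of "inv i" i] assms by (metis J_closed(1,3) r_inv l_inv)+

text \<open>The contragredient representation, extended by zero off the dual space so that
  equivariance becomes an identity between composites in \<open>lin_maps U U\<close>.\<close>

definition dual_act :: "'a \<Rightarrow> ('w \<Rightarrow> complex) \<Rightarrow> 'w \<Rightarrow> complex" where
  "dual_act j \<xi> = (if \<xi> \<in> U then contragredient G W lam j \<xi> else 0)"

lemma dual_act_apply: "\<xi> \<in> U \<Longrightarrow> w \<in> W \<Longrightarrow> dual_act j \<xi> w = \<xi> (lam (inv j) w)"
  by (simp add: dual_act_def contragredient_def)

lemma U_0: "0 \<in> U" and U_sub: "cvec.subspace U"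
  using subspace_dual_space[OF subspace_W] cvec.subspace_0 by auto

lemma dual_eqI:
  assumes "\<xi> \<in> U" "\<eta> \<in> U" "\<And>w. w \<in> W \<Longrightarrow> \<xi> w = \<eta> w"
  shows "\<xi> = \<eta>"
proof
  fix w show "\<xi> w = \<eta> w"
    using assms lin_mapsD(5)[of \<xi> W UNIV w] lin_mapsD(5)[of \<eta> W UNIV w] unfolding dual_space_def by (cases "w \<in> W") auto
qed

lemma dual_act_in:
  assumes j: "j \<in> J"
  shows "dual_act j \<in> lin_maps U U"
proof -
  have inU: "dual_act j \<xi> \<in> U" if "\<xi> \<in> U" for \<xi>
  proof -
    note x = lin_mapsD[OF that[unfolded dual_space_def]]
    have "lam (inv j) v \<in> W" "lam (inv j) (v + w) = lam (inv j) v + lam (inv j) w"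
      "lam (inv j) (c *\<^sub>C v) = c *\<^sub>C lam (inv j) v" if "v \<in> W" "w \<in> W" for v w c
      using lam_simps(1,2)[of "inv j"] j that by (auto simp: linear_from_to_def)
    then show ?thesis
      using x that cvec.subspace_add[OF subspace_W] cvec.subspace_scale[OF subspace_W]
      by (simp add: dual_act_def contragredient_def dual_space_def lin_maps_def linear_from_to_def)
  qed
  then show ?thesis
    using cvec.subspace_add[OF U_sub] cvec.subspace_scale[OF U_sub]
    by (auto simp: lin_maps_def linear_from_to_def dual_act_def contragredient_def scaleC_fun_def scaleC_complex_def)
qed

lemmas dual_act_closed = lin_mapsD(2)[OF dual_act_in]

lemma dual_act_mult:
  assumes "i \<in> J" "j \<in> J"
  shows "dual_act (i \<otimes> j) = dual_act i \<circ> dual_act j"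
proof
  fix \<xi>
  show "dual_act (i \<otimes> j) \<xi> = (dual_act i \<circ> dual_act j) \<xi>"
  proof (cases "\<xi> \<in> U")
    case True
    have "lam (inv (i \<otimes> j)) w = lam (inv j) (lam (inv i) w)" "lam (inv i) w \<in> W" if "w \<in> W" for w
      using assms that lam_simps(1,4) by (simp_all add: inv_mult_group)
    then show ?thesis
      using assms True dual_act_closed by (intro dual_eqI) (auto simp: dual_act_apply)
  next
    case False
    then show ?thesis
      using linear_from_to_0[OF lin_mapsD(1)[OF dual_act_in[OF assms(1)]] U_sub] by (simp add: dual_act_def)
  qed
qed

lemma dual_act_one:
  assumes "A \<in> lin_maps U U"
  shows "dual_act \<one> \<circ> A = A" "A \<circ> dual_act \<one> = A"
proof -
  have one: "dual_act \<one> \<xi> = \<xi>" if "\<xi> \<in> U" for \<xi>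
    using that dual_act_closed[of \<one>] lam_simps(3)[of \<one>] by (intro dual_eqI) (auto simp: dual_act_apply)
  show "dual_act \<one> \<circ> A = A"
  proof
    fix \<xi>
    have "A \<xi> \<in> U"
      using lin_mapsD(2,5)[OF assms, of \<xi>] U_0 by (cases "\<xi> \<in> U") auto
    then show "(dual_act \<one> \<circ> A) \<xi> = A \<xi>"
      using one by simp
  qed
  show "A \<circ> dual_act \<one> = A"
  proof
    fix \<xi>
    show "(A \<circ> dual_act \<one>) \<xi> = A \<xi>"
      using one lin_mapsD(5)[OF assms] linear_from_to_0[OF lin_mapsD(1)[OF assms] U_sub]
      by (cases "\<xi> \<in> U") (auto simp: dual_act_def)
  qed
qed

lemma dual_act_inv:
  assumes "j \<in> J" "A \<in> lin_maps U U"
  shows "dual_act (inv j) \<circ> (dual_act j \<circ> A) = A" "(A \<circ> dual_act j) \<circ> dual_act (inv j) = A"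
    "dual_act j \<circ> (dual_act (inv j) \<circ> A) = A" "(A \<circ> dual_act (inv j)) \<circ> dual_act j = A"
  using assms dual_act_one[OF assms(2)] dual_act_mult[of j "inv j"] dual_act_mult[of "inv j" j]
  by (simp_all add: comp_assoc[symmetric]) (simp_all add: comp_assoc)

lemma finite_dual_act: "finite (dual_act ` J)"
proof (rule finite_subset)
  let ?f = "\<lambda>m \<xi>. if \<xi> \<in> U then (\<lambda>v. if v \<in> W then \<xi> (m v) else 0) else 0"
  show "dual_act ` J \<subseteq> ?f ` lam ` J"
  proof
    fix s assume "s \<in> dual_act ` J"
    then obtain j where j: "j \<in> J" "s = dual_act j" by blast
    have "s = ?f (lam (inv j))"
      unfolding j(2) by (auto simp: dual_act_def contragredient_def fun_eq_iff)
    then show "s \<in> ?f ` lam ` J"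
      using j J_closed(3) by blast
  qed
qed (use finite_lam in auto)

lemma hecke_bar_iff:
  "\<Psi> \<in> hecke_bar G J W lam \<longleftrightarrow> (\<forall>g. g \<notin> carrier G \<longrightarrow> \<Psi> g = 0) \<and>
     (\<forall>g\<in>carrier G. \<Psi> g \<in> lin_maps U U) \<and>
     (\<forall>i\<in>J. \<forall>j\<in>J. \<forall>g\<in>carrier G. \<Psi> (i \<otimes> g \<otimes> j) = dual_act i \<circ> \<Psi> g \<circ> dual_act j)"
proof -
  have "(\<forall>\<xi>\<in>U. \<Psi> (i \<otimes> g \<otimes> j) \<xi> = contragredient G W lam i (\<Psi> g (contragredient G W lam j \<xi>))) \<longleftrightarrow>
     \<Psi> (i \<otimes> g \<otimes> j) = dual_act i \<circ> \<Psi> g \<circ> dual_act j"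
    if ij: "i \<in> J" "j \<in> J" "g \<in> carrier G" and lin: "\<forall>g\<in>carrier G. \<Psi> g \<in> lin_maps U U" for i j g
  proof -
    have P: "\<Psi> g \<in> lin_maps U U" "\<Psi> (i \<otimes> g \<otimes> j) \<in> lin_maps U U"
      using ij lin by auto
    have "(dual_act i \<circ> \<Psi> g \<circ> dual_act j) \<xi> = contragredient G W lam i (\<Psi> g (contragredient G W lam j \<xi>))" if "\<xi> \<in> U" for \<xi>
    proof -
      have "dual_act j \<xi> \<in> U" "\<Psi> g (dual_act j \<xi>) \<in> U"
        using dual_act_closed[OF ij(2) that] lin_mapsD(2)[OF P(1)] by auto
      then show ?thesis
        using that by (simp add: dual_act_def)
    qed
    moreover have "(dual_act i \<circ> \<Psi> g \<circ> dual_act j) \<xi> = \<Psi> (i \<otimes> g \<otimes> j) \<xi>" if "\<xi> \<notin> U" for \<xi>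
      using that lin_mapsD(5)[OF P(2)] linear_from_to_0[OF lin_mapsD(1)[OF P(1)] U_sub]
        linear_from_to_0[OF lin_mapsD(1)[OF dual_act_in[OF ij(1)]] U_sub] by (simp add: dual_act_def)
    ultimately show ?thesis
      by (metis ext)
  qed
  then show ?thesis
    unfolding hecke_bar_def mem_Collect_eq by meson
qed

lemma hecke_barD:
  assumes "\<Psi> \<in> hecke_bar G J W lam"
  shows "g \<notin> carrier G \<Longrightarrow> \<Psi> g = 0" "g \<in> carrier G \<Longrightarrow> \<Psi> g \<in> lin_maps U U"
    "i \<in> J \<Longrightarrow> j \<in> J \<Longrightarrow> g \<in> carrier G \<Longrightarrow> \<Psi> (i \<otimes> g \<otimes> j) = dual_act i \<circ> \<Psi> g \<circ> dual_act j"
  using assms unfolding hecke_bar_iff by blast+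

subsection \<open>Hecke operators supported on one double coset\<close>

text \<open>An element \<open>y\<close> of \<open>J g J\<close> can be written as \<open>i g j\<close> in many ways, but only finitely many pairs
  of operators arise from these.  The sum of \<open>m \<circ> A \<circ> m'\<close> over all of them is bi-equivariant in
  \<open>y\<close> for every \<open>A\<close>, because translation of \<open>y\<close> permutes the pairs.\<close>

definition coset_pairs :: "'a \<Rightarrow> 'a \<Rightarrow> ((('w \<Rightarrow> complex) \<Rightarrow> 'w \<Rightarrow> complex) \<times> (('w \<Rightarrow> complex) \<Rightarrow> 'w \<Rightarrow> complex)) set" where
  "coset_pairs g y = {(dual_act i, dual_act j) | i j. i \<in> J \<and> j \<in> J \<and> y = i \<otimes> g \<otimes> j}"

definition double_coset_op :: "(('w \<Rightarrow> complex) \<Rightarrow> 'w \<Rightarrow> complex) \<Rightarrow> 'a \<Rightarrow> 'a \<Rightarrow> ('w \<Rightarrow> complex) \<Rightarrow> 'w \<Rightarrow> complex" where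
  "double_coset_op A g y = (\<Sum>(m, m')\<in>coset_pairs g y. m \<circ> A \<circ> m')"

lemma finite_coset_pairs: "finite (coset_pairs g y)"
  by (rule finite_subset[of _ "dual_act ` J \<times> dual_act ` J"]) (auto simp: coset_pairs_def finite_dual_act)

lemma coset_pairs_nonempty_iff: "coset_pairs g y \<noteq> {} \<longleftrightarrow> (\<exists>i\<in>J. \<exists>j\<in>J. y = i \<otimes> g \<otimes> j)"
  by (auto simp: coset_pairs_def)

lemma coset_pairs_translate:
  assumes ij: "i \<in> J" "j \<in> J" and g: "g \<in> carrier G" and y: "y \<in> carrier G"
  shows "bij_betw (\<lambda>(m, m'). (dual_act i \<circ> m, m' \<circ> dual_act j)) (coset_pairs g y) (coset_pairs g (i \<otimes> y \<otimes> j))"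
proof (rule bij_betw_byWitness[where f' = "\<lambda>(m, m'). (dual_act (inv i) \<circ> m, m' \<circ> dual_act (inv j))"])
  have *: "(\<lambda>(m, m'). (dual_act i \<circ> m, m' \<circ> dual_act j)) ` coset_pairs g y \<subseteq> coset_pairs g (i \<otimes> y \<otimes> j)"
    if "i \<in> J" "j \<in> J" "y \<in> carrier G" for i j y
  proof
    fix p assume "p \<in> (\<lambda>(m, m'). (dual_act i \<circ> m, m' \<circ> dual_act j)) ` coset_pairs g y"
    then obtain k l where kl: "k \<in> J" "l \<in> J" "y = k \<otimes> g \<otimes> l" "p = (dual_act i \<circ> dual_act k, dual_act l \<circ> dual_act j)"
      by (auto simp: coset_pairs_def)
    then have "p = (dual_act (i \<otimes> k), dual_act (l \<otimes> j))" "i \<otimes> y \<otimes> j = (i \<otimes> k) \<otimes> g \<otimes> (l \<otimes> j)"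
      using that g by (auto simp: dual_act_mult m_assoc)
    then show "p \<in> coset_pairs g (i \<otimes> y \<otimes> j)"
      using kl that J_closed(4) unfolding coset_pairs_def by blast
  qed
  show "(\<lambda>(m, m'). (dual_act i \<circ> m, m' \<circ> dual_act j)) ` coset_pairs g y \<subseteq> coset_pairs g (i \<otimes> y \<otimes> j)"
    using * ij y by blast
  have "inv i \<otimes> (i \<otimes> y \<otimes> j) \<otimes> inv j = y"
    using ij y by (simp add: m_assoc)
  then show "(\<lambda>(m, m'). (dual_act (inv i) \<circ> m, m' \<circ> dual_act (inv j))) ` coset_pairs g (i \<otimes> y \<otimes> j) \<subseteq> coset_pairs g y"
    using *[of "inv i" "inv j" "i \<otimes> y \<otimes> j"] ij y by simp
  show "\<forall>p\<in>coset_pairs g y. (case case p of (m, m') \<Rightarrow> (dual_act i \<circ> m, m' \<circ> dual_act j) of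
      (m, m') \<Rightarrow> (dual_act (inv i) \<circ> m, m' \<circ> dual_act (inv j))) = p"
    using dual_act_inv ij dual_act_in by (auto simp: coset_pairs_def)
  show "\<forall>p\<in>coset_pairs g (i \<otimes> y \<otimes> j). (case case p of (m, m') \<Rightarrow> (dual_act (inv i) \<circ> m, m' \<circ> dual_act (inv j)) of
      (m, m') \<Rightarrow> (dual_act i \<circ> m, m' \<circ> dual_act j)) = p"
    using dual_act_inv ij dual_act_in by (auto simp: coset_pairs_def)
qed

lemma comp_sum_comp:
  assumes a: "a \<in> lin_maps U U" and c: "c \<in> lin_maps U U" and F: "\<And>i. i \<in> I \<Longrightarrow> F i \<in> lin_maps U U"
  shows "a \<circ> (\<Sum>i\<in>I. F i) \<circ> c = (\<Sum>i\<in>I. a \<circ> F i \<circ> c)"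
proof
  fix \<xi>
  have "c \<xi> \<in> U"
    using lin_mapsD(2,5)[OF c] U_0 by (cases "\<xi> \<in> U") auto
  then have "a (\<Sum>i\<in>I. F i (c \<xi>)) = (\<Sum>i\<in>I. a (F i (c \<xi>)))"
    using lin_mapsD(2)[OF F] by (intro linear_from_to_sum[OF lin_mapsD(1)[OF a] U_sub]) auto
  then show "(a \<circ> (\<Sum>i\<in>I. F i) \<circ> c) \<xi> = (\<Sum>i\<in>I. a \<circ> F i \<circ> c) \<xi>"
    by (simp add: sum_fun_apply)
qed

lemma coset_pairs_term_in:
  assumes "A \<in> lin_maps U U" "(m, m') \<in> coset_pairs g y"
  shows "m \<circ> A \<circ> m' \<in> lin_maps U U"
proof -
  obtain i j where "i \<in> J" "j \<in> J" "m = dual_act i" "m' = dual_act j"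
    using assms(2) by (auto simp: coset_pairs_def)
  then show ?thesis
    using lin_maps_comp[OF lin_maps_comp[OF dual_act_in assms(1) U_sub] dual_act_in U_sub] by simp
qed

text \<open>The coset \<open>g J\<close> is compact, hence covered by finitely many \<open>J x\<close>, and \<open>J (J x) = J x\<close>.\<close>

lemma double_coset_compact:
  assumes g: "g \<in> carrier G"
  obtains F where "finite F" "F \<subseteq> carrier G"
    "\<And>i j. i \<in> J \<Longrightarrow> j \<in> J \<Longrightarrow> i \<otimes> g \<otimes> j \<in> (\<Union>x\<in>F. J #> x)"
proof -
  obtain F where F: "finite F" "F \<subseteq> carrier G" "g <# J \<subseteq> (\<Union>x\<in>F. J #> x)"
    using compact_rcosets[OF lcoset_compact[OF g]] by blast
  have "i \<otimes> g \<otimes> j \<in> (\<Union>x\<in>F. J #> x)" if ij: "i \<in> J" "j \<in> J" for i j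
  proof -
    have "g \<otimes> j \<in> g <# J"
      using ij by (auto simp: l_coset_def)
    then obtain x k where x: "x \<in> F" "k \<in> J" "g \<otimes> j = k \<otimes> x"
      using F(3) by (auto simp: r_coset_def)
    then have "i \<otimes> g \<otimes> j = (i \<otimes> k) \<otimes> x" "i \<otimes> k \<in> J" "x \<in> carrier G"
      using ij g F(2) by (auto simp: m_assoc)
    then show ?thesis
      using x by (auto simp: r_coset_def)
  qed
  with that F show thesis by blast
qed

lemma double_coset_op_in_hecke_algebra:
  assumes A: "A \<in> lin_maps U U" and g: "g \<in> carrier G"
  shows "double_coset_op A g \<in> hecke_algebra G X J W lam"
proof -
  have supp: "\<exists>i\<in>J. \<exists>j\<in>J. y = i \<otimes> g \<otimes> j" if "double_coset_op A g y \<noteq> 0" for y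
  proof (rule ccontr)
    assume "\<not> ?thesis"
    then have "coset_pairs g y = {}"
      using coset_pairs_nonempty_iff[of g y] by blast
    then show False
      using that by (simp add: double_coset_op_def)
  qed
  have "double_coset_op A g \<in> hecke_bar G J W lam"
    unfolding hecke_bar_iff
  proof (intro conjI allI impI ballI)
    fix y
    show "double_coset_op A g y = 0" if "y \<notin> carrier G"
    proof (rule ccontr)
      assume "double_coset_op A g y \<noteq> 0"
      then obtain i j where "i \<in> J" "j \<in> J" "y = i \<otimes> g \<otimes> j"
        using supp by blast
      then show False
        using that g by simp
    qed
    show "double_coset_op A g y \<in> lin_maps U U"
      unfolding double_coset_op_def using coset_pairs_term_in[OF A]
      by (intro cvec.subspace_sum[OF subspace_lin_maps[OF U_sub]]) auto
    fix i j assume ij: "i \<in> J" "j \<in> J" and y: "y \<in> carrier G"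
    have "double_coset_op A g (i \<otimes> y \<otimes> j) = (\<Sum>p\<in>coset_pairs g y. dual_act i \<circ> (case p of (m, m') \<Rightarrow> m \<circ> A \<circ> m') \<circ> dual_act j)"
      unfolding double_coset_op_def sum.reindex_bij_betw[OF coset_pairs_translate[OF ij g y], symmetric]
      by (intro sum.cong refl) (auto simp: comp_assoc)
    also have "\<dots> = dual_act i \<circ> double_coset_op A g y \<circ> dual_act j"
      unfolding double_coset_op_def using coset_pairs_term_in[OF A] dual_act_in ij by (intro comp_sum_comp[symmetric]) auto
    finally show "double_coset_op A g (i \<otimes> y \<otimes> j) = dual_act i \<circ> double_coset_op A g y \<circ> dual_act j" .
  qed
  moreover have "compactly_supported X (double_coset_op A g)"
  proof -
    obtain F where F: "finite F" "F \<subseteq> carrier G"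
      "\<And>i j. i \<in> J \<Longrightarrow> j \<in> J \<Longrightarrow> i \<otimes> g \<otimes> j \<in> (\<Union>x\<in>F. J #> x)"
      using double_coset_compact[OF g] by blast
    have "compactin X (\<Union>x\<in>F. J #> x)"
      using F rcoset_compact by (intro compactin_Union) auto
    moreover have "{y. double_coset_op A g y \<noteq> 0} \<subseteq> (\<Union>x\<in>F. J #> x)"
      using supp F(3) by blast
    ultimately show ?thesis
      unfolding compactly_supported_def by blast
  qed
  ultimately show ?thesis
    by (simp add: hecke_algebra_def)
qed

text \<open>The constant that relates the trace pairing on \<open>J g J\<close> to the trace form on operators; the
  sum is over the cosets \<open>J x\<close> contained in \<open>J g J\<close>.\<close>

definition weight :: "'a \<Rightarrow> complex" where
  "weight g = (\<Sum>c\<in>{c \<in> rcosets J. coset_pairs (inv g) (inv (coset_rep c)) \<noteq> {}}. of_nat (card (coset_pairs (inv g) (inv (coset_rep c)))))"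

lemma finite_weight_support:
  assumes g: "g \<in> carrier G"
  shows "finite {c \<in> rcosets J. coset_pairs (inv g) (inv (coset_rep c)) \<noteq> {}}"
proof -
  obtain F where F: "finite F" "F \<subseteq> carrier G"
    "\<And>i j. i \<in> J \<Longrightarrow> j \<in> J \<Longrightarrow> i \<otimes> g \<otimes> j \<in> (\<Union>x\<in>F. J #> x)"
    using double_coset_compact[OF g] by blast
  have "finite {c \<in> rcosets J. card (coset_pairs (inv g) (inv (coset_rep c))) \<noteq> 0}"
  proof (rule finite_rcoset_support[OF F(1,2)])
    fix x assume x: "x \<in> carrier G" "card (coset_pairs (inv g) (inv x)) \<noteq> 0"
    then obtain i j where ij: "i \<in> J" "j \<in> J" "inv x = i \<otimes> inv g \<otimes> j"
      using coset_pairs_nonempty_iff[of "inv g" "inv x"] by (metis card.empty)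
    have "x = inv (inv x)"
      using x by simp
    also have "\<dots> = inv j \<otimes> g \<otimes> inv i"
      using ij g by (simp add: inv_mult_group m_assoc)
    finally show "x \<in> (\<Union>x\<in>F. J #> x)"
      using F(3) ij J_closed(3) by metis
  qed
  then show ?thesis
    by (simp add: finite_coset_pairs)
qed

lemma weight_nonzero:
  assumes g: "g \<in> carrier G"
  shows "weight g \<noteq> 0"
proof -
  let ?D = "{c \<in> rcosets J. coset_pairs (inv g) (inv (coset_rep c)) \<noteq> {}}"
  obtain j where j: "j \<in> J" "coset_rep (J #> g) = j \<otimes> g"
    using rep_r_coset[OF g] by blast
  have "inv (j \<otimes> g) = \<one> \<otimes> inv g \<otimes> inv j"
    using j g by (simp add: inv_mult_group)
  then have "coset_pairs (inv g) (inv (j \<otimes> g)) \<noteq> {}"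
    using coset_pairs_nonempty_iff j J_closed(2,3) by blast
  then have c: "J #> g \<in> ?D"
    using g j by (auto simp: RCOSETS_def)
  have "(\<Sum>c\<in>?D. card (coset_pairs (inv g) (inv (coset_rep c)))) \<noteq> 0"
    using c finite_weight_support[OF g] finite_coset_pairs by (subst sum_eq_0_iff) (auto simp: card_eq_0_iff)
  then show ?thesis
    by (simp only: weight_def of_nat_sum[symmetric] of_nat_eq_0_iff not_False_eq_True)
qed

text \<open>The summands at \<open>x\<close> are \<open>m \<circ> A \<circ> m' \<circ> \<Psi> x\<close>, where \<open>m\<close> and \<open>m'\<close> are the actions of \<open>i\<close> and \<open>j\<close> with
  \<open>j x i = g\<close>.  Under the trace, \<open>m\<close> moves to the right end, and there equivariance turns
  \<open>m' \<circ> \<Psi> x \<circ> m\<close> into \<open>\<Psi> g\<close>: each summand contributes the same trace.\<close>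

lemma trace_hecke_conv:
  assumes \<Psi>: "\<Psi> \<in> hecke_bar G J W lam" and A: "A \<in> lin_maps U U" and g: "g \<in> carrier G"
  shows "tr (hecke_conv G J (double_coset_op A (inv g)) \<Psi> \<one>) = weight g * tr (A \<circ> \<Psi> g)"
proof -
  let ?D = "{c \<in> rcosets J. coset_pairs (inv g) (inv (coset_rep c)) \<noteq> {}}"
  let ?t = "\<lambda>x. double_coset_op A (inv g) (\<one> \<otimes> inv x) \<circ> \<Psi> x"
  have tr_t: "tr (?t x) = of_nat (card (coset_pairs (inv g) (inv x))) * tr (A \<circ> \<Psi> g)" if x: "x \<in> carrier G" for x
  proof -
    have each: "tr (m \<circ> A \<circ> m' \<circ> \<Psi> x) = tr (A \<circ> \<Psi> g)" if mm: "(m, m') \<in> coset_pairs (inv g) (inv x)" for m m'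
    proof -
      obtain i j where ij: "i \<in> J" "j \<in> J" "inv x = i \<otimes> inv g \<otimes> j" "m = dual_act i" "m' = dual_act j"
        using mm by (auto simp: coset_pairs_def)
      have "x = inv (inv x)"
        using x by simp
      also have "\<dots> = inv j \<otimes> g \<otimes> inv i"
        using ij g by (simp add: inv_mult_group m_assoc)
      finally have "j \<otimes> x \<otimes> i = j \<otimes> (inv j \<otimes> g \<otimes> inv i) \<otimes> i"
        by (rule arg_cong)
      then have gx: "g = j \<otimes> x \<otimes> i"
        using ij(1,2) g by (simp add: m_assoc)
      note lin = A dual_act_in[OF ij(1)] dual_act_in[OF ij(2)] hecke_barD(2)[OF \<Psi> x]
      have "tr (m \<circ> A \<circ> m' \<circ> \<Psi> x) = tr (dual_act i \<circ> (A \<circ> (dual_act j \<circ> \<Psi> x)))"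
        by (simp add: ij comp_assoc)
      also have "\<dots> = tr ((A \<circ> (dual_act j \<circ> \<Psi> x)) \<circ> dual_act i)"
        by (intro tr_comp_commute lin lin_maps_comp[OF _ _ U_sub])
      also have "(A \<circ> (dual_act j \<circ> \<Psi> x)) \<circ> dual_act i = A \<circ> \<Psi> g"
        using hecke_barD(3)[OF \<Psi> ij(2,1) x] by (simp add: gx comp_assoc)
      finally show ?thesis .
    qed
    have "?t x = (\<Sum>(m, m')\<in>coset_pairs (inv g) (inv x). m \<circ> A \<circ> m' \<circ> \<Psi> x)"
      using x by (auto simp: double_coset_op_def fun_eq_iff sum_fun_apply case_prod_unfold)
    then have "tr (?t x) = (\<Sum>(m, m')\<in>coset_pairs (inv g) (inv x). tr (m \<circ> A \<circ> m' \<circ> \<Psi> x))"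
      by (simp add: tr_sum case_prod_unfold)
    also have "\<dots> = (\<Sum>p\<in>coset_pairs (inv g) (inv x). tr (A \<circ> \<Psi> g))"
      using each by (intro sum.cong) auto
    finally show ?thesis by simp
  qed
  have "hecke_conv G J (double_coset_op A (inv g)) \<Psi> \<one> = coset_sum (rcosets J) ?t"
    by (simp add: hecke_conv_def)
  also have "\<dots> = (\<Sum>c\<in>?D. ?t (coset_rep c))"
  proof (rule coset_sum_eq[OF finite_weight_support[OF g]])
    fix c assume c: "c \<in> rcosets J" "c \<notin> ?D"
    then show "?t (coset_rep c) = 0"
      using rep_rcoset(2)[OF c(1)] by (auto simp: double_coset_op_def fun_eq_iff)
  qed auto
  finally have "tr (hecke_conv G J (double_coset_op A (inv g)) \<Psi> \<one>) = (\<Sum>c\<in>?D. tr (?t (coset_rep c)))"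
    by (simp add: tr_sum)
  also have "\<dots> = weight g * tr (A \<circ> \<Psi> g)"
    using tr_t rep_rcoset(2) by (simp add: weight_def sum_distrib_right)
  finally show ?thesis .
qed

text \<open>For an eigenfunction, \<open>trace_hecke_conv\<close> expresses the traces of all \<open>A \<circ> \<Psi> g\<close> in terms of the
  single number \<open>tr (\<Psi> \<one>)\<close>, with coefficients that depend on \<open>chi\<close>, \<open>A\<close> and \<open>g\<close> only.\<close>

lemma eigenfunction_unique:
  assumes \<Psi>: "\<Psi> \<in> hecke_bar_eigenspace G X J W lam chi"
    and \<Psi>0: "\<Psi>0 \<in> hecke_bar_eigenspace G X J W lam chi" and one: "tr (\<Psi>0 \<one>) = 1"
  shows "\<Psi> = tr (\<Psi> \<one>) *\<^sub>C \<Psi>0"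
proof
  fix g
  have bar: "\<Psi> \<in> hecke_bar G J W lam" "\<Psi>0 \<in> hecke_bar G J W lam"
    using \<Psi> \<Psi>0 by (auto simp: hecke_bar_eigenspace_def)
  show "\<Psi> g = (tr (\<Psi> \<one>) *\<^sub>C \<Psi>0) g"
  proof (cases "g \<in> carrier G")
    case g: True
    have key: "weight g * tr (A \<circ> \<Phi> g) = chi (double_coset_op A (inv g)) * tr (\<Phi> \<one>)"
      if "A \<in> lin_maps U U" "\<Phi> \<in> hecke_bar_eigenspace G X J W lam chi" for A \<Phi>
    proof -
      have "hecke_conv G J (double_coset_op A (inv g)) \<Phi> = chi (double_coset_op A (inv g)) *\<^sub>C \<Phi>" "\<Phi> \<in> hecke_bar G J W lam"
        using that double_coset_op_in_hecke_algebra[OF that(1), of "inv g"] g by (auto simp: hecke_bar_eigenspace_def)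
      with trace_hecke_conv[OF this(2) that(1) g] show ?thesis
        by (simp add: scaleC_fun_def[of _ \<Phi>] tr_scale)
    qed
    have eq: "\<Psi> g \<eta> w = tr (\<Psi> \<one>) * \<Psi>0 g \<eta> w" if \<eta>: "\<eta> \<in> U" for \<eta> w
    proof -
      note r = rank_one_in[OF \<eta>, of w]
      have "weight g * tr (rank_one w \<eta> \<circ> \<Psi> g) = tr (\<Psi> \<one>) * (weight g * tr (rank_one w \<eta> \<circ> \<Psi>0 g))"
        using key[OF r \<Psi>] key[OF r \<Psi>0] one by simp
      then have "weight g * \<Psi> g \<eta> w = weight g * (tr (\<Psi> \<one>) * \<Psi>0 g \<eta> w)"
        by (simp add: tr_rank_one[OF hecke_barD(2)[OF bar(1) g] \<eta>]
            tr_rank_one[OF hecke_barD(2)[OF bar(2) g] \<eta>])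
      then show ?thesis
        using weight_nonzero[OF g] by simp
    qed
    have "\<Psi> g \<eta> w = tr (\<Psi> \<one>) * \<Psi>0 g \<eta> w" for \<eta> w
      using eq lin_mapsD(5)[OF hecke_barD(2)[OF bar(1) g]] lin_mapsD(5)[OF hecke_barD(2)[OF bar(2) g]]
      by (cases "\<eta> \<in> U") auto
    then show ?thesis
      by (simp add: fun_eq_iff scaleC_fun_def scaleC_complex_def)
  next
    case False
    then show ?thesis
      using hecke_barD(1)[OF bar(1)] hecke_barD(1)[OF bar(2)] by (simp add: scaleC_fun_def fun_eq_iff)
  qed
qed

end


section \<open>Frobenius reciprocity and the character of the Hecke algebra\<close>

locale hecke_module = hecke_pair G J W B X lam
  for G (structure) and J :: "'a set" and W :: "'w::complex_vector set" and B
    and X :: "'a topology" and lam :: "'a \<Rightarrow> 'w \<Rightarrow> 'w" +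
  fixes V :: "'v::complex_vector set" and \<pi> :: "'a \<Rightarrow> 'v \<Rightarrow> 'v"
  assumes V_rep: "representation G V \<pi>"
begin

abbreviation Ind :: "('a \<Rightarrow> 'w) set" where
  "Ind \<equiv> ind_space G X J W lam"

lemma V_sub: "cvec.subspace V"
  using V_rep by (simp add: representation_def)

lemma pi_lin: "g \<in> carrier G \<Longrightarrow> linear_from_to V V (\<pi> g)"
  using V_rep by (simp add: representation_def)

lemma pi_simps:
  assumes "g \<in> carrier G" "v \<in> V"
  shows "\<pi> g v \<in> V" "\<pi> \<one> v = v" "h \<in> carrier G \<Longrightarrow> \<pi> (g \<otimes> h) v = \<pi> g (\<pi> h v)"
  using assms V_rep by (auto simp: representation_def linear_from_to_def)

lemma pi_0: "g \<in> carrier G \<Longrightarrow> \<pi> g 0 = 0"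
  using linear_from_to_0[OF pi_lin V_sub] by simp

lemma Ind_iff:
  "h \<in> Ind \<longleftrightarrow> (\<forall>g. g \<notin> carrier G \<longrightarrow> h g = 0) \<and> (\<forall>g\<in>carrier G. h g \<in> W) \<and>
     (\<forall>j\<in>J. \<forall>g\<in>carrier G. h (j \<otimes> g) = lam j (h g)) \<and> compactly_supported X h"
  by (auto simp: ind_space_def equivariant_funs_def)

lemma IndD:
  assumes "h \<in> Ind"
  shows "g \<notin> carrier G \<Longrightarrow> h g = 0" "g \<in> carrier G \<Longrightarrow> h g \<in> W"
    "j \<in> J \<Longrightarrow> g \<in> carrier G \<Longrightarrow> h (j \<otimes> g) = lam j (h g)" "compactly_supported X h"
  using assms by (auto simp: Ind_iff)

text \<open>In this form compactness of supports passes to translates and inverses by algebra alone.\<close>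

lemma compactly_supported_rcosets:
  "compactly_supported X h \<longleftrightarrow> (\<exists>F. finite F \<and> F \<subseteq> carrier G \<and> {g. h g \<noteq> 0} \<subseteq> (\<Union>x\<in>F. J #> x))"
proof
  assume "compactly_supported X h"
  then show "\<exists>F. finite F \<and> F \<subseteq> carrier G \<and> {g. h g \<noteq> 0} \<subseteq> (\<Union>x\<in>F. J #> x)"
    unfolding compactly_supported_def using compact_rcosets by (meson subset_trans)
next
  assume "\<exists>F. finite F \<and> F \<subseteq> carrier G \<and> {g. h g \<noteq> 0} \<subseteq> (\<Union>x\<in>F. J #> x)"
  then obtain F where F: "finite F" "F \<subseteq> carrier G" "{g. h g \<noteq> 0} \<subseteq> (\<Union>x\<in>F. J #> x)" by blast
  have "compactin X (\<Union>x\<in>F. J #> x)"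
    using F rcoset_compact by (intro compactin_Union) auto
  then show "compactly_supported X h"
    unfolding compactly_supported_def using F(3) by blast
qed

lemma Ind_sub: "cvec.subspace Ind"
  unfolding cvec.subspace_def
proof (intro conjI ballI allI)
  have lam0: "lam j 0 = 0" if "j \<in> J" for j
    using linear_from_to_0[OF lam_simps(2)[OF that] subspace_W] .
  have "compactly_supported X (0 :: 'a \<Rightarrow> 'w)"
    unfolding compactly_supported_rcosets by (intro exI[of _ "{}"]) auto
  then show "0 \<in> Ind"
    using lam0 cvec.subspace_0[OF subspace_W] by (simp add: Ind_iff)
  show "h + k \<in> Ind" if h: "h \<in> Ind" and k: "k \<in> Ind" for h k
  proof -
    obtain K L where KL: "compactin X K" "{g. h g \<noteq> 0} \<subseteq> K" "compactin X L" "{g. k g \<noteq> 0} \<subseteq> L"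
      using IndD(4)[OF h] IndD(4)[OF k] by (auto simp: compactly_supported_def)
    have "h g = 0" if "g \<notin> K" for g
      using KL(2) that by blast
    moreover have "k g = 0" if "g \<notin> L" for g
      using KL(4) that by blast
    ultimately have "compactin X (K \<union> L)" "{g. (h + k) g \<noteq> 0} \<subseteq> K \<union> L"
      using compactin_Un[OF KL(1,3)] by (auto simp: plus_fun_def) (metis add.right_neutral)
    then have "compactly_supported X (h + k)"
      unfolding compactly_supported_def by blast
    moreover have "lam j (v + w) = lam j v + lam j w" if "j \<in> J" "v \<in> W" "w \<in> W" for j v w
      using lam_simps(2)[OF that(1)] that by (simp add: linear_from_to_def)
    ultimately show ?thesis
      using IndD[OF h] IndD[OF k] cvec.subspace_add[OF subspace_W] by (simp add: Ind_iff)
  qed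
  show "c *\<^sub>C h \<in> Ind" if h: "h \<in> Ind" for c h
  proof -
    obtain K where K: "compactin X K" "{g. h g \<noteq> 0} \<subseteq> K"
      using IndD(4)[OF h] by (auto simp: compactly_supported_def)
    have "{g. (c *\<^sub>C h) g \<noteq> 0} \<subseteq> K"
      using K(2) by (auto simp: scaleC_fun_def)
    then have "compactly_supported X (c *\<^sub>C h)"
      unfolding compactly_supported_def using K(1) by blast
    moreover have "lam j (c *\<^sub>C v) = c *\<^sub>C lam j v" if "j \<in> J" "v \<in> W" for j v
      using lam_simps(2)[OF that(1)] that by (simp add: linear_from_to_def)
    ultimately show ?thesis
      using IndD[OF h] cvec.subspace_scale[OF subspace_W] by (simp add: Ind_iff scaleC_fun_def)
  qed
qed

lemma right_translation_Ind:
  assumes h: "h \<in> Ind" and g: "g \<in> carrier G"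
  shows "right_translation G g h \<in> Ind"
proof -
  obtain F where F: "finite F" "F \<subseteq> carrier G" "{x. h x \<noteq> 0} \<subseteq> (\<Union>x\<in>F. J #> x)"
    using IndD(4)[OF h] unfolding compactly_supported_rcosets by blast
  have "{x. right_translation G g h x \<noteq> 0} \<subseteq> (\<Union>x\<in>(\<lambda>y. y \<otimes> inv g) ` F. J #> x)"
  proof
    fix x assume "x \<in> {x. right_translation G g h x \<noteq> 0}"
    then have x: "x \<in> carrier G" "h (x \<otimes> g) \<noteq> 0"
      by (auto simp: right_translation_def split: if_splits)
    then obtain y j where y: "y \<in> F" "j \<in> J" "x \<otimes> g = j \<otimes> y"
      using F(3) by (auto simp: r_coset_def)
    have "x = (x \<otimes> g) \<otimes> inv g"
      using x g by (simp add: m_assoc)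
    also have "\<dots> = j \<otimes> (y \<otimes> inv g)"
      using y F(2) g by (auto simp: m_assoc)
    finally show "x \<in> (\<Union>x\<in>(\<lambda>y. y \<otimes> inv g) ` F. J #> x)"
      using y by (auto simp: r_coset_def)
  qed
  then have "compactly_supported X (right_translation G g h)"
    unfolding compactly_supported_rcosets using F g by (intro exI[of _ "(\<lambda>y. y \<otimes> inv g) ` F"]) auto
  then show ?thesis
    using IndD[OF h] g by (auto simp: Ind_iff right_translation_def m_assoc)
qed

text \<open>These functions, supported on \<open>J\<close>, generate the induced representation: \<open>h\<close> is the sum over
  \<open>J\G\<close> of the translates by \<open>x\<^sup>-\<^sup>1\<close> of \<open>point_function (h x)\<close>.\<close>

definition point_function :: "'w \<Rightarrow> 'a \<Rightarrow> 'w" where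
  "point_function w = (\<lambda>g. if g \<in> J then lam g w else 0)"

lemma point_function_Ind:
  assumes w: "w \<in> W"
  shows "point_function w \<in> Ind"
proof -
  have "{g. point_function w g \<noteq> 0} \<subseteq> (\<Union>x\<in>{\<one>}. J #> x)"
    by (auto simp: point_function_def r_coset_def split: if_splits)
  then have "compactly_supported X (point_function w)"
    unfolding compactly_supported_rcosets by (intro exI[of _ "{\<one>}"]) auto
  moreover have "point_function w (j \<otimes> g) = lam j (point_function w g)" if j: "j \<in> J" and g: "g \<in> carrier G" for j g
  proof (cases "g \<in> J")
    case True
    then show ?thesis
      using j w lam_simps(4) by (simp add: point_function_def)
  next
    case False
    have "j \<otimes> g \<notin> J"
    proof
      assume "j \<otimes> g \<in> J"
      then have "inv j \<otimes> (j \<otimes> g) \<in> J"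
        by (rule J_closed(4)[OF J_closed(3)[OF j]])
      then show False
        using False j g by simp
    qed
    then show ?thesis
      using False linear_from_to_0[OF lam_simps(2)[OF j] subspace_W] by (simp add: point_function_def)
  qed
  ultimately show ?thesis
    using w lam_simps(1) cvec.subspace_0[OF subspace_W] by (auto simp: Ind_iff point_function_def)
qed

lemma Hom_JD:
  assumes "\<alpha> \<in> Hom_J G J W lam V \<pi>"
  shows "linear_from_to W V \<alpha>" "w \<in> W \<Longrightarrow> \<alpha> w \<in> V" "w \<notin> W \<Longrightarrow> \<alpha> w = 0"
    "j \<in> J \<Longrightarrow> w \<in> W \<Longrightarrow> \<alpha> (lam j w) = \<pi> j (\<alpha> w)"
  using assms by (auto simp: Hom_J_def intertwiners_def lin_maps_def linear_from_to_def)

text \<open>The inverse of Frobenius reciprocity, as forced by the decomposition of \<open>h\<close> into translates of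
  functions \<open>point_function w\<close>.\<close>

definition frobenius_inverse :: "('w \<Rightarrow> 'v) \<Rightarrow> ('a \<Rightarrow> 'w) \<Rightarrow> 'v" where
  "frobenius_inverse \<alpha> h = (if h \<in> Ind then coset_sum (rcosets J) (\<lambda>x. \<pi> (inv x) (\<alpha> (h x))) else 0)"

context
  fixes \<alpha>
  assumes \<alpha>: "\<alpha> \<in> Hom_J G J W lam V \<pi>"
begin

lemma alpha_0: "\<alpha> 0 = 0"
  using linear_from_to_0[OF Hom_JD(1)[OF \<alpha>] subspace_W] .

lemma unfold_term_in: "h \<in> Ind \<Longrightarrow> x \<in> carrier G \<Longrightarrow> \<pi> (inv x) (\<alpha> (h x)) \<in> V"
  using pi_simps(1)[of "inv x"] Hom_JD(2)[OF \<alpha>] IndD(2) by simp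

lemma unfold_term_invariant:
  assumes h: "h \<in> Ind" and j: "j \<in> J" and x: "x \<in> carrier G"
  shows "\<pi> (inv (j \<otimes> x)) (\<alpha> (h (j \<otimes> x))) = \<pi> (inv x) (\<alpha> (h x))"
proof -
  have w: "h x \<in> W" "lam j (h x) \<in> W"
    using IndD(2)[OF h x] lam_simps(1)[OF j] by auto
  have "\<pi> (inv (j \<otimes> x)) (\<alpha> (h (j \<otimes> x))) = \<pi> (inv x \<otimes> inv j) (\<pi> j (\<alpha> (h x)))"
    using IndD(3)[OF h j x] Hom_JD(4)[OF \<alpha> j w(1)] j x by (simp add: inv_mult_group)
  also have "\<dots> = \<pi> ((inv x \<otimes> inv j) \<otimes> j) (\<alpha> (h x))"
    using pi_simps(3) Hom_JD(2)[OF \<alpha> w(1)] j x by simp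
  finally show ?thesis
    using j x by (simp add: m_assoc)
qed

lemma unfold_finite:
  assumes h: "h \<in> Ind"
  shows "finite {c \<in> rcosets J. \<pi> (inv (coset_rep c)) (\<alpha> (h (coset_rep c))) \<noteq> 0}"
proof -
  obtain F where F: "finite F" "F \<subseteq> carrier G" "{x. h x \<noteq> 0} \<subseteq> (\<Union>x\<in>F. J #> x)"
    using IndD(4)[OF h] unfolding compactly_supported_rcosets by blast
  show ?thesis
  proof (rule finite_rcoset_support[OF F(1,2)])
    fix x assume "x \<in> carrier G" "\<pi> (inv x) (\<alpha> (h x)) \<noteq> 0"
    then have "h x \<noteq> 0"
      using alpha_0 pi_0 by auto
    then show "x \<in> (\<Union>y\<in>F. J #> y)"
      using F(3) by blast
  qed
qed

lemma frobenius_inverse_in: "frobenius_inverse \<alpha> \<in> Hom_G_ind G X J W lam V \<pi>"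
proof -
  have "frobenius_inverse \<alpha> \<in> lin_maps Ind V"
    unfolding lin_maps_def linear_from_to_def mem_Collect_eq
  proof (intro conjI ballI allI impI)
    show "frobenius_inverse \<alpha> h \<in> V" if "h \<in> Ind" for h
      using that unfold_term_in rep_rcoset(2) by (auto simp: frobenius_inverse_def intro!: coset_sum_in_subspace[OF V_sub])
    show "frobenius_inverse \<alpha> (h + k) = frobenius_inverse \<alpha> h + frobenius_inverse \<alpha> k" if hk: "h \<in> Ind" "k \<in> Ind" for h k
    proof -
      have "\<pi> (inv x) (\<alpha> ((h + k) x)) = \<pi> (inv x) (\<alpha> (h x)) + \<pi> (inv x) (\<alpha> (k x))" if x: "x \<in> carrier G" for x
      proof -
        have "\<alpha> (h x + k x) = \<alpha> (h x) + \<alpha> (k x)" "\<alpha> (h x) \<in> V" "\<alpha> (k x) \<in> V"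
          using Hom_JD(1,2)[OF \<alpha>] IndD(2)[OF hk(1) x] IndD(2)[OF hk(2) x] by (auto simp: linear_from_to_def)
        then show ?thesis
          using pi_lin[of "inv x"] x by (simp add: linear_from_to_def)
      qed
      then have "frobenius_inverse \<alpha> (h + k) =
          coset_sum (rcosets J) (\<lambda>x. \<pi> (inv x) (\<alpha> (h x)) + \<pi> (inv x) (\<alpha> (k x)))"
        using cvec.subspace_add[OF Ind_sub hk] by (auto simp: frobenius_inverse_def intro: coset_sum_cong)
      then show ?thesis
        using coset_sum_add[OF unfold_finite[OF hk(1)] unfold_finite[OF hk(2)]] hk
        by (simp add: frobenius_inverse_def)
    qed
    show "frobenius_inverse \<alpha> (c *\<^sub>C h) = c *\<^sub>C frobenius_inverse \<alpha> h" if h: "h \<in> Ind" for c h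
    proof -
      have "\<pi> (inv x) (\<alpha> ((c *\<^sub>C h) x)) = c *\<^sub>C \<pi> (inv x) (\<alpha> (h x))" if x: "x \<in> carrier G" for x
      proof -
        have "\<alpha> (c *\<^sub>C h x) = c *\<^sub>C \<alpha> (h x)" "\<alpha> (h x) \<in> V"
          using Hom_JD(1,2)[OF \<alpha>] IndD(2)[OF h x] by (auto simp: linear_from_to_def)
        then show ?thesis
          using pi_lin[of "inv x"] x by (simp add: linear_from_to_def scaleC_fun_def)
      qed
      then have "frobenius_inverse \<alpha> (c *\<^sub>C h) = coset_sum (rcosets J) (\<lambda>x. c *\<^sub>C \<pi> (inv x) (\<alpha> (h x)))"
        using cvec.subspace_scale[OF Ind_sub h] by (auto simp: frobenius_inverse_def intro: coset_sum_cong)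
      also have "\<dots> = c *\<^sub>C coset_sum (rcosets J) (\<lambda>x. \<pi> (inv x) (\<alpha> (h x)))"
      proof (rule coset_sum_linear[symmetric, where V = V and U = UNIV, OF _ V_sub _ unfold_finite[OF h]])
        show "linear_from_to V UNIV ((*\<^sub>C) c)"
          by (simp add: linear_from_to_def scaleC_add_right scaleC_scaleC mult.commute)
      qed (use unfold_term_in[OF h] rep_rcoset(2) in auto)
      finally show ?thesis
        using h by (simp add: frobenius_inverse_def)
    qed
    show "frobenius_inverse \<alpha> h = 0" if "h \<notin> Ind" for h
      using that by (simp add: frobenius_inverse_def)
  qed
  moreover have "frobenius_inverse \<alpha> (right_translation G g h) = \<pi> g (frobenius_inverse \<alpha> h)"
    if g: "g \<in> carrier G" and h: "h \<in> Ind" for g h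
  proof -
    let ?t = "\<lambda>x. \<pi> (inv x) (\<alpha> (h x))"
    have eq: "\<pi> (inv x) (\<alpha> (right_translation G g h x)) = \<pi> g (?t (x \<otimes> g))" if x: "x \<in> carrier G" for x
    proof -
      have v: "\<alpha> (h (x \<otimes> g)) \<in> V"
        using Hom_JD(2)[OF \<alpha>] IndD(2)[OF h] x g by simp
      have "\<pi> g (?t (x \<otimes> g)) = \<pi> (g \<otimes> inv (x \<otimes> g)) (\<alpha> (h (x \<otimes> g)))"
        using pi_simps(3)[OF g v, of "inv (x \<otimes> g)"] pi_simps(3)[OF g] v x g by simp
      also have "g \<otimes> inv (x \<otimes> g) = inv x"
        using x g by (simp add: inv_mult_group)
      finally show ?thesis
        using x by (simp add: right_translation_def)
    qed
    have "frobenius_inverse \<alpha> (right_translation G g h) = coset_sum (rcosets J) (\<lambda>x. \<pi> g (?t (x \<otimes> g)))"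
      using right_translation_Ind[OF h g] eq by (auto simp: frobenius_inverse_def intro: coset_sum_cong)
    also have "\<dots> = coset_sum (rcosets J) (\<lambda>x. \<pi> g (?t x))"
      using coset_sum_shift[OF g, of "\<lambda>x. \<pi> g (?t x)"] unfold_term_invariant[OF h] by simp
    also have "\<dots> = \<pi> g (coset_sum (rcosets J) ?t)"
      using unfold_term_in[OF h] rep_rcoset(2)
      by (intro coset_sum_linear[symmetric, OF pi_lin[OF g] V_sub _ unfold_finite[OF h]]) auto
    finally show ?thesis
      using h by (simp add: frobenius_inverse_def)
  qed
  ultimately show ?thesis
    by (simp add: Hom_G_ind_def intertwiners_def)
qed

lemma frobenius_frobenius_inverse: "frobenius J W lam (frobenius_inverse \<alpha>) = \<alpha>"
proof
  fix w
  show "frobenius J W lam (frobenius_inverse \<alpha>) w = \<alpha> w"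
  proof (cases "w \<in> W")
    case True
    have "coset_sum (rcosets J) (\<lambda>x. \<pi> (inv x) (\<alpha> (point_function w x))) = \<alpha> w"
    proof (rule coset_sum_supported_on_subgroup)
      show "\<pi> (inv x) (\<alpha> (point_function w x)) = 0" if "x \<in> carrier G" "x \<notin> J" for x
        using that alpha_0 pi_0 by (simp add: point_function_def)
      show "\<pi> (inv j) (\<alpha> (point_function w j)) = \<alpha> w" if j: "j \<in> J" for j
      proof -
        have "\<pi> (inv j) (\<alpha> (point_function w j)) = \<pi> (inv j \<otimes> j) (\<alpha> w)"
          using Hom_JD(2,4)[OF \<alpha> ] j True pi_simps(3)[of "inv j" "\<alpha> w" j] by (simp add: point_function_def)
        then show ?thesis
          using j pi_simps(2)[OF one_closed Hom_JD(2)[OF \<alpha> True]] by simp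
      qed
    qed
    then show ?thesis
      using True point_function_Ind[OF True] by (simp add: frobenius_def frobenius_inverse_def point_function_def[symmetric])
  qed (use Hom_JD(3)[OF \<alpha>] in \<open>simp add: frobenius_def\<close>)
qed

text \<open>A homomorphism is determined by its values on the generators \<open>point_function w\<close>.\<close>

lemma frobenius_injective:
  assumes \<beta>: "\<beta> \<in> Hom_G_ind G X J W lam V \<pi>" and frob: "frobenius J W lam \<beta> = \<alpha>"
  shows "\<beta> = frobenius_inverse \<alpha>"
proof
  fix h
  note lin = \<beta>[unfolded Hom_G_ind_def intertwiners_def mem_Collect_eq]
  show "\<beta> h = frobenius_inverse \<alpha> h"
  proof (cases "h \<in> Ind")
    case h: True
    let ?D = "{c \<in> rcosets J. h (coset_rep c) \<noteq> 0}"
    let ?k = "\<lambda>c. right_translation G (inv (coset_rep c)) (point_function (h (coset_rep c)))"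
    obtain F where F: "finite F" "F \<subseteq> carrier G" "{x. h x \<noteq> 0} \<subseteq> (\<Union>x\<in>F. J #> x)"
      using IndD(4)[OF h] unfolding compactly_supported_rcosets by blast
    have fin: "finite ?D"
      using F(3) by (intro finite_rcoset_support[OF F(1,2)]) auto
    have r: "coset_rep c \<in> carrier G" "h (coset_rep c) \<in> W" if "c \<in> ?D" for c
      using that rep_rcoset(2) IndD(2)[OF h] by auto
    have k: "?k c \<in> Ind" if "c \<in> ?D" for c
      using right_translation_Ind[OF point_function_Ind] r[OF that] by simp
    have "h = (\<Sum>c\<in>?D. ?k c)"
    proof
      fix g
      show "h g = (\<Sum>c\<in>?D. ?k c) g"
      proof (cases "g \<in> carrier G")
        case g: True
        obtain j where j: "j \<in> J" "coset_rep (J #> g) = j \<otimes> g"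
          using rep_r_coset[OF g] by blast
        have hj: "h (j \<otimes> g) = lam j (h g)" "h g \<in> W"
          using IndD(2,3)[OF h] j g by auto
        have C: "J #> g \<in> rcosets J"
          using g by (auto simp: RCOSETS_def)
        have gin: "?k (J #> g) g = h g"
        proof -
          have "g \<otimes> inv (j \<otimes> g) = inv j"
            using j g by (simp add: inv_mult_group)
          then show ?thesis
            using g j hj lam_inv(2)[OF j(1)] by (simp add: right_translation_def point_function_def)
        qed
        have off: "?k c g = 0" if c: "c \<in> ?D" "c \<noteq> J #> g" for c
        proof -
          have "g \<otimes> inv (coset_rep c) \<notin> J"
          proof
            assume "g \<otimes> inv (coset_rep c) \<in> J"
            then have "(g \<otimes> inv (coset_rep c)) \<otimes> coset_rep c \<in> J #> coset_rep c"
              by (auto simp: r_coset_def)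
            then have "g \<in> J #> coset_rep c"
              using g r(1)[OF c(1)] by (simp add: m_assoc)
            then have "J #> coset_rep c = J #> g"
              using repr_independence[OF _ r(1)[OF c(1)] sub] by simp
            then show False
              using rep_rcoset(3) c by simp
          qed
          then show ?thesis
            using g by (simp add: right_translation_def point_function_def)
        qed
        have "(\<Sum>c\<in>?D. ?k c) g = (\<Sum>c\<in>?D. if c = J #> g then h g else 0)"
          unfolding sum_fun_apply using gin off by (intro sum.cong refl) (simp split: if_split)
        also have "\<dots> = (if J #> g \<in> ?D then h g else 0)"
          using fin by simp
        also have "\<dots> = h g"
        proof -
          have "h g = 0" if "J #> g \<notin> ?D"
          proof -
            have "lam j (h g) = 0"
              using that C j hj by simp
            then show ?thesis
              using lam_inv(2)[OF j(1) hj(2)] linear_from_to_0[OF lam_simps(2) subspace_W] j by simp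
          qed
          then show ?thesis by auto
        qed
        finally show ?thesis by simp
      next
        case False
        then show ?thesis
          using IndD(1)[OF h] by (simp add: sum_fun_apply right_translation_def)
      qed
    qed
    then have "\<beta> h = \<beta> (\<Sum>c\<in>?D. ?k c)"
      by (rule arg_cong)
    also have "\<dots> = (\<Sum>c\<in>?D. \<beta> (?k c))"
      using k lin by (intro linear_from_to_sum[OF lin_mapsD(1) Ind_sub]) auto
    also have "\<dots> = (\<Sum>c\<in>?D. \<pi> (inv (coset_rep c)) (\<alpha> (h (coset_rep c))))"
    proof (intro sum.cong refl)
      fix c assume c: "c \<in> ?D"
      have "\<beta> (point_function (h (coset_rep c))) = \<alpha> (h (coset_rep c))"
        unfolding frob[symmetric] using r[OF c] by (simp add: frobenius_def point_function_def)
      then show "\<beta> (?k c) = \<pi> (inv (coset_rep c)) (\<alpha> (h (coset_rep c)))"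
        using lin r[OF c] point_function_Ind by simp
    qed
    also have "\<dots> = coset_sum (rcosets J) (\<lambda>x. \<pi> (inv x) (\<alpha> (h x)))"
      using rep_rcoset(2) alpha_0 pi_0 by (intro coset_sum_eq[symmetric] fin) auto
    finally show ?thesis
      using h by (simp add: frobenius_inverse_def)
  next
    case False
    then show ?thesis
      using lin_mapsD(5)[OF conjunct1[OF lin]] by (simp add: frobenius_inverse_def)
  qed
qed

lemma inv_frobenius:
  "the_inv_into (Hom_G_ind G X J W lam V \<pi>) (frobenius J W lam) \<alpha> = frobenius_inverse \<alpha>"
  unfolding the_inv_into_def
proof (rule the_equality)
  show "frobenius_inverse \<alpha> \<in> Hom_G_ind G X J W lam V \<pi> \<and> frobenius J W lam (frobenius_inverse \<alpha>) = \<alpha>"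
    using frobenius_inverse_in frobenius_frobenius_inverse by blast
qed (use frobenius_injective in blast)

end

abbreviation tilde :: "('a \<Rightarrow> ('w \<Rightarrow> complex) \<Rightarrow> 'w \<Rightarrow> complex) \<Rightarrow> 'a \<Rightarrow> 'w \<Rightarrow> 'w" where
  "tilde \<equiv> hecke_tilde G W"

lemma tilde_eval:
  assumes "\<phi> \<in> hecke_bar G J W lam" "x \<in> carrier G" "w \<in> W"
  shows "tilde \<phi> x w \<in> W" "\<xi> \<in> U \<Longrightarrow> \<xi> (tilde \<phi> x w) = \<phi> (inv x) \<xi> w"
  using transpose_end[OF hecke_barD(2)[OF assms(1)] assms(3)] assms(2) by (simp_all add: hecke_tilde_def)

lemma tilde_equivariant:
  assumes \<phi>: "\<phi> \<in> hecke_bar G J W lam" and x: "x \<in> carrier G" and w: "w \<in> W" and ij: "i \<in> J" "j \<in> J"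
  shows "tilde \<phi> (i \<otimes> x \<otimes> j) w = lam i (tilde \<phi> x (lam j w))"
proof (rule dual_separates)
  have lw: "lam j w \<in> W"
    using lam_simps(1) ij w by simp
  show "tilde \<phi> (i \<otimes> x \<otimes> j) w \<in> W" "lam i (tilde \<phi> x (lam j w)) \<in> W"
    using tilde_eval(1)[OF \<phi>] lam_simps(1) ij x w lw by auto
  fix \<xi> assume \<xi>: "\<xi> \<in> U"
  have s: "dual_act (inv i) \<xi> \<in> U" "\<phi> (inv x) (dual_act (inv i) \<xi>) \<in> U"
    using dual_act_closed[OF J_closed(3)[OF ij(1)] \<xi>] lin_mapsD(2)[OF hecke_barD(2)[OF \<phi> inv_closed[OF x]]] by auto
  have "\<xi> (tilde \<phi> (i \<otimes> x \<otimes> j) w) = \<phi> (inv (i \<otimes> x \<otimes> j)) \<xi> w"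
    using tilde_eval(2)[OF \<phi> _ w \<xi>] ij x by simp
  also have "inv (i \<otimes> x \<otimes> j) = inv j \<otimes> inv x \<otimes> inv i"
    using ij x by (simp add: inv_mult_group m_assoc)
  also have "\<phi> (inv j \<otimes> inv x \<otimes> inv i) \<xi> w = dual_act (inv j) (\<phi> (inv x) (dual_act (inv i) \<xi>)) w"
    using hecke_barD(3)[OF \<phi>] ij x by simp
  also have "\<dots> = dual_act (inv i) \<xi> (tilde \<phi> x (lam j w))"
    using dual_act_apply[OF s(2) w] tilde_eval(2)[OF \<phi> x lw s(1)] ij by simp
  also have "\<dots> = \<xi> (lam i (tilde \<phi> x (lam j w)))"
    using dual_act_apply[OF \<xi> tilde_eval(1)[OF \<phi> x lw]] ij by simp
  finally show "\<xi> (tilde \<phi> (i \<otimes> x \<otimes> j) w) = \<xi> (lam i (tilde \<phi> x (lam j w)))" .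
qed

lemma tilde_0:
  assumes "\<phi> \<in> hecke_bar G J W lam" "x \<in> carrier G" "w \<in> W" and 0: "w = 0 \<or> \<phi> (inv x) = 0"
  shows "tilde \<phi> x w = 0"
proof (rule dual_separates[OF tilde_eval(1)[OF assms(1-3)] cvec.subspace_0[OF subspace_W]])
  fix \<xi> assume \<xi>: "\<xi> \<in> U"
  have z: "\<eta> 0 = 0" if "\<eta> \<in> U" for \<eta> :: "'w \<Rightarrow> complex"
    using linear_from_to_0[OF lin_mapsD(1)[OF that[unfolded dual_space_def]] subspace_W] .
  have "\<phi> (inv x) \<xi> \<in> U"
    using lin_mapsD(2)[OF hecke_barD(2)[OF assms(1)] \<xi>] assms(2) by simp
  then show "\<xi> (tilde \<phi> x w) = \<xi> 0"
    using tilde_eval(2)[OF assms(1-3) \<xi>] 0 z z[OF \<xi>] by auto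
qed

lemma hecke_algebra_support:
  assumes \<phi>: "\<phi> \<in> hecke_algebra G X J W lam"
  obtains F where "finite F" "F \<subseteq> carrier G"
    "\<And>y. \<phi> y \<noteq> 0 \<Longrightarrow> \<exists>x\<in>F. \<exists>j\<in>J. y = x \<otimes> j"
proof -
  obtain K where K: "compactin X K" "{g. \<phi> g \<noteq> 0} \<subseteq> K"
    using \<phi> by (auto simp: hecke_algebra_def compactly_supported_def)
  obtain F where F: "finite F" "F \<subseteq> carrier G" "K \<subseteq> (\<Union>x\<in>F. x <# J)"
    using compact_lcosets[OF K(1)] by blast
  have "\<exists>x\<in>F. \<exists>j\<in>J. y = x \<otimes> j" if "\<phi> y \<noteq> 0" for y
    using K(2) F(3) that unfolding l_coset_def by blast
  then show thesis
    using that F by blast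
qed

text \<open>The support is contained in the inverse of the support of \<open>\<phi>\<close>, and inversion turns a covering by
  cosets \<open>x J\<close> into one by cosets \<open>J x\<^sup>-\<^sup>1\<close>.\<close>

lemma tilde_column_Ind:
  assumes \<phi>: "\<phi> \<in> hecke_algebra G X J W lam" and w: "w \<in> W"
  shows "(\<lambda>g. if g \<in> carrier G then tilde \<phi> g w else 0) \<in> Ind"
proof -
  let ?h = "\<lambda>g. if g \<in> carrier G then tilde \<phi> g w else 0"
  have bar: "\<phi> \<in> hecke_bar G J W lam"
    using \<phi> by (simp add: hecke_algebra_def)
  obtain F where F: "finite F" "F \<subseteq> carrier G"
    "\<And>y. \<phi> y \<noteq> 0 \<Longrightarrow> \<exists>x\<in>F. \<exists>j\<in>J. y = x \<otimes> j"
    using hecke_algebra_support[OF \<phi>] by blast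
  have "{g. ?h g \<noteq> 0} \<subseteq> (\<Union>x\<in>(\<lambda>x. inv x) ` F. J #> x)"
  proof
    fix g assume "g \<in> {g. ?h g \<noteq> 0}"
    then have g: "g \<in> carrier G" "tilde \<phi> g w \<noteq> 0"
      by (auto split: if_splits)
    then have "\<phi> (inv g) \<noteq> 0"
      using tilde_0[OF bar g(1) w] by blast
    then obtain x j where x: "x \<in> F" "j \<in> J" "inv g = x \<otimes> j"
      using F(3) by blast
    have "g = inv (inv g)"
      using g by simp
    also have "\<dots> = inv j \<otimes> inv x"
      using x F(2) by (auto simp: inv_mult_group)
    finally show "g \<in> (\<Union>x\<in>(\<lambda>x. inv x) ` F. J #> x)"
      using x(1) J_closed(3)[OF x(2)] unfolding r_coset_def by blast
  qed
  then have "compactly_supported X ?h"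
    unfolding compactly_supported_rcosets using F by (intro exI[of _ "(\<lambda>x. inv x) ` F"]) auto
  moreover have "tilde \<phi> (j \<otimes> g) w = lam j (tilde \<phi> g w)" if "j \<in> J" "g \<in> carrier G" for j g
    using tilde_equivariant[OF bar that(2) w that(1) J_closed(2)] lam_simps(3)[OF J_closed(2) w] that by simp
  ultimately show ?thesis
    using tilde_eval(1)[OF bar _ w] by (simp add: Ind_iff)
qed

lemma ind_conv_point_function:
  assumes \<phi>: "\<phi> \<in> hecke_bar G J W lam" and w: "w \<in> W"
  shows "ind_conv G J (tilde \<phi>) (point_function w) = (\<lambda>g. if g \<in> carrier G then tilde \<phi> g w else 0)"
proof
  fix g
  have "coset_sum (lcosets J) (\<lambda>x. tilde \<phi> x (point_function w (inv x \<otimes> g))) = tilde \<phi> g w" if g: "g \<in> carrier G"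
  proof (rule coset_sum_supported_on_lcoset[OF g])
    show "tilde \<phi> x (point_function w (inv x \<otimes> g)) = 0" if "x \<in> carrier G" "inv x \<otimes> g \<notin> J" for x
      using that tilde_0[OF \<phi> that(1), of 0] cvec.subspace_0[OF subspace_W] by (simp add: point_function_def)
    fix j assume j: "j \<in> J"
    have "inv (g \<otimes> j) \<otimes> g = inv j"
      using g j by (simp add: inv_mult_group m_assoc)
    then have "tilde \<phi> (g \<otimes> j) (point_function w (inv (g \<otimes> j) \<otimes> g)) = tilde \<phi> (\<one> \<otimes> g \<otimes> j) (lam (inv j) w)"
      using j g by (simp add: point_function_def)
    also have "\<dots> = lam \<one> (tilde \<phi> g (lam j (lam (inv j) w)))"
      using j g w lam_simps(1)[of "inv j"] by (intro tilde_equivariant[OF \<phi>]) auto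
    also have "\<dots> = tilde \<phi> g w"
      using lam_inv(1)[OF j w] lam_simps(3)[OF J_closed(2)] tilde_eval(1)[OF \<phi> g w] by simp
    finally show "tilde \<phi> (g \<otimes> j) (point_function w (inv (g \<otimes> j) \<otimes> g)) = tilde \<phi> g w" .
  qed
  then show "ind_conv G J (tilde \<phi>) (point_function w) g = (if g \<in> carrier G then tilde \<phi> g w else 0)"
    by (simp add: ind_conv_def)
qed

text \<open>Convolution of \<open>tilde \<phi>\<close> with \<open>point_function w\<close> is the function \<open>x \<mapsto> tilde \<phi> x w\<close>, at which
  \<open>frobenius_inverse \<alpha>\<close> is then evaluated.\<close>

lemma hecke_act_formula:
  assumes \<phi>: "\<phi> \<in> hecke_algebra G X J W lam" and \<alpha>: "\<alpha> \<in> Hom_J G J W lam V \<pi>" and w: "w \<in> W"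
  shows "hecke_act G X J W lam V \<pi> \<phi> \<alpha> w = coset_sum (rcosets J) (\<lambda>x. \<pi> (inv x) (\<alpha> (tilde \<phi> x w)))"
    and "finite {c \<in> rcosets J. \<pi> (inv (coset_rep c)) (\<alpha> (tilde \<phi> (coset_rep c) w)) \<noteq> 0}"
proof -
  let ?h = "\<lambda>g. if g \<in> carrier G then tilde \<phi> g w else 0"
  have bar: "\<phi> \<in> hecke_bar G J W lam"
    using \<phi> by (simp add: hecke_algebra_def)
  have "hecke_act G X J W lam V \<pi> \<phi> \<alpha> w = frobenius_inverse \<alpha> (ind_conv G J (tilde \<phi>) (point_function w))"
    using w point_function_Ind[OF w]
    by (simp add: hecke_act_def inv_frobenius[OF \<alpha>] frobenius_def hecke_act_ind_def point_function_def[symmetric])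
  also have "\<dots> = coset_sum (rcosets J) (\<lambda>x. \<pi> (inv x) (\<alpha> (?h x)))"
    using tilde_column_Ind[OF \<phi> w] by (simp add: ind_conv_point_function[OF bar w] frobenius_inverse_def)
  also have "\<dots> = coset_sum (rcosets J) (\<lambda>x. \<pi> (inv x) (\<alpha> (tilde \<phi> x w)))"
    by (rule coset_sum_cong) simp
  finally show "hecke_act G X J W lam V \<pi> \<phi> \<alpha> w = coset_sum (rcosets J) (\<lambda>x. \<pi> (inv x) (\<alpha> (tilde \<phi> x w)))" .
  have "{c \<in> rcosets J. \<pi> (inv (coset_rep c)) (\<alpha> (?h (coset_rep c))) \<noteq> 0} =
      {c \<in> rcosets J. \<pi> (inv (coset_rep c)) (\<alpha> (tilde \<phi> (coset_rep c) w)) \<noteq> 0}"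
    using rep_rcoset(2) by auto
  then show "finite {c \<in> rcosets J. \<pi> (inv (coset_rep c)) (\<alpha> (tilde \<phi> (coset_rep c) w)) \<noteq> 0}"
    using unfold_finite[OF \<alpha> tilde_column_Ind[OF \<phi> w]] by simp
qed

end


section \<open>Existence of the eigenfunction\<close>

context hecke_module
begin

text \<open>On vectors with finite \<open>J\<close>-orbit, averages over \<open>J\<close> are finite sums.  All translates of the
  image of \<open>\<alpha>\<close> consist of such vectors, see \<open>translate_orbit_finite\<close>.\<close>

definition orbit_finite :: "'v set" where
  "orbit_finite = {v \<in> V. finite ((\<lambda>j. \<pi> (inv j) v) ` J)}"

lemma orbit_finite_sub: "cvec.subspace orbit_finite"
  unfolding cvec.subspace_def
proof (intro conjI ballI allI)
  have lin: "\<pi> (inv j) (v + w) = \<pi> (inv j) v + \<pi> (inv j) w" "\<pi> (inv j) (c *\<^sub>C v) = c *\<^sub>C \<pi> (inv j) v"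
    if "j \<in> J" "v \<in> V" "w \<in> V" for j v w c
    using pi_lin[of "inv j"] that by (auto simp: linear_from_to_def)
  have "finite ((\<lambda>j. \<pi> (inv j) 0) ` J)"
    by (rule finite_subset[of _ "{0}"]) (auto simp: pi_0)
  then show "0 \<in> orbit_finite"
    using cvec.subspace_0[OF V_sub] by (simp add: orbit_finite_def)
  show "v + w \<in> orbit_finite" if v: "v \<in> orbit_finite" and w: "w \<in> orbit_finite" for v w
  proof -
    have V: "v \<in> V" "w \<in> V"
      using v w by (auto simp: orbit_finite_def)
    have "finite ((\<lambda>j. \<pi> (inv j) (v + w)) ` J)"
    proof (rule finite_subset)
      show "(\<lambda>j. \<pi> (inv j) (v + w)) ` J \<subseteq>
          (\<lambda>(x, y). x + y) ` ((\<lambda>j. \<pi> (inv j) v) ` J \<times> (\<lambda>j. \<pi> (inv j) w) ` J)"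
        using lin(1)[OF _ V] by force
    qed (use v w in \<open>simp add: orbit_finite_def\<close>)
    then show ?thesis
      using cvec.subspace_add[OF V_sub V] by (simp add: orbit_finite_def)
  qed
  show "c *\<^sub>C v \<in> orbit_finite" if v: "v \<in> orbit_finite" for c v
  proof -
    have V: "v \<in> V"
      using v by (auto simp: orbit_finite_def)
    have "finite ((\<lambda>j. \<pi> (inv j) (c *\<^sub>C v)) ` J)"
    proof (rule finite_subset)
      show "(\<lambda>j. \<pi> (inv j) (c *\<^sub>C v)) ` J \<subseteq> (\<lambda>x. c *\<^sub>C x) ` ((\<lambda>j. \<pi> (inv j) v) ` J)"
        using lin(2)[OF _ V V] by force
    qed (use v in \<open>simp add: orbit_finite_def\<close>)
    then show ?thesis
      using cvec.subspace_scale[OF V_sub V] by (simp add: orbit_finite_def)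
  qed
qed

text \<open>The coset \<open>J g\<close> is covered by finitely many \<open>x J\<close>, and \<open>J\<close> acts on the image of \<open>\<alpha>\<close> through the
  finite set \<open>lam ` J\<close>.\<close>

lemma translate_orbit_finite:
  assumes \<alpha>: "\<alpha> \<in> Hom_J G J W lam V \<pi>" and g: "g \<in> carrier G" and w: "w \<in> W"
  shows "\<pi> g (\<alpha> w) \<in> orbit_finite"
proof -
  have aw: "\<alpha> w \<in> V"
    using Hom_JD(2)[OF \<alpha> w] .
  obtain F where F: "finite F" "F \<subseteq> carrier G" "J #> g \<subseteq> (\<Union>x\<in>F. x <# J)"
    using compact_lcosets[OF rcoset_compact[OF g]] by blast
  have "(\<lambda>j. \<pi> (inv j) (\<pi> g (\<alpha> w))) ` J \<subseteq> (\<Union>x\<in>F. (\<lambda>m. \<pi> x (\<alpha> (m w))) ` lam ` J)"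
  proof
    fix v assume "v \<in> (\<lambda>j. \<pi> (inv j) (\<pi> g (\<alpha> w))) ` J"
    then obtain j where j: "j \<in> J" "v = \<pi> (inv j) (\<pi> g (\<alpha> w))" by blast
    have "inv j \<otimes> g \<in> J #> g"
      using J_closed(3)[OF j(1)] by (auto simp: r_coset_def)
    then obtain x i where x: "x \<in> F" "i \<in> J" "inv j \<otimes> g = x \<otimes> i"
      using F(3) by (auto simp: l_coset_def)
    have xc: "x \<in> carrier G"
      using x F by auto
    have "v = \<pi> (inv j \<otimes> g) (\<alpha> w)"
      using j g pi_simps(3)[of "inv j" "\<alpha> w" g] aw by simp
    also have "\<dots> = \<pi> x (\<pi> i (\<alpha> w))"
      unfolding x(3) using pi_simps(3)[OF xc aw] x by simp
    also have "\<dots> = \<pi> x (\<alpha> (lam i w))"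
      using Hom_JD(4)[OF \<alpha> x(2) w] by simp
    finally show "v \<in> (\<Union>x\<in>F. (\<lambda>m. \<pi> x (\<alpha> (m w))) ` lam ` J)"
      using x by blast
  qed
  moreover have "finite (\<Union>x\<in>F. (\<lambda>m. \<pi> x (\<alpha> (m w))) ` lam ` J)"
    using F(1) finite_lam by blast
  ultimately show ?thesis
    using pi_simps(1)[OF g aw] finite_subset by (auto simp: orbit_finite_def)
qed

text \<open>Off \<open>W\<close> the values of \<open>lam\<close> are arbitrary and not multiplicative; the restriction to \<open>W\<close> depends
  on \<open>j\<close> in a right stable way.\<close>

definition lam_on :: "'a \<Rightarrow> 'w \<Rightarrow> 'w" where
  "lam_on j = (\<lambda>w. if w \<in> W then lam j w else 0)"

lemma lam_on_eqD: "lam_on i = lam_on j \<Longrightarrow> w \<in> W \<Longrightarrow> lam i w = lam j w"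
  by (metis lam_on_def)

lemma finite_lam_on: "finite (lam_on ` J)"
  by (rule finite_subset[of _ "(\<lambda>m w. if w \<in> W then m w else 0) ` lam ` J"])
    (auto simp: lam_on_def finite_lam)

lemma lam_on_right_stable: "right_stable lam_on"
  unfolding right_stable_def
proof (intro ballI impI)
  fix i j h assume ij: "i \<in> J" "j \<in> J" "h \<in> J" "lam_on i = lam_on j"
  have "lam (i \<otimes> h) w = lam (j \<otimes> h) w" if "w \<in> W" for w
    using lam_simps(4) ij(1-3) that lam_on_eqD[OF ij(4) lam_simps(1)[OF ij(3) that]] by simp
  then show "lam_on (i \<otimes> h) = lam_on (j \<otimes> h)"
    by (simp add: lam_on_def fun_eq_iff)
qed

lemma lam_on_inv_eq:
  assumes "i \<in> J" "j \<in> J" "lam_on i = lam_on j" "w \<in> W"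
  shows "lam (inv i) w = lam (inv j) w"
proof -
  have w: "lam (inv j) w \<in> W"
    using assms lam_simps(1) by simp
  have "lam (inv i) w = lam (inv i) (lam j (lam (inv j) w))"
    using lam_inv(1) assms by simp
  also have "\<dots> = lam (inv i) (lam i (lam (inv j) w))"
    using lam_on_eqD[OF assms(3) w] by simp
  also have "\<dots> = lam (inv j) w"
    using lam_inv(2)[OF assms(1) w] .
  finally show ?thesis .
qed

text \<open>The map with finite image through which the function averaged below factors.\<close>

definition joint :: "'v \<Rightarrow> 'a \<Rightarrow> ('w \<Rightarrow> 'w) \<times> 'v" where
  "joint v j = (lam_on j, \<pi> (inv j) v)"

lemma pi_inv_mult:
  assumes "v \<in> V" "i \<in> J" "h \<in> J"
  shows "\<pi> (inv (i \<otimes> h)) v = \<pi> (inv h) (\<pi> (inv i) v)"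
  using assms pi_simps(3)[of "inv h" v "inv i"] by (simp add: inv_mult_group)

lemma joint_right_stable: "v \<in> V \<Longrightarrow> right_stable (joint v)"
  using lam_on_right_stable unfolding right_stable_def joint_def prod.inject
  by (intro ballI impI conjI) (blast, simp only: pi_inv_mult)

lemma joint_finite: "v \<in> orbit_finite \<Longrightarrow> finite (joint v ` J)"
  by (rule finite_subset[of _ "lam_on ` J \<times> (\<lambda>j. \<pi> (inv j) v) ` J"])
    (auto simp: joint_def orbit_finite_def finite_lam_on)

lemma orbit_finite_V: "v \<in> orbit_finite \<Longrightarrow> v \<in> V"
  by (simp add: orbit_finite_def)

definition summand :: "('v \<Rightarrow> complex) \<Rightarrow> 'w \<Rightarrow> 'v \<Rightarrow> 'a \<Rightarrow> 'w" where
  "summand l w0 v j = l (\<pi> (inv j) v) *\<^sub>C lam j w0"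

text \<open>The average over \<open>J\<close> of the conjugates of the rank one map \<open>v \<mapsto> l v *\<^sub>C w0\<close>.\<close>

definition averaged :: "('v \<Rightarrow> complex) \<Rightarrow> 'w \<Rightarrow> 'v \<Rightarrow> 'w" where
  "averaged l w0 v = orbit_mean (joint v) (summand l w0 v)"

context
  fixes l :: "'v \<Rightarrow> complex" and w0 :: 'w
  assumes l: "linear_from_to UNIV UNIV l" and w0: "w0 \<in> W"
begin

lemma summand_factors:
  assumes "joint v i = joint v j"
  shows "summand l w0 v i = summand l w0 v j"
proof -
  have "lam_on i = lam_on j" and pi: "\<pi> (inv i) v = \<pi> (inv j) v"
    using assms by (simp_all add: joint_def)
  then have "lam i w0 = lam j w0"
    using lam_on_eqD w0 by blast
  then show ?thesis
    by (simp only: summand_def pi)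
qed

lemma summand_in: "j \<in> J \<Longrightarrow> summand l w0 v j \<in> W"
  using lam_simps(1) w0 cvec.subspace_scale[OF subspace_W] by (simp add: summand_def)

text \<open>The averages at \<open>v\<close>, \<open>w\<close> and \<open>v + w\<close> are taken over different finite quotients of \<open>J\<close>; a common
  refinement compares them.\<close>

lemma averaged_linear: "linear_from_to orbit_finite W (averaged l w0)"
  unfolding linear_from_to_def
proof (intro conjI ballI allI)
  have lin: "\<pi> (inv j) (v + w) = \<pi> (inv j) v + \<pi> (inv j) w" "\<pi> (inv j) (c *\<^sub>C v) = c *\<^sub>C \<pi> (inv j) v"
    if "j \<in> J" "v \<in> V" "w \<in> V" for j v w c
    using pi_lin[of "inv j"] that by (auto simp: linear_from_to_def)
  have idW: "linear_from_to W W (\<lambda>w. w)"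
    by (simp add: linear_from_to_def)
  show "averaged l w0 v \<in> W" for v
    unfolding averaged_def by (rule orbit_mean_linear(1)[OF idW subspace_W summand_in])
  show "averaged l w0 (v + w) = averaged l w0 v + averaged l w0 w" if v: "v \<in> orbit_finite" and w: "w \<in> orbit_finite" for v w
  proof -
    note V = orbit_finite_V[OF v] orbit_finite_V[OF w]
    have vw: "v + w \<in> V"
      using cvec.subspace_add[OF V_sub V] .
    let ?a = "\<lambda>j. (joint v j, joint w j)"
    have stable: "right_stable ?a"
      using joint_right_stable[OF V(1)] joint_right_stable[OF V(2)]
      unfolding right_stable_def prod.inject by blast
    have fin: "finite (?a ` J)"
      by (rule finite_subset[of _ "joint v ` J \<times> joint w ` J"]) (auto simp: joint_finite v w)
    have "averaged l w0 (v + w) = orbit_mean ?a (summand l w0 (v + w))"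
      unfolding averaged_def
      by (rule orbit_mean_refine[symmetric, OF fin stable joint_right_stable[OF vw] _ summand_factors])
        (auto simp: joint_def lin(1)[OF _ V])
    also have "\<dots> = orbit_mean ?a (\<lambda>j. summand l w0 v j + summand l w0 w j)"
      using l lin(1)[OF _ V]
      by (intro orbit_mean_cong) (simp add: summand_def linear_from_to_def scaleC_add_left)
    also have "\<dots> = orbit_mean ?a (summand l w0 v) + orbit_mean ?a (summand l w0 w)"
      by (rule orbit_mean_add)
    also have "orbit_mean ?a (summand l w0 v) = averaged l w0 v"
      unfolding averaged_def
      by (rule orbit_mean_refine[OF fin stable joint_right_stable[OF V(1)] _ summand_factors]) auto
    also have "orbit_mean ?a (summand l w0 w) = averaged l w0 w"
      unfolding averaged_def
      by (rule orbit_mean_refine[OF fin stable joint_right_stable[OF V(2)] _ summand_factors]) auto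
    finally show ?thesis .
  qed
  show "averaged l w0 (c *\<^sub>C v) = c *\<^sub>C averaged l w0 v" if v: "v \<in> orbit_finite" for c v
  proof -
    note V = orbit_finite_V[OF v]
    have cv: "c *\<^sub>C v \<in> V"
      using cvec.subspace_scale[OF V_sub V] .
    have sc: "linear_from_to W W ((*\<^sub>C) c)"
      using cvec.subspace_scale[OF subspace_W]
      by (simp add: linear_from_to_def scaleC_add_right scaleC_scaleC mult.commute)
    have "averaged l w0 (c *\<^sub>C v) = orbit_mean (joint v) (summand l w0 (c *\<^sub>C v))"
      unfolding averaged_def
      by (rule orbit_mean_refine[symmetric, OF joint_finite[OF v] joint_right_stable[OF V]
            joint_right_stable[OF cv] _ summand_factors])
        (auto simp: joint_def lin(2)[OF _ V V])
    also have "\<dots> = orbit_mean (joint v) (\<lambda>j. c *\<^sub>C summand l w0 v j)"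
      using l lin(2)[OF _ V V]
      by (intro orbit_mean_cong) (simp add: summand_def linear_from_to_def scaleC_complex_def scaleC_scaleC)
    also have "\<dots> = c *\<^sub>C averaged l w0 v"
      unfolding averaged_def by (rule orbit_mean_linear(2)[symmetric, OF sc subspace_W summand_in])
    finally show ?thesis .
  qed
qed

lemma averaged_equivariant:
  assumes v: "v \<in> orbit_finite" and hv: "\<pi> h v \<in> orbit_finite" and h: "h \<in> J"
  shows "averaged l w0 (\<pi> h v) = lam h (averaged l w0 v)"
proof -
  note V = orbit_finite_V[OF v] orbit_finite_V[OF hv]
  have eq: "\<pi> (inv j) (\<pi> h v) = \<pi> (inv (inv h \<otimes> j)) v" if "j \<in> J" for j
    using that h V(1) pi_simps(3)[of "inv j" v h] by (simp add: inv_mult_group)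
  let ?b = "\<lambda>j. joint v (inv h \<otimes> j)" and ?u = "\<lambda>j. summand l w0 v (inv h \<otimes> j)"
  have stable: "right_stable ?b"
    using joint_right_stable[OF V(1)] h unfolding right_stable_def by (simp add: m_assoc[symmetric])
  have "averaged l w0 (\<pi> h v) = orbit_mean (joint (\<pi> h v)) (\<lambda>j. lam h (?u j))"
    unfolding averaged_def
  proof (rule orbit_mean_cong)
    fix j assume j: "j \<in> J"
    have "lam h (?u j) = l (\<pi> (inv (inv h \<otimes> j)) v) *\<^sub>C lam h (lam (inv h \<otimes> j) w0)"
      using lam_simps(2)[OF h] lam_simps(1)[of "inv h \<otimes> j"] j h w0 by (simp add: summand_def linear_from_to_def)
    also have "lam h (lam (inv h \<otimes> j) w0) = lam j w0"
      using lam_simps(4)[OF h, of "inv h \<otimes> j" w0] j h w0 by simp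
    finally show "summand l w0 (\<pi> h v) j = lam h (?u j)"
      using eq[OF j] by (simp add: summand_def)
  qed
  also have "\<dots> = lam h (orbit_mean (joint (\<pi> h v)) ?u)"
    using summand_in h by (intro orbit_mean_linear(2)[symmetric, OF lam_simps(2)[OF h] subspace_W]) simp
  also have "orbit_mean (joint (\<pi> h v)) ?u = orbit_mean ?b ?u"
  proof (rule orbit_mean_refine[OF joint_finite[OF hv] joint_right_stable[OF V(2)] stable])
    fix i j assume ij: "i \<in> J" "j \<in> J" "joint (\<pi> h v) i = joint (\<pi> h v) j"
    then have r: "lam_on i = lam_on j" "\<pi> (inv (inv h \<otimes> i)) v = \<pi> (inv (inv h \<otimes> j)) v"
      by (auto simp: joint_def eq)
    have "lam_on (inv h \<otimes> i) = lam_on (inv h \<otimes> j)"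
      using lam_on_eqD[OF r(1)] lam_simps(4)[of "inv h"] ij h by (simp add: lam_on_def fun_eq_iff)
    then show "?b i = ?b j"
      using r(2) by (simp add: joint_def)
  qed (rule summand_factors)
  also have "\<dots> = averaged l w0 v"
    unfolding averaged_def by (rule orbit_mean_left_translate[OF J_closed(3)[OF h] summand_factors])
  finally show ?thesis .
qed

text \<open>Averaging over conjugates does not change the trace, and \<open>w \<mapsto> l (\<alpha> w) *\<^sub>C w0\<close> has trace
  \<open>l (\<alpha> w0)\<close>.\<close>

lemma averaged_trace:
  assumes \<alpha>: "\<alpha> \<in> Hom_J G J W lam V \<pi>" and one: "l (\<alpha> w0) = 1"
  shows "(\<Sum>b\<in>B. dual_basis b (averaged l w0 (\<alpha> b))) = 1"
proof -
  have a0: "\<pi> \<one> (\<alpha> w) = \<alpha> w" "\<alpha> w \<in> orbit_finite" if "w \<in> W" for w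
    using pi_simps(2)[OF one_closed Hom_JD(2)[OF \<alpha> that]] translate_orbit_finite[OF \<alpha> one_closed that] by auto
  have P: "averaged l w0 (\<alpha> b) = orbit_mean lam_on (\<lambda>j. l (\<alpha> (lam (inv j) b)) *\<^sub>C lam j w0)" if b: "b \<in> W" for b
  proof -
    have "averaged l w0 (\<alpha> b) = orbit_mean (joint (\<alpha> b)) (\<lambda>j. l (\<alpha> (lam (inv j) b)) *\<^sub>C lam j w0)"
      unfolding averaged_def using Hom_JD(4)[OF \<alpha> _ b] by (intro orbit_mean_cong) (simp add: summand_def)
    also have "\<dots> = orbit_mean lam_on (\<lambda>j. l (\<alpha> (lam (inv j) b)) *\<^sub>C lam j w0)"
    proof (rule orbit_mean_refine)
      show "finite (joint (\<alpha> b) ` J)" "right_stable (joint (\<alpha> b))" "right_stable lam_on"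
        using a0(2)[OF b] joint_finite joint_right_stable orbit_finite_V lam_on_right_stable by blast+
      show "lam_on i = lam_on j" if "joint (\<alpha> b) i = joint (\<alpha> b) j" for i j
        using that by (simp add: joint_def)
      fix i j assume ij: "i \<in> J" "j \<in> J" "lam_on i = lam_on j"
      have "lam (inv i) b = lam (inv j) b" "lam i w0 = lam j w0"
        using lam_on_inv_eq[OF ij b] lam_on_eqD[OF ij(3) w0] by auto
      then show "l (\<alpha> (lam (inv i) b)) *\<^sub>C lam i w0 = l (\<alpha> (lam (inv j) b)) *\<^sub>C lam j w0"
        by (simp only:)
    qed
    finally show ?thesis .
  qed
  have "dual_basis b (averaged l w0 (\<alpha> b)) = orbit_mean lam_on (\<lambda>j. dual_basis b (lam j w0) * l (\<alpha> (lam (inv j) b)))"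
    if b: "b \<in> B" for b
  proof -
    note lin = lin_mapsD[OF dual_basis_in[of b, unfolded dual_space_def]]
    have "dual_basis b (averaged l w0 (\<alpha> b)) = orbit_mean lam_on (\<lambda>j. dual_basis b (l (\<alpha> (lam (inv j) b)) *\<^sub>C lam j w0))"
      unfolding P[OF basis_in[OF b]] using lam_simps(1) w0 cvec.subspace_scale[OF subspace_W]
      by (intro orbit_mean_linear(2)[OF lin(1) subspace_W]) auto
    also have "\<dots> = orbit_mean lam_on (\<lambda>j. dual_basis b (lam j w0) * l (\<alpha> (lam (inv j) b)))"
      using lin(4) lam_simps(1) w0 by (intro orbit_mean_cong) (simp add: scaleC_complex_def)
    finally show ?thesis .
  qed
  then have "(\<Sum>b\<in>B. dual_basis b (averaged l w0 (\<alpha> b))) =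
      (\<Sum>b\<in>B. orbit_mean lam_on (\<lambda>j. dual_basis b (lam j w0) * l (\<alpha> (lam (inv j) b))))"
    by simp
  also have "\<dots> = orbit_mean lam_on (\<lambda>j. \<Sum>b\<in>B. dual_basis b (lam j w0) * l (\<alpha> (lam (inv j) b)))"
    by (rule orbit_mean_sum[OF finite_lam_on, symmetric])
  also have "\<dots> = orbit_mean lam_on (\<lambda>j. 1)"
  proof (rule orbit_mean_cong)
    fix j assume j: "j \<in> J"
    have w: "lam j w0 \<in> W" "\<And>b. b \<in> B \<Longrightarrow> b \<in> W"
      using lam_simps(1)[OF j w0] basis_in by auto
    let ?L = "\<lambda>w. l (\<alpha> (lam (inv j) w))"
    have L: "linear_from_to W UNIV ?L"
      using l Hom_JD(1)[OF \<alpha>] lam_simps(2)[OF J_closed(3)[OF j]] by (simp add: linear_from_to_def)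
    have "(\<Sum>b\<in>B. dual_basis b (lam j w0) * ?L b) = (\<Sum>b\<in>B. ?L (dual_basis b (lam j w0) *\<^sub>C b))"
      using L w(2) by (intro sum.cong refl) (simp add: linear_from_to_def scaleC_complex_def)
    also have "\<dots> = ?L (\<Sum>b\<in>B. dual_basis b (lam j w0) *\<^sub>C b)"
      using w cvec.subspace_scale[OF subspace_W] by (intro linear_from_to_sum[OF L subspace_W, symmetric]) auto
    also have "\<dots> = 1"
      using expand[OF w(1)] lam_inv(2)[OF j w0] one by simp
    finally show "(\<Sum>b\<in>B. dual_basis b (lam j w0) * ?L b) = 1" .
  qed
  also have "\<dots> = 1"
    using orbit_mean_const[OF finite_lam_on] .
  finally show ?thesis .
qed

end

text \<open>The transpose of the operator \<open>w \<mapsto> averaged l w0 (\<pi> (inv g) (\<alpha> w))\<close> on \<open>W\<close>.\<close>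

definition coefficient :: "('v \<Rightarrow> complex) \<Rightarrow> 'w \<Rightarrow> ('w \<Rightarrow> 'v) \<Rightarrow> 'a \<Rightarrow> ('w \<Rightarrow> complex) \<Rightarrow> 'w \<Rightarrow> complex" where
  "coefficient l w0 \<alpha> g \<xi> = (\<lambda>w. if g \<in> carrier G \<and> \<xi> \<in> U \<and> w \<in> W then \<xi> (averaged l w0 (\<pi> (inv g) (\<alpha> w))) else 0)"

context
  fixes l :: "'v \<Rightarrow> complex" and w0 :: 'w and \<alpha> :: "'w \<Rightarrow> 'v"
  assumes l: "linear_from_to UNIV UNIV l" and w0: "w0 \<in> W" and \<alpha>: "\<alpha> \<in> Hom_J G J W lam V \<pi>"
begin

lemma averaged_translate_linear:
  assumes g: "g \<in> carrier G"
  shows "linear_from_to W W (\<lambda>w. averaged l w0 (\<pi> (inv g) (\<alpha> w)))"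
proof -
  have "\<alpha> (v + w) = \<alpha> v + \<alpha> w" "\<alpha> (c *\<^sub>C v) = c *\<^sub>C \<alpha> v" "\<alpha> v \<in> V"
    "\<pi> (inv g) (\<alpha> v + \<alpha> w) = \<pi> (inv g) (\<alpha> v) + \<pi> (inv g) (\<alpha> w)"
    "\<pi> (inv g) (c *\<^sub>C \<alpha> v) = c *\<^sub>C \<pi> (inv g) (\<alpha> v)"
    if "v \<in> W" "w \<in> W" for v w c
    using Hom_JD(1)[OF \<alpha>] pi_lin[OF inv_closed[OF g]] that by (auto simp: linear_from_to_def)
  then show ?thesis
    using averaged_linear[OF l w0] translate_orbit_finite[OF \<alpha> inv_closed[OF g]] by (simp add: linear_from_to_def)
qed

lemma coefficient_in_U:
  assumes g: "g \<in> carrier G" and \<xi>: "\<xi> \<in> U"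
  shows "coefficient l w0 \<alpha> g \<xi> \<in> U"
  using averaged_translate_linear[OF g] lin_mapsD[OF \<xi>[unfolded dual_space_def]] g \<xi>
    cvec.subspace_add[OF subspace_W] cvec.subspace_scale[OF subspace_W]
  by (simp add: coefficient_def dual_space_def lin_maps_def linear_from_to_def)

lemma coefficient_hecke_bar: "coefficient l w0 \<alpha> \<in> hecke_bar G J W lam"
  unfolding hecke_bar_iff
proof (intro conjI allI impI ballI)
  show "coefficient l w0 \<alpha> g = 0" if "g \<notin> carrier G" for g
    using that by (simp add: coefficient_def fun_eq_iff)
  show lin: "coefficient l w0 \<alpha> g \<in> lin_maps U U" if g: "g \<in> carrier G" for g
    unfolding lin_maps_def linear_from_to_def mem_Collect_eq
    using coefficient_in_U[OF g] cvec.subspace_add[OF U_sub] cvec.subspace_scale[OF U_sub]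
    by (auto simp: coefficient_def scaleC_fun_def scaleC_complex_def fun_eq_iff)
  fix i j g assume ij: "i \<in> J" "j \<in> J" and g: "g \<in> carrier G"
  show "coefficient l w0 \<alpha> (i \<otimes> g \<otimes> j) = dual_act i \<circ> coefficient l w0 \<alpha> g \<circ> dual_act j"
  proof
    fix \<xi>
    show "coefficient l w0 \<alpha> (i \<otimes> g \<otimes> j) \<xi> = (dual_act i \<circ> coefficient l w0 \<alpha> g \<circ> dual_act j) \<xi>"
    proof (cases "\<xi> \<in> U")
      case \<xi>: True
      have s: "dual_act j \<xi> \<in> U" "coefficient l w0 \<alpha> g (dual_act j \<xi>) \<in> U"
        "dual_act i (coefficient l w0 \<alpha> g (dual_act j \<xi>)) \<in> U"
        using dual_act_closed ij \<xi> coefficient_in_U[OF g] by auto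
      show ?thesis
      proof (rule dual_eqI)
        show "coefficient l w0 \<alpha> (i \<otimes> g \<otimes> j) \<xi> \<in> U"
          using ij g by (intro coefficient_in_U \<xi>) auto
        show "(dual_act i \<circ> coefficient l w0 \<alpha> g \<circ> dual_act j) \<xi> \<in> U"
          using s by simp
        fix w assume w: "w \<in> W"
        let ?w = "lam (inv i) w"
        have lw: "?w \<in> W"
          using lam_simps(1) ij w by simp
        have aw: "\<alpha> w \<in> V" "\<alpha> ?w \<in> V"
          using Hom_JD(2)[OF \<alpha>] w lw by auto
        have P: "averaged l w0 (\<pi> (inv g) (\<alpha> ?w)) \<in> W"
          using averaged_translate_linear[OF g] lw by (simp add: linear_from_to_def)
        have "inv (i \<otimes> g \<otimes> j) = inv j \<otimes> (inv g \<otimes> inv i)"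
          using ij g by (simp add: inv_mult_group m_assoc)
        then have "\<pi> (inv (i \<otimes> g \<otimes> j)) (\<alpha> w) = \<pi> (inv j) (\<pi> (inv g) (\<pi> (inv i) (\<alpha> w)))"
          using pi_simps(3)[of "inv j" "\<alpha> w" "inv g \<otimes> inv i"] pi_simps(3)[of "inv g" "\<alpha> w" "inv i"] aw ij g
          by simp
        then have e: "\<pi> (inv (i \<otimes> g \<otimes> j)) (\<alpha> w) = \<pi> (inv j) (\<pi> (inv g) (\<alpha> ?w))"
          using Hom_JD(4)[OF \<alpha> J_closed(3)[OF ij(1)] w] by simp
        have fin: "\<pi> (inv g) (\<alpha> ?w) \<in> orbit_finite" "\<pi> (inv j) (\<pi> (inv g) (\<alpha> ?w)) \<in> orbit_finite"
          using translate_orbit_finite[OF \<alpha> _ lw, of "inv g"]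
            translate_orbit_finite[OF \<alpha> _ w, of "inv (i \<otimes> g \<otimes> j)"] e ij g by auto
        have "coefficient l w0 \<alpha> (i \<otimes> g \<otimes> j) \<xi> w = \<xi> (lam (inv j) (averaged l w0 (\<pi> (inv g) (\<alpha> ?w))))"
          using ij g \<xi> w e averaged_equivariant[OF l w0 fin J_closed(3)[OF ij(2)]] by (simp add: coefficient_def)
        also have "\<dots> = dual_act j \<xi> (averaged l w0 (\<pi> (inv g) (\<alpha> ?w)))"
          using dual_act_apply[OF \<xi> P] by simp
        also have "\<dots> = coefficient l w0 \<alpha> g (dual_act j \<xi>) ?w"
          using s lw g by (simp add: coefficient_def)
        also have "\<dots> = dual_act i (coefficient l w0 \<alpha> g (dual_act j \<xi>)) w"
          using dual_act_apply[OF s(2) w] by simp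
        finally show "coefficient l w0 \<alpha> (i \<otimes> g \<otimes> j) \<xi> w = (dual_act i \<circ> coefficient l w0 \<alpha> g \<circ> dual_act j) \<xi> w"
          by simp
      qed
    next
      case False
      then show ?thesis
        using linear_from_to_0[OF lin_mapsD(1)[OF lin[OF g]] U_sub]
          linear_from_to_0[OF lin_mapsD(1)[OF dual_act_in[OF ij(1)]] U_sub]
        by (simp add: dual_act_def) (simp add: coefficient_def fun_eq_iff)
    qed
  qed
qed

lemma coefficient_trace:
  assumes "l (\<alpha> w0) = 1"
  shows "tr (coefficient l w0 \<alpha> \<one>) = 1"
proof -
  have "coefficient l w0 \<alpha> \<one> (dual_basis b) b = dual_basis b (averaged l w0 (\<alpha> b))" if "b \<in> B" for b
    using basis_in[OF that] dual_basis_in pi_simps(2)[OF one_closed Hom_JD(2)[OF \<alpha>]]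
    by (simp add: coefficient_def)
  then show ?thesis
    using averaged_trace[OF l w0 \<alpha> assms] by (simp add: tr_def)
qed

lemma hecke_term_finite:
  assumes \<phi>: "\<phi> \<in> hecke_algebra G X J W lam" and g: "g \<in> carrier G"
  shows "finite {c \<in> rcosets J. \<phi> (g \<otimes> inv (coset_rep c)) \<noteq> 0}"
proof -
  obtain F where F: "finite F" "F \<subseteq> carrier G"
    "\<And>y. \<phi> y \<noteq> 0 \<Longrightarrow> \<exists>x\<in>F. \<exists>j\<in>J. y = x \<otimes> j"
    using hecke_algebra_support[OF \<phi>] by blast
  show ?thesis
  proof (rule finite_rcoset_support[of "(\<lambda>y. inv y \<otimes> g) ` F"])
    fix x assume x: "x \<in> carrier G" "\<phi> (g \<otimes> inv x) \<noteq> 0"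
    then obtain y j where y: "y \<in> F" "j \<in> J" "g \<otimes> inv x = y \<otimes> j"
      using F(3) by blast
    have yc: "y \<in> carrier G"
      using y F by auto
    have "x = inv (g \<otimes> inv x) \<otimes> g"
      using x g by (simp add: inv_mult_group m_assoc)
    also have "\<dots> = inv j \<otimes> (inv y \<otimes> g)"
      unfolding y(3) using y yc g by (simp add: inv_mult_group m_assoc)
    finally show "x \<in> (\<Union>y\<in>(\<lambda>y. inv y \<otimes> g) ` F. J #> y)"
      using y(1) J_closed(3)[OF y(2)] unfolding r_coset_def by blast
  qed (use F g in auto)
qed

text \<open>Transposition turns the convolution at \<open>g\<close> into the sum over \<open>J\G\<close> of
  \<open>averaged l w0 (\<pi> (inv x) (\<alpha> (tilde \<phi> (x \<otimes> inv g) w)))\<close>.  The substitution \<open>x = y \<otimes> g\<close> pulls out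
  \<open>\<pi> (inv g)\<close> and leaves the sum that computes the action of \<open>\<phi>\<close> on \<open>\<alpha>\<close>.\<close>

lemma coefficient_eigenfunction:
  assumes \<phi>: "\<phi> \<in> hecke_algebra G X J W lam" and c: "hecke_act G X J W lam V \<pi> \<phi> \<alpha> = c *\<^sub>C \<alpha>"
  shows "hecke_conv G J \<phi> (coefficient l w0 \<alpha>) = c *\<^sub>C coefficient l w0 \<alpha>"
proof
  fix g
  let ?\<Psi> = "coefficient l w0 \<alpha>"
  have bar: "\<phi> \<in> hecke_bar G J W lam"
    using \<phi> by (simp add: hecke_algebra_def)
  show "hecke_conv G J \<phi> ?\<Psi> g = (c *\<^sub>C ?\<Psi>) g"
  proof (cases "g \<in> carrier G")
    case g: True
    let ?D = "{d \<in> rcosets J. \<phi> (g \<otimes> inv (coset_rep d)) \<noteq> 0}"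
    have D: "finite ?D" "?D \<subseteq> rcosets J"
      using hecke_term_finite[OF \<phi> g] by auto
    have "hecke_conv G J \<phi> ?\<Psi> g = coset_sum (rcosets J) (\<lambda>x. \<phi> (g \<otimes> inv x) \<circ> ?\<Psi> x)"
      using g by (simp add: hecke_conv_def)
    also have "\<dots> = (\<Sum>d\<in>?D. \<phi> (g \<otimes> inv (coset_rep d)) \<circ> ?\<Psi> (coset_rep d))"
      by (rule coset_sum_eq[OF D]) (simp add: fun_eq_iff)
    finally have conv: "hecke_conv G J \<phi> ?\<Psi> g = (\<Sum>d\<in>?D. \<phi> (g \<otimes> inv (coset_rep d)) \<circ> ?\<Psi> (coset_rep d))" .
    show ?thesis
    proof (intro ext)
      fix \<xi> w
      have zero: "\<phi> (g \<otimes> inv x) (?\<Psi> x \<xi>) w = 0" if x: "x \<in> carrier G" and "\<xi> \<notin> U \<or> w \<notin> W" for x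
      proof (cases "\<xi> \<in> U")
        case True
        have "\<phi> (g \<otimes> inv x) (?\<Psi> x \<xi>) \<in> lin_maps W UNIV"
          using lin_mapsD(2)[OF hecke_barD(2)[OF bar] coefficient_in_U[OF x True]] x g
          by (simp add: dual_space_def)
        then show ?thesis
          using lin_mapsD(5) True that by blast
      next
        case False
        then have "?\<Psi> x \<xi> = 0"
          by (simp add: coefficient_def fun_eq_iff)
        then show ?thesis
          using linear_from_to_0[OF lin_mapsD(1)[OF hecke_barD(2)[OF bar]] U_sub] x g by simp
      qed
      have sum: "hecke_conv G J \<phi> ?\<Psi> g \<xi> w = (\<Sum>d\<in>?D. \<phi> (g \<otimes> inv (coset_rep d)) (?\<Psi> (coset_rep d) \<xi>) w)"
        by (simp add: conv sum_fun_apply)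
      show "hecke_conv G J \<phi> ?\<Psi> g \<xi> w = (c *\<^sub>C ?\<Psi>) g \<xi> w"
      proof (cases "\<xi> \<in> U \<and> w \<in> W")
        case True
        then have \<xi>: "\<xi> \<in> U" and w: "w \<in> W" by auto
        let ?t = "\<lambda>x. \<pi> (inv x) (\<alpha> (tilde \<phi> x w))"
        let ?s = "\<lambda>x. \<pi> (inv g) (?t (x \<otimes> inv g))"
        have term_in: "tilde \<phi> (x \<otimes> inv g) w \<in> W" if "x \<in> carrier G" for x
          using that g tilde_eval(1)[OF bar _ w] by simp
        have s_eq: "?s x = \<pi> (inv x) (\<alpha> (tilde \<phi> (x \<otimes> inv g) w))" if x: "x \<in> carrier G" for x
        proof -
          have v: "\<alpha> (tilde \<phi> (x \<otimes> inv g) w) \<in> V"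
            using Hom_JD(2)[OF \<alpha> term_in[OF x]] .
          have "inv g \<otimes> inv (x \<otimes> inv g) = inv x"
            using x g by (simp add: inv_mult_group)
          then show ?thesis
            using pi_simps(3)[of "inv g" _ "inv (x \<otimes> inv g)", OF _ v] x g by simp
        qed
        have each: "\<phi> (g \<otimes> inv x) (?\<Psi> x \<xi>) w = \<xi> (averaged l w0 (?s x))" if x: "x \<in> carrier G" for x
        proof -
          have "inv (x \<otimes> inv g) = g \<otimes> inv x"
            using x g by (simp add: inv_mult_group)
          then have "\<phi> (g \<otimes> inv x) (?\<Psi> x \<xi>) w = ?\<Psi> x \<xi> (tilde \<phi> (x \<otimes> inv g) w)"
            using tilde_eval(2)[OF bar _ w coefficient_in_U[OF x \<xi>], of "x \<otimes> inv g"] x g by simp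
          also have "\<dots> = \<xi> (averaged l w0 (\<pi> (inv x) (\<alpha> (tilde \<phi> (x \<otimes> inv g) w))))"
            using x \<xi> term_in[OF x] by (simp add: coefficient_def)
          finally show ?thesis
            using s_eq[OF x] by simp
        qed
        have t_inv: "?t (j \<otimes> x) = ?t x" if j: "j \<in> J" and x: "x \<in> carrier G" for j x
        proof -
          have tw: "tilde \<phi> x w \<in> W"
            using tilde_eval(1)[OF bar x w] .
          have "tilde \<phi> (j \<otimes> x) w = lam j (tilde \<phi> x w)"
            using tilde_equivariant[OF bar x w j J_closed(2)] lam_simps(3)[OF J_closed(2) w] j x by simp
          then have "\<alpha> (tilde \<phi> (j \<otimes> x) w) = \<pi> j (\<alpha> (tilde \<phi> x w))"
            using Hom_JD(4)[OF \<alpha> j tw] by simp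
          moreover have "inv (j \<otimes> x) \<otimes> j = inv x"
            using j x by (simp add: inv_mult_group m_assoc)
          ultimately show ?thesis
            using pi_simps(3)[of "inv (j \<otimes> x)" "\<alpha> (tilde \<phi> x w)" j] Hom_JD(2)[OF \<alpha> tw] j x by simp
        qed
        have s_inv: "?s (j \<otimes> x) = ?s x" if "j \<in> J" "x \<in> carrier G" for j x
          using t_inv[OF that(1), of "x \<otimes> inv g"] that g by (simp add: m_assoc)
        have t_in: "?t x \<in> V" if "x \<in> carrier G" for x
          using pi_simps(1)[of "inv x"] Hom_JD(2)[OF \<alpha>] tilde_eval(1)[OF bar that w] that by simp
        have s_in: "?s x \<in> orbit_finite" if "x \<in> carrier G" for x
          using s_eq[OF that] translate_orbit_finite[OF \<alpha> _ term_in[OF that], of "inv x"] that by simp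
        have t_sum: "coset_sum (rcosets J) ?t = c *\<^sub>C \<alpha> w"
          using hecke_act_formula(1)[OF \<phi> \<alpha> w] c by (simp add: scaleC_fun_def)
        have "\<pi> (inv g) (c *\<^sub>C \<alpha> w) = coset_sum (rcosets J) (\<lambda>x. \<pi> (inv g) (?t x))"
          unfolding t_sum[symmetric] using t_in rep_rcoset(2) g
          by (intro coset_sum_linear[OF pi_lin V_sub _ hecke_act_formula(2)[OF \<phi> \<alpha> w]]) auto
        also have "\<dots> = coset_sum (rcosets J) ?s"
          using coset_sum_shift[of "inv g" "\<lambda>x. \<pi> (inv g) (?t x)"] t_inv g by simp
        finally have s_sum: "coset_sum (rcosets J) ?s = \<pi> (inv g) (c *\<^sub>C \<alpha> w)" by simp
        have s_0: "?s x = 0" if x: "x \<in> carrier G" and "\<phi> (g \<otimes> inv x) = 0" for x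
        proof -
          have "\<phi> (inv (x \<otimes> inv g)) = 0"
            using that g by (simp add: inv_mult_group)
          then have "tilde \<phi> (x \<otimes> inv g) w = 0"
            using tilde_0[OF bar _ w, of "x \<otimes> inv g"] x g by simp
          then show ?thesis
            using s_eq[OF x] alpha_0[OF \<alpha>] pi_0 x by simp
        qed
        have "hecke_conv G J \<phi> ?\<Psi> g \<xi> w = (\<Sum>d\<in>?D. \<phi> (g \<otimes> inv (coset_rep d)) (?\<Psi> (coset_rep d) \<xi>) w)"
          by (rule sum)
        also have "\<dots> = (\<Sum>d\<in>?D. \<xi> (averaged l w0 (?s (coset_rep d))))"
          using each rep_rcoset(2) D(2) by (intro sum.cong refl) auto
        also have "\<dots> = \<xi> (averaged l w0 (\<Sum>d\<in>?D. ?s (coset_rep d)))"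
        proof -
          have L: "linear_from_to orbit_finite UNIV (\<lambda>v. \<xi> (averaged l w0 v))"
            using averaged_linear[OF l w0] lin_mapsD(1)[OF \<xi>[unfolded dual_space_def]] by (simp add: linear_from_to_def)
          show ?thesis
            using s_in rep_rcoset(2) D(2)
            by (intro linear_from_to_sum[OF L orbit_finite_sub, symmetric]) auto
        qed
        also have "(\<Sum>d\<in>?D. ?s (coset_rep d)) = coset_sum (rcosets J) ?s"
          using s_0 rep_rcoset(2) by (intro coset_sum_eq[symmetric] D) auto
        also have "\<xi> (averaged l w0 (coset_sum (rcosets J) ?s)) = c * \<xi> (averaged l w0 (\<pi> (inv g) (\<alpha> w)))"
        proof -
          have v: "\<pi> (inv g) (\<alpha> w) \<in> orbit_finite"
            using translate_orbit_finite[OF \<alpha> inv_closed[OF g] w] .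
          have "\<pi> (inv g) (c *\<^sub>C \<alpha> w) = c *\<^sub>C \<pi> (inv g) (\<alpha> w)"
            using pi_lin[OF inv_closed[OF g]] Hom_JD(2)[OF \<alpha> w] by (simp add: linear_from_to_def)
          moreover have "averaged l w0 (c *\<^sub>C \<pi> (inv g) (\<alpha> w)) = c *\<^sub>C averaged l w0 (\<pi> (inv g) (\<alpha> w))"
            "averaged l w0 (\<pi> (inv g) (\<alpha> w)) \<in> W"
            using averaged_linear[OF l w0] v by (auto simp: linear_from_to_def)
          ultimately show ?thesis
            unfolding s_sum using lin_mapsD(4)[OF \<xi>[unfolded dual_space_def]] by (simp add: scaleC_complex_def)
        qed
        also have "\<dots> = (c *\<^sub>C ?\<Psi>) g \<xi> w"
          using \<xi> w g by (simp add: coefficient_def scaleC_fun_def scaleC_complex_def)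
        finally show ?thesis .
      next
        case False
        then have "(\<Sum>d\<in>?D. \<phi> (g \<otimes> inv (coset_rep d)) (?\<Psi> (coset_rep d) \<xi>) w) = 0"
          using zero rep_rcoset(2) by (intro sum.neutral) auto
        then show ?thesis
          unfolding sum using False by (auto simp: coefficient_def scaleC_fun_def scaleC_complex_def)
      qed
    qed
  next
    case False
    then show ?thesis
      by (simp add: hecke_conv_def coefficient_def scaleC_fun_def scaleC_complex_def fun_eq_iff)
  qed
qed

end

theorem dim_hecke_bar_eigenspace:
  assumes chi: "afforded_character G X J W lam V \<pi> chi"
  shows "cvec.dim (hecke_bar_eigenspace G X J W lam chi) = 1"
proof -
  let ?H = "Hom_J G J W lam V \<pi>" and ?E = "hecke_bar_eigenspace G X J W lam chi"
  have "\<exists>\<alpha>\<in>?H. \<alpha> \<noteq> 0"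
  proof (rule ccontr)
    assume "\<not> ?thesis"
    then have "?H \<subseteq> {0}" by blast
    then have "cvec.span ?H \<subseteq> cvec.span {0}"
      by (rule cvec.span_mono)
    then have "cvec.span {} = cvec.span ?H"
      using cvec.span_zero[of ?H] by auto
    then have "cvec.dim ?H = card ({} :: ('w \<Rightarrow> 'v) set)"
      by (rule cvec.dim_eq_card) (rule cvec.independent_empty)
    then show False
      using chi by (simp add: afforded_character_def)
  qed
  then obtain \<alpha> w0 where \<alpha>: "\<alpha> \<in> ?H" and "\<alpha> w0 \<noteq> 0"
    by (auto simp: fun_eq_iff)
  then have w0: "w0 \<in> W"
    using Hom_JD(3) by blast
  (* normalised so that the eigenfunction has trace 1 at the identity *)
  obtain l where l: "linear_from_to UNIV UNIV l" "l (\<alpha> w0) = (1 :: complex)"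
    using separating_functional[OF \<open>\<alpha> w0 \<noteq> 0\<close>] by blast
  let ?\<Psi> = "coefficient l w0 \<alpha>"
  have \<Psi>: "?\<Psi> \<in> ?E"
    unfolding hecke_bar_eigenspace_def mem_Collect_eq
  proof (intro conjI ballI)
    show "?\<Psi> \<in> hecke_bar G J W lam"
      using coefficient_hecke_bar[OF l(1) w0 \<alpha>] .
    show "hecke_conv G J \<phi> ?\<Psi> = chi \<phi> *\<^sub>C ?\<Psi>" if \<phi>: "\<phi> \<in> hecke_algebra G X J W lam" for \<phi>
      using chi \<alpha> \<phi> by (intro coefficient_eigenfunction[OF l(1) w0 \<alpha> \<phi>]) (simp add: afforded_character_def)
  qed
  have one: "tr (?\<Psi> \<one>) = 1"
    using coefficient_trace[OF l(1) w0 \<alpha> l(2)] .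
  have nz: "?\<Psi> \<noteq> 0"
    using one by (auto simp: tr_def)
  have "?E \<subseteq> cvec.span {?\<Psi>}"
    using eigenfunction_unique[OF _ \<Psi> one] by (auto simp: cvec.span_singleton)
  then have "cvec.span {?\<Psi>} = cvec.span ?E"
    using \<Psi> by (intro subset_antisym cvec.span_minimal cvec.subspace_span) (auto intro: cvec.span_base)
  moreover have "cvec.independent {?\<Psi>}"
    using nz by simp
  ultimately have "cvec.dim ?E = card {?\<Psi>}"
    by (rule cvec.dim_eq_card)
  then show ?thesis by simp
qed

end


section \<open>Compact open subgroups\<close>

text \<open>Cosets of a compact open subgroup are compact and open, since translations are homeomorphisms;
  the cosets of the elements of a compact set form an open cover of it.\<close>

lemma (in group_with_subgroup) compact_open_cosets:
  assumes top: "topspace X = carrier G" and J: "openin X J" "compactin X J"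
    and left: "\<And>g. g \<in> carrier G \<Longrightarrow> continuous_map X X (\<lambda>x. g \<otimes> x)"
    and right: "\<And>g. g \<in> carrier G \<Longrightarrow> continuous_map X X (\<lambda>x. x \<otimes> g)"
  shows "compactin X K \<Longrightarrow> \<exists>F. finite F \<and> F \<subseteq> carrier G \<and> K \<subseteq> (\<Union>x\<in>F. J #> x)"
    and "compactin X K \<Longrightarrow> \<exists>F. finite F \<and> F \<subseteq> carrier G \<and> K \<subseteq> (\<Union>x\<in>F. x <# J)"
    and "x \<in> carrier G \<Longrightarrow> compactin X (J #> x)"
    and "x \<in> carrier G \<Longrightarrow> compactin X (x <# J)"
proof -
  show "compactin X (J #> x)" if x: "x \<in> carrier G" for x
  proof -
    have "J #> x = (\<lambda>y. y \<otimes> x) ` J"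
      by (auto simp: r_coset_def)
    then show ?thesis
      using image_compactin[OF J(2) right[OF x]] by simp
  qed
  show "compactin X (x <# J)" if x: "x \<in> carrier G" for x
  proof -
    have "x <# J = (\<lambda>y. x \<otimes> y) ` J"
      by (auto simp: l_coset_def)
    then show ?thesis
      using image_compactin[OF J(2) left[OF x]] by simp
  qed
  have r_open: "openin X (J #> x)" if x: "x \<in> carrier G" for x
  proof -
    have "J #> x = {y \<in> topspace X. y \<otimes> inv x \<in> J}"
    proof (intro subset_antisym subsetI)
      fix y assume "y \<in> {y \<in> topspace X. y \<otimes> inv x \<in> J}"
      then have y: "y \<in> carrier G" "y \<otimes> inv x \<in> J" using top by auto
      have "y = (y \<otimes> inv x) \<otimes> x"
        using x y(1) by (simp add: m_assoc)
      then show "y \<in> J #> x"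
        using y(2) unfolding r_coset_def by blast
    next
      fix y assume "y \<in> J #> x"
      then obtain j where "j \<in> J" "y = j \<otimes> x"
        by (auto simp: r_coset_def)
      then show "y \<in> {y \<in> topspace X. y \<otimes> inv x \<in> J}"
        using x top by (simp add: m_assoc)
    qed
    then show ?thesis
      using openin_continuous_map_preimage[OF right[OF inv_closed[OF x]] J(1)] by simp
  qed
  have l_open: "openin X (x <# J)" if x: "x \<in> carrier G" for x
  proof -
    have "x <# J = {y \<in> topspace X. inv x \<otimes> y \<in> J}"
    proof (intro subset_antisym subsetI)
      fix y assume "y \<in> {y \<in> topspace X. inv x \<otimes> y \<in> J}"
      then have y: "y \<in> carrier G" "inv x \<otimes> y \<in> J" using top by auto
      have "y = x \<otimes> (inv x \<otimes> y)"
        using x y(1) by simp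
      then show "y \<in> x <# J"
        using y(2) unfolding l_coset_def by blast
    next
      fix y assume "y \<in> x <# J"
      then obtain j where "j \<in> J" "y = x \<otimes> j"
        by (auto simp: l_coset_def)
      then show "y \<in> {y \<in> topspace X. inv x \<otimes> y \<in> J}"
        using x top by simp
    qed
    then show ?thesis
      using openin_continuous_map_preimage[OF left[OF inv_closed[OF x]] J(1)] by simp
  qed
  show "\<exists>F. finite F \<and> F \<subseteq> carrier G \<and> K \<subseteq> (\<Union>x\<in>F. J #> x)" if K: "compactin X K" for K
  proof -
    have KG: "K \<subseteq> carrier G"
      using compactin_subset_topspace[OF K] top by simp
    then have "K \<subseteq> \<Union> ((\<lambda>x. J #> x) ` carrier G)"
      using rcos_self[OF _ sub] by blast
    then obtain \<F> where F: "finite \<F>" "\<F> \<subseteq> (\<lambda>x. J #> x) ` carrier G" "K \<subseteq> \<Union>\<F>"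
      using compactinD[OF K, of "(\<lambda>x. J #> x) ` carrier G"] r_open by blast
    then show ?thesis
      using finite_subset_image[OF F(1,2)] by metis
  qed
  show "\<exists>F. finite F \<and> F \<subseteq> carrier G \<and> K \<subseteq> (\<Union>x\<in>F. x <# J)" if K: "compactin X K" for K
  proof -
    have KG: "K \<subseteq> carrier G"
      using compactin_subset_topspace[OF K] top by simp
    then have "K \<subseteq> \<Union> ((\<lambda>x. x <# J) ` carrier G)"
      using lcos_self[OF _ sub] by blast
    then obtain \<F> where F: "finite \<F>" "\<F> \<subseteq> (\<lambda>x. x <# J) ` carrier G" "K \<subseteq> \<Union>\<F>"
      using compactinD[OF K, of "(\<lambda>x. x <# J) ` carrier G"] l_open by blast
    then show ?thesis
      using finite_subset_image[OF F(1,2)] by metis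
  qed
qed


section \<open>Compactness of the ring of integers\<close>

context nonarch_local_field
begin

lemma nv_0 [simp]: "nv 0 = 0"
  using nv_eq_0_iff by blast

lemma nv_1 [simp]: "nv 1 = 1"
  using nv_mult[of 1 1] nv_eq_0_iff[of 1] by simp

lemma nv_minus [simp]: "nv (- x) = nv x"
proof -
  have "nv (-1) * nv (-1) = 1"
    using nv_mult[of "-1" "-1"] by simp
  then have "nv (-1) = 1"
    using nv_nonneg[of "-1"] by (metis abs_of_nonneg abs_square_eq_1 power2_eq_square)
  then show ?thesis
    using nv_mult[of "-1" x] by simp
qed

lemma nv_diff: "nv (x - y) \<le> max (nv x) (nv y)"
  using nv_ultrametric[of x "- y"] by simp

lemma nv_diff_commute: "nv (x - y) = nv (y - x)"
  using nv_minus[of "x - y"] by simp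

lemma nv_sum_le:
  assumes "finite I" "r \<ge> 0" "\<And>i. i \<in> I \<Longrightarrow> nv (g i) \<le> r"
  shows "nv (\<Sum>i\<in>I. g i) \<le> r"
  using assms by (induction I rule: finite_induct) (auto intro: order_trans[OF nv_ultrametric])

lemma nv_sum_less:
  assumes "finite I" "r > 0" "\<And>i. i \<in> I \<Longrightarrow> nv (g i) < r"
  shows "nv (\<Sum>i\<in>I. g i) < r"
  using assms by (induction I rule: finite_induct) (auto intro: le_less_trans[OF nv_ultrametric])

lemma nv_power: "nv (x ^ k) = nv x ^ k"
  by (induction k) (auto simp: nv_mult)

lemma nv_inverse: "nv (inverse x) = inverse (nv x)"
proof (cases "x = 0")
  case False
  then have "nv x * nv (inverse x) = 1"
    using nv_mult[of x "inverse x"] by simp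
  then show ?thesis
    by (metis inverse_unique)
qed simp

lemma metric: "Metric_space UNIV (\<lambda>x y. nv (x - y))"
proof
  show "nv (x - z) \<le> nv (x - y) + nv (y - z)" for x y z
    using nv_ultrametric[of "x - y" "y - z"] nv_nonneg[of "x - y"] nv_nonneg[of "y - z"] by simp
qed (use nv_nonneg nv_diff_commute nv_eq_0_iff in auto)

lemma small_element:
  assumes "r > 0"
  obtains x where "x \<noteq> 0" "nv x < r"
proof -
  obtain y where y: "y \<noteq> 0" "nv y \<noteq> 1"
    using nv_nontrivial by blast
  obtain z where z: "z \<noteq> 0" "nv z < 1"
  proof (cases "nv y < 1")
    case False
    then have "nv (inverse y) < 1"
      using y by (simp add: nv_inverse inverse_less_1_iff)
    then show ?thesis
      using that[of "inverse y"] y by simp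
  qed (use y that in blast)
  obtain k where "nv z ^ k < r"
    using real_arch_pow_inv[OF assms z(2)] by blast
  then show thesis
    using that[of "z ^ k"] z by (simp add: nv_power)
qed

text \<open>A compact neighbourhood of \<open>0\<close> contains a scaled copy of the ring of integers.\<close>

lemma integers_sequentially_compact:
  fixes s :: "nat \<Rightarrow> 'a"
  assumes s: "\<And>k. nv (s k) \<le> 1"
  obtains l r where "nv l \<le> 1" "strict_mono r" "(\<lambda>k. nv (s (r k) - l)) \<longlonglongrightarrow> 0"
proof -
  interpret F: Metric_space UNIV "\<lambda>x y. nv (x - y)"
    by (rule metric)
  obtain N K where NK: "openin F.mtopology N" "compactin F.mtopology K" "0 \<in> N" "N \<subseteq> K"
    using nv_locally_compact unfolding locally_compact_space_def F.topspace_mtopology by (metis UNIV_I)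
  obtain \<epsilon> where \<epsilon>: "\<epsilon> > 0" "F.mball 0 \<epsilon> \<subseteq> N"
    using NK(1,3) unfolding F.openin_mtopology by blast
  obtain x where x: "x \<noteq> 0" "nv x < \<epsilon>"
    using small_element[OF \<epsilon>(1)] by blast
  have "x * s k \<in> K" for k
  proof -
    have "nv (x * s k) \<le> nv x"
      using s[of k] nv_nonneg[of x] by (simp add: nv_mult mult_left_le)
    then have "x * s k \<in> F.mball 0 \<epsilon>"
      using x by (simp add: F.in_mball)
    then show ?thesis
      using \<epsilon> NK by blast
  qed
  then have "range (\<lambda>k. x * s k) \<subseteq> K" by blast
  then obtain m r where r: "strict_mono r" "limitin F.mtopology ((\<lambda>k. x * s k) \<circ> r) m sequentially"
    using NK(2) unfolding F.compactin_sequentially by blast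
  have lim: "(\<lambda>k. nv (x * s (r k) - m)) \<longlonglongrightarrow> 0"
  proof (rule LIMSEQ_I)
    fix e :: real assume e: "e > 0"
    have "\<forall>\<^sub>F k in sequentially. nv (x * s (r k) - m) < e"
      using r(2) e unfolding F.limitin_metric by (auto elim: eventually_mono)
    then show "\<exists>n0. \<forall>k\<ge>n0. norm (nv (x * s (r k) - m) - 0) < e"
      using nv_nonneg by (auto simp: eventually_sequentially)
  qed
  let ?l = "inverse x * m"
  have eq: "nv (s (r k) - ?l) = inverse (nv x) * nv (x * s (r k) - m)" for k
  proof -
    have "s (r k) - ?l = inverse x * (x * s (r k) - m)"
      using x by (simp add: algebra_simps)
    then show ?thesis
      by (simp add: nv_mult nv_inverse)
  qed
  have lim': "(\<lambda>k. nv (s (r k) - ?l)) \<longlonglongrightarrow> 0"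
    unfolding eq using tendsto_mult_right_zero[OF lim] by simp
  have "\<forall>\<^sub>F k in sequentially. nv (s (r k) - ?l) < 1"
    using order_tendstoD(2)[OF lim'] by simp
  then obtain k where "nv (s (r k) - ?l) < 1"
    by (auto simp: eventually_sequentially)
  then have "nv ?l \<le> 1"
    using nv_diff[of "s (r k)" "s (r k) - ?l"] s[of "r k"] by simp
  then show thesis
    using that r(1) lim' by blast
qed

text \<open>Subsequences are extracted for one index after the other.\<close>

lemma integer_families_sequentially_compact:
  fixes s :: "nat \<Rightarrow> 'i \<Rightarrow> 'a"
  assumes "finite I" "\<And>k i. i \<in> I \<Longrightarrow> nv (s k i) \<le> 1"
  obtains l r where "strict_mono r" "\<And>i. i \<in> I \<Longrightarrow> nv (l i) \<le> 1"
    "\<And>i. i \<in> I \<Longrightarrow> (\<lambda>k. nv (s (r k) i - l i)) \<longlonglongrightarrow> 0"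
proof -
  have "\<exists>l r. strict_mono r \<and> (\<forall>i\<in>I. nv (l i) \<le> 1 \<and> (\<lambda>k. nv (s (r k) i - l i)) \<longlonglongrightarrow> 0)"
    using assms
  proof (induction I rule: finite_induct)
    case empty
    show ?case
      using strict_mono_id by auto
  next
    case (insert j I)
    then obtain l r where lr: "strict_mono r" "\<forall>i\<in>I. nv (l i) \<le> 1 \<and> (\<lambda>k. nv (s (r k) i - l i)) \<longlonglongrightarrow> 0"
      by auto
    obtain m q where mq: "nv m \<le> 1" "strict_mono q" "(\<lambda>k. nv (s (r (q k)) j - m)) \<longlonglongrightarrow> 0"
      using integers_sequentially_compact[of "\<lambda>k. s (r k) j"] insert.prems by auto
    have "(\<lambda>k. nv (s (r (q k)) i - l i)) \<longlonglongrightarrow> 0" if "i \<in> I" for i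
      using LIMSEQ_subseq_LIMSEQ[OF _ mq(2), of "\<lambda>k. nv (s (r k) i - l i)" 0] lr(2) that by (simp add: o_def)
    then show ?case
      using lr mq insert.hyps strict_mono_o[OF lr(1) mq(2)]
      by (intro exI[of _ "l(j := m)"] exI[of _ "r \<circ> q"]) (auto simp: o_def)
  qed
  then show thesis
    using that by blast
qed

lemma red_0 [simp]: "red 0 = 0"
  using red_eq_0_iff[of 0] by simp

lemma red_diff:
  assumes "nv x \<le> 1" "nv y \<le> 1"
  shows "red (x - y) = red x - red y"
proof -
  have "red (x - y + y) = red (x - y) + red y"
    using assms nv_diff[of x y] by (intro red_add) auto
  then show ?thesis by simp
qed

lemma red_sum:
  assumes "finite I" "\<And>i. i \<in> I \<Longrightarrow> nv (g i) \<le> 1"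
  shows "red (\<Sum>i\<in>I. g i) = (\<Sum>i\<in>I. red (g i))"
  using assms
proof (induction I rule: finite_induct)
  case (insert i I)
  then have "nv (\<Sum>i\<in>I. g i) \<le> 1"
    by (intro nv_sum_le) auto
  then show ?case
    using insert by (simp add: red_add)
qed simp

text \<open>A sequence of integers with distinct residues has no convergent subsequence.\<close>

lemma finite_residue_field: "finite (UNIV :: 'k set)"
proof (rule ccontr)
  assume "infinite (UNIV :: 'k set)"
  then obtain z :: "nat \<Rightarrow> 'k" where z: "inj z"
    using infinite_countable_subset by blast
  have "\<forall>k. \<exists>x. nv x \<le> 1 \<and> red x = z k"
    using red_surj by blast
  then obtain s where s: "\<And>k. nv (s k) \<le> 1" "\<And>k. red (s k) = z k"
    by metis
  obtain l r where lr: "nv l \<le> 1" "strict_mono r" "(\<lambda>k. nv (s (r k) - l)) \<longlonglongrightarrow> 0"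
    using integers_sequentially_compact[of s] s(1) by blast
  have "\<forall>\<^sub>F k in sequentially. nv (s (r k) - l) < 1"
    using order_tendstoD(2)[OF lr(3)] by simp
  then obtain k where k: "nv (s (r k) - l) < 1" "nv (s (r (Suc k)) - l) < 1"
    unfolding eventually_sequentially by (meson le_Suc_eq order_refl)
  have "red (s (r i)) = red l" if "nv (s (r i) - l) < 1" for i
    using red_diff[OF s(1) lr(1), of "r i"] red_eq_0_iff[of "s (r i) - l"] that by simp
  then have "z (r k) = z (r (Suc k))"
    using k s(2) by metis
  then have "r k = r (Suc k)"
    using z by (simp add: inj_eq)
  then show False
    using strict_monoD[OF lr(2), of k "Suc k"] by simp
qed

end


section \<open>The topological group of invertible matrices\<close>

lemma mat_mult_entry:
  assumes "A \<in> carrier_mat m m" "C \<in> carrier_mat m m" "i < m" "j < m"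
  shows "(A * C) $$ (i, j) = (\<Sum>k<m. A $$ (i, k) * C $$ (k, j))"
  using assms by (simp add: scalar_prod_def atLeast0LessThan)

lemma carrier_GL:
  "A \<in> carrier (GL m) \<longleftrightarrow> A \<in> carrier_mat m m \<and> (\<exists>C\<in>carrier_mat m m. A * C = 1\<^sub>m m \<and> C * A = 1\<^sub>m m)"
  by (auto simp: GL_def units_of_def Units_def ring_mat_simps)

lemma mult_GL [simp]: "A \<otimes>\<^bsub>GL m\<^esub> C = A * C" and one_GL [simp]: "\<one>\<^bsub>GL m\<^esub> = 1\<^sub>m m"
  by (simp_all add: GL_def units_of_def ring_mat_simps)

lemma group_GL: "group (GL m :: 'b::field mat monoid)"
proof -
  interpret ring "ring_mat TYPE('b) m ()"
    by (rule ring_mat)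
  show ?thesis
    unfolding GL_def by (rule units_group)
qed

context nonarch_local_field
begin

lemma mat_metric_le_iff:
  "r \<ge> 0 \<Longrightarrow> mat_metric nv m A C \<le> r \<longleftrightarrow> (\<forall>i<m. \<forall>j<m. nv (A $$ (i, j) - C $$ (i, j)) \<le> r)"
  unfolding mat_metric_def by (subst Max_le_iff) auto

lemma mat_metric_less_iff:
  "r > 0 \<Longrightarrow> mat_metric nv m A C < r \<longleftrightarrow> (\<forall>i<m. \<forall>j<m. nv (A $$ (i, j) - C $$ (i, j)) < r)"
  unfolding mat_metric_def by (subst Max_less_iff) auto

lemma mat_metric_nonneg: "mat_metric nv m A C \<ge> 0"
  unfolding mat_metric_def by (rule Max_ge) auto

lemma entry_le_mat_metric: "i < m \<Longrightarrow> j < m \<Longrightarrow> nv (A $$ (i, j) - C $$ (i, j)) \<le> mat_metric nv m A C"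
  using mat_metric_le_iff[OF mat_metric_nonneg, of m A C m A C] by simp

lemma mat_metric_space: "Metric_space (carrier_mat m m) (mat_metric nv m)"
proof
  fix A C D :: "'a mat"
  show "0 \<le> mat_metric nv m A C"
    by (rule mat_metric_nonneg)
  show "mat_metric nv m A C = mat_metric nv m C A"
    unfolding mat_metric_def by (simp add: nv_diff_commute)
  show "mat_metric nv m A C = 0 \<longleftrightarrow> A = C" if A: "A \<in> carrier_mat m m" and C: "C \<in> carrier_mat m m"
  proof
    assume "mat_metric nv m A C = 0"
    then have "nv (A $$ (i, j) - C $$ (i, j)) \<le> 0" if "i < m" "j < m" for i j
      using mat_metric_le_iff[of 0 m A C] that by simp
    then have "A $$ (i, j) = C $$ (i, j)" if "i < m" "j < m" for i j
      using that nv_nonneg nv_eq_0_iff[of "A $$ (i, j) - C $$ (i, j)"] by (simp add: order_antisym)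
    then show "A = C"
      using A C by (intro eq_matI) auto
  next
    assume "A = C"
    then show "mat_metric nv m A C = 0"
      using mat_metric_le_iff[of 0 m A C] mat_metric_nonneg[of m A C] by simp
  qed
  show "mat_metric nv m A D \<le> mat_metric nv m A C + mat_metric nv m C D"
  proof (subst mat_metric_le_iff)
    show "\<forall>i<m. \<forall>j<m. nv (A $$ (i, j) - D $$ (i, j)) \<le> mat_metric nv m A C + mat_metric nv m C D"
    proof (intro allI impI)
      fix i j assume ij: "i < m" "j < m"
      have "nv (A $$ (i, j) - D $$ (i, j)) \<le> max (nv (A $$ (i, j) - C $$ (i, j))) (nv (C $$ (i, j) - D $$ (i, j)))"
        using nv_ultrametric[of "A $$ (i, j) - C $$ (i, j)" "C $$ (i, j) - D $$ (i, j)"] by simp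
      then show "nv (A $$ (i, j) - D $$ (i, j)) \<le> mat_metric nv m A C + mat_metric nv m C D"
        using entry_le_mat_metric[OF ij, of A C] entry_le_mat_metric[OF ij, of C D]
          mat_metric_nonneg[of m A C] mat_metric_nonneg[of m C D] by linarith
    qed
  qed (use mat_metric_nonneg in \<open>simp add: add_nonneg_nonneg\<close>)
qed

lemma GL_metric_space: "Metric_space (carrier (GL m)) (mat_metric nv m)"
  and GL_topology_eq: "GL_topology nv m = Metric_space.mtopology (carrier (GL m)) (mat_metric nv m)"
proof -
  interpret Metric_space "carrier_mat m m" "mat_metric nv m"
    by (rule mat_metric_space)
  interpret Submetric "carrier_mat m m" "mat_metric nv m" "carrier (GL m)"
    by unfold_locales (auto simp: carrier_GL)
  show "Metric_space (carrier (GL m)) (mat_metric nv m)"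
    by (rule sub.Metric_space_axioms)
  show "GL_topology nv m = Metric_space.mtopology (carrier (GL m)) (mat_metric nv m)"
    by (simp add: GL_topology_def mtopology_submetric)
qed

lemma topspace_GL: "topspace (GL_topology nv m) = carrier (GL m)"
  unfolding GL_topology_eq by (simp add: Metric_space.topspace_mtopology[OF GL_metric_space])

text \<open>Multiplication by a fixed matrix is Lipschitz, with the largest absolute value of an entry as
  constant.\<close>

lemma nv_prod_sum_le:
  fixes m :: nat
  assumes "C \<ge> 0" "d \<ge> 0" "\<And>k. k < m \<Longrightarrow> nv (a k) \<le> C" "\<And>k. k < m \<Longrightarrow> nv (b k) \<le> d"
  shows "nv (\<Sum>k<m. a k * b k) \<le> C * d"
  using assms by (intro nv_sum_le) (auto simp: nv_mult intro!: mult_mono nv_nonneg)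

lemma lipschitz_continuous_GL:
  assumes F: "\<And>x. x \<in> carrier (GL m) \<Longrightarrow> F x \<in> carrier (GL m)" and C: "C \<ge> 0"
    and L: "\<And>x y. x \<in> carrier (GL m) \<Longrightarrow> y \<in> carrier (GL m) \<Longrightarrow> mat_metric nv m (F x) (F y) \<le> C * mat_metric nv m x y"
  shows "continuous_map (GL_topology nv m) (GL_topology nv m) F"
proof -
  interpret Metric_space "carrier (GL m)" "mat_metric nv m"
    by (rule GL_metric_space)
  show ?thesis
    unfolding GL_topology_eq continuous_map_to_metric
  proof (intro ballI allI impI)
    fix x and \<epsilon> :: real assume x: "x \<in> topspace mtopology" and \<epsilon>: "0 < \<epsilon>"
    show "\<exists>U. openin mtopology U \<and> x \<in> U \<and> (\<forall>y\<in>U. F y \<in> mball (F x) \<epsilon>)"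
    proof (intro exI conjI ballI)
      show "openin mtopology (mball x (\<epsilon> / (C + 1)))" by simp
      show "x \<in> mball x (\<epsilon> / (C + 1))"
        using x \<epsilon> C by simp
      fix y assume "y \<in> mball x (\<epsilon> / (C + 1))"
      then have y: "y \<in> carrier (GL m)" "mat_metric nv m x y < \<epsilon> / (C + 1)"
        by (auto simp: in_mball)
      have "mat_metric nv m (F x) (F y) \<le> C * mat_metric nv m x y"
        using L x y by simp
      also have "\<dots> \<le> (C + 1) * mat_metric nv m x y"
        using mat_metric_nonneg by (intro mult_right_mono) auto
      also have "\<dots> < \<epsilon>"
        using y(2) C by (simp add: field_simps)
      finally show "F y \<in> mball (F x) \<epsilon>"
        using F x y by (simp add: in_mball)
    qed
  qed
qed

lemma translation_continuous_GL:
  assumes g: "g \<in> carrier (GL m)"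
  shows "continuous_map (GL_topology nv m) (GL_topology nv m) (\<lambda>x. g * x)"
    and "continuous_map (GL_topology nv m) (GL_topology nv m) (\<lambda>x. x * g)"
proof -
  interpret group "GL m :: 'a mat monoid"
    by (rule group_GL)
  have gm: "g \<in> carrier_mat m m"
    using g by (simp add: carrier_GL)
  let ?C = "Max (insert 0 ((\<lambda>(i, j). nv (g $$ (i, j))) ` ({..<m} \<times> {..<m})))"
  have C0: "?C \<ge> 0"
    by (rule Max_ge) auto
  have C: "nv (g $$ (i, j)) \<le> ?C" if "i < m" "j < m" for i j
    by (rule Max_ge) (use that in force)+
  have le: "mat_metric nv m x y * ?C \<ge> 0" "?C * mat_metric nv m x y \<ge> 0" for x y :: "'a mat"
    using C0 mat_metric_nonneg by auto
  have diff: "(\<Sum>k<m. a k * b k) - (\<Sum>k<m. a k * c k) = (\<Sum>k<m. a k * (b k - c k :: 'a))" for a b c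
    by (simp add: sum_subtractf algebra_simps)
  show "continuous_map (GL_topology nv m) (GL_topology nv m) (\<lambda>x. g * x)"
  proof (rule lipschitz_continuous_GL[OF _ C0])
    show "g * x \<in> carrier (GL m)" if "x \<in> carrier (GL m)" for x
      using m_closed[OF g that] by simp
    fix x y :: "'a mat" assume "x \<in> carrier (GL m)" "y \<in> carrier (GL m)"
    then have xy: "x \<in> carrier_mat m m" "y \<in> carrier_mat m m"
      by (auto simp: carrier_GL)
    show "mat_metric nv m (g * x) (g * y) \<le> ?C * mat_metric nv m x y"
      unfolding mat_metric_le_iff[OF le(2)]
    proof (intro allI impI)
      fix i j assume ij: "i < m" "j < m"
      show "nv ((g * x) $$ (i, j) - (g * y) $$ (i, j)) \<le> ?C * mat_metric nv m x y"
        unfolding mat_mult_entry[OF gm xy(1) ij] mat_mult_entry[OF gm xy(2) ij] diff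
        using C entry_le_mat_metric ij by (intro nv_prod_sum_le C0 mat_metric_nonneg)
    qed
  qed
  show "continuous_map (GL_topology nv m) (GL_topology nv m) (\<lambda>x. x * g)"
  proof (rule lipschitz_continuous_GL[OF _ C0])
    show "x * g \<in> carrier (GL m)" if "x \<in> carrier (GL m)" for x
      using m_closed[OF that g] by simp
    fix x y :: "'a mat" assume "x \<in> carrier (GL m)" "y \<in> carrier (GL m)"
    then have xy: "x \<in> carrier_mat m m" "y \<in> carrier_mat m m"
      by (auto simp: carrier_GL)
    show "mat_metric nv m (x * g) (y * g) \<le> ?C * mat_metric nv m x y"
      unfolding mat_metric_le_iff[OF le(2)]
    proof (intro allI impI)
      fix i j assume ij: "i < m" "j < m"
      show "nv ((x * g) $$ (i, j) - (y * g) $$ (i, j)) \<le> ?C * mat_metric nv m x y"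
        unfolding mat_mult_entry[OF xy(1) gm ij] mat_mult_entry[OF xy(2) gm ij]
          mult.commute[of _ "g $$ _"] diff
        using C entry_le_mat_metric ij by (intro nv_prod_sum_le C0 mat_metric_nonneg)
    qed
  qed
qed


section \<open>The group of the simple type\<close>

lemma block_orderD:
  assumes "A \<in> block_order nv e f"
  shows "A \<in> carrier_mat (e * f) (e * f)"
    and "i < e * f \<Longrightarrow> j < e * f \<Longrightarrow> nv (A $$ (i, j)) \<le> 1"
    and "i < e * f \<Longrightarrow> j < e * f \<Longrightarrow> j div f < i div f \<Longrightarrow> nv (A $$ (i, j)) < 1"
  using assms by (auto simp: block_order_def integral_mats_def)

lemma block_orderI:
  assumes "A \<in> carrier_mat (e * f) (e * f)"
    and "\<And>i j. i < e * f \<Longrightarrow> j < e * f \<Longrightarrow> nv (A $$ (i, j)) \<le> 1"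
    and "\<And>i j. i < e * f \<Longrightarrow> j < e * f \<Longrightarrow> j div f < i div f \<Longrightarrow> nv (A $$ (i, j)) < 1"
  shows "A \<in> block_order nv e f"
  using assms by (auto simp: block_order_def integral_mats_def)

lemma nv_mult_le_1: "nv x \<le> 1 \<Longrightarrow> nv y \<le> 1 \<Longrightarrow> nv (x * y) \<le> 1"
  using nv_nonneg by (simp add: nv_mult mult_le_one)

lemma nv_mult_less_1:
  assumes "nv x \<le> 1" "nv y \<le> 1" "nv x < 1 \<or> nv y < 1"
  shows "nv (x * y) < 1"
proof -
  have "nv x * nv y \<le> nv x" "nv x * nv y \<le> nv y"
    using assms nv_nonneg[of x] nv_nonneg[of y] by (auto simp: mult_left_le mult_left_le_one_le)
  then show ?thesis
    using assms by (auto simp: nv_mult)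
qed

lemma block_order_mult:
  assumes A: "A \<in> block_order nv e f" and C: "C \<in> block_order nv e f"
  shows "A * C \<in> block_order nv e f"
proof (rule block_orderI)
  note a = block_orderD[OF A] and c = block_orderD[OF C]
  show "A * C \<in> carrier_mat (e * f) (e * f)"
    using a(1) c(1) by simp
  show "nv ((A * C) $$ (i, j)) \<le> 1" if "i < e * f" "j < e * f" for i j
    unfolding mat_mult_entry[OF a(1) c(1) that] using a(2) c(2) that
    by (intro nv_sum_le nv_mult_le_1) auto
  show "nv ((A * C) $$ (i, j)) < 1" if ij: "i < e * f" "j < e * f" "j div f < i div f" for i j
    unfolding mat_mult_entry[OF a(1) c(1) ij(1,2)]
  proof (rule nv_sum_less)
    fix k assume "k \<in> {..<e * f}"
    then have k: "k < e * f" by simp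
    have "k div f < i div f \<or> j div f < k div f"
      using ij(3) by linarith
    then show "nv (A $$ (i, k) * C $$ (k, j)) < 1"
      using a(2,3) c(2,3) k ij by (intro nv_mult_less_1) auto
  qed auto
qed

lemma block_order_one: "1\<^sub>m (e * f) \<in> block_order nv e f"
  by (rule block_orderI) auto

lemma type_group_iff:
  "A \<in> type_group nv e f \<longleftrightarrow> A \<in> block_order nv e f \<and>
     (\<exists>C\<in>block_order nv e f. A * C = 1\<^sub>m (e * f) \<and> C * A = 1\<^sub>m (e * f))"
  by (auto simp: type_group_def mat_units_def)

lemma type_group_subset: "type_group nv e f \<subseteq> carrier (GL (e * f))"
  using block_orderD(1) by (fastforce simp: type_group_iff carrier_GL)

lemma subgroup_type_group: "subgroup (type_group nv e f) (GL (e * f))"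
proof -
  interpret group "GL (e * f) :: 'a mat monoid"
    by (rule group_GL)
  show ?thesis
  proof (rule subgroupI)
    show "type_group nv e f \<subseteq> carrier (GL (e * f))"
      by (rule type_group_subset)
    have "1\<^sub>m (e * f) \<in> type_group nv e f"
      using block_order_one[of e f] unfolding type_group_iff by force
    then show "type_group nv e f \<noteq> {}" by blast
  next
    fix A assume A: "A \<in> type_group nv e f"
    then obtain C where C: "A \<in> block_order nv e f" "C \<in> block_order nv e f" "A * C = 1\<^sub>m (e * f)" "C * A = 1\<^sub>m (e * f)"
      by (auto simp: type_group_iff)
    then have "C \<in> type_group nv e f"
      by (auto simp: type_group_iff)
    moreover have "inv\<^bsub>GL (e * f)\<^esub> A = C"
      using C A calculation type_group_subset by (intro inv_equality) auto
    ultimately show "inv\<^bsub>GL (e * f)\<^esub> A \<in> type_group nv e f" by simp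
  next
    fix A D assume "A \<in> type_group nv e f" "D \<in> type_group nv e f"
    then obtain C E where C: "A \<in> block_order nv e f" "C \<in> block_order nv e f" "A * C = 1\<^sub>m (e * f)" "C * A = 1\<^sub>m (e * f)"
      and E: "D \<in> block_order nv e f" "E \<in> block_order nv e f" "D * E = 1\<^sub>m (e * f)" "E * D = 1\<^sub>m (e * f)"
      by (auto simp: type_group_iff)
    note m = block_orderD(1)[OF C(1)] block_orderD(1)[OF C(2)] block_orderD(1)[OF E(1)] block_orderD(1)[OF E(2)]
    have "(A * D) * (E * C) = A * (D * E) * C" "(E * C) * (A * D) = E * (C * A) * D"
      using m by (simp_all add: assoc_mult_mat[of _ "e * f" "e * f" _ "e * f" _ "e * f"])
    then have "(A * D) * (E * C) = 1\<^sub>m (e * f)" "(E * C) * (A * D) = 1\<^sub>m (e * f)"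
      using m C E by simp_all
    then show "A \<otimes>\<^bsub>GL (e * f)\<^esub> D \<in> type_group nv e f"
      using block_order_mult C E by (auto simp: type_group_iff)
  qed
qed

text \<open>An inverse \<open>D\<close> of \<open>1 + N\<close>, where \<open>N\<close> has entries of absolute value less than \<open>1\<close>, satisfies
  \<open>D = 1 - N D\<close>; an entry of \<open>D\<close> of largest absolute value, were that greater than \<open>1\<close>, would be
  smaller than itself.\<close>

lemma inverse_near_one:
  assumes N: "N \<in> carrier_mat m m" and D: "D \<in> carrier_mat m m" and inv: "D = 1\<^sub>m m - N * D"
    and small: "\<And>i j. i < m \<Longrightarrow> j < m \<Longrightarrow> nv (N $$ (i, j)) < 1"
    and i: "i < m" and j: "j < m"
  shows "nv (D $$ (i, j)) \<le> 1" "nv ((N * D) $$ (i, j)) < 1"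
proof -
  have entry: "D $$ (i, j) = 1\<^sub>m m $$ (i, j) - (\<Sum>k<m. N $$ (i, k) * D $$ (k, j))" if "i < m" "j < m" for i j
  proof -
    have "D $$ (i, j) = (1\<^sub>m m - N * D) $$ (i, j)"
      using inv by (rule arg_cong)
    also have "\<dots> = 1\<^sub>m m $$ (i, j) - (N * D) $$ (i, j)"
      using N D that by (intro index_minus_mat) auto
    finally show ?thesis
      using mat_mult_entry[OF N D that] by simp
  qed
  have le: "nv (D $$ (i, j)) \<le> 1" if ij: "i < m" "j < m" for i j
  proof (rule ccontr)
    let ?S = "(\<lambda>(i, j). nv (D $$ (i, j))) ` ({..<m} \<times> {..<m})"
    assume "\<not> nv (D $$ (i, j)) \<le> 1"
    moreover have "nv (D $$ (i, j)) \<le> Max ?S"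
      by (rule Max_ge) (use ij in force)+
    ultimately have M: "Max ?S > 1" by linarith
    have "Max ?S \<in> ?S"
      by (rule Max_in) (use ij in auto)
    then obtain k l where kl: "k < m" "l < m" "Max ?S = nv (D $$ (k, l))" by auto
    have max: "nv (D $$ (t, l)) \<le> nv (D $$ (k, l))" if "t < m" for t
      unfolding kl(3)[symmetric] by (rule Max_ge) (use that kl in force)+
    have "nv (\<Sum>t<m. N $$ (k, t) * D $$ (t, l)) < nv (D $$ (k, l))"
    proof (rule nv_sum_less)
      fix t assume "t \<in> {..<m}"
      then have t: "t < m" by simp
      have "nv (N $$ (k, t)) * nv (D $$ (t, l)) \<le> nv (N $$ (k, t)) * nv (D $$ (k, l))"
        using max[OF t] nv_nonneg by (intro mult_left_mono) auto
      also have "\<dots> < nv (D $$ (k, l))"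
        using small[OF kl(1) t] M kl(3) by simp
      finally show "nv (N $$ (k, t) * D $$ (t, l)) < nv (D $$ (k, l))"
        by (simp add: nv_mult)
    qed (use M kl in auto)
    moreover have "nv (1\<^sub>m m $$ (k, l)) < nv (D $$ (k, l))"
      using M kl by (cases "k = l") auto
    ultimately have "nv (D $$ (k, l)) < nv (D $$ (k, l))"
      using entry[OF kl(1,2)] nv_diff[of "1\<^sub>m m $$ (k, l)" "\<Sum>t<m. N $$ (k, t) * D $$ (t, l)"] by simp
    then show False by simp
  qed
  then show "nv (D $$ (i, j)) \<le> 1"
    using i j by blast
  show "nv ((N * D) $$ (i, j)) < 1"
    unfolding mat_mult_entry[OF N D i j]
    using le small i j by (intro nv_sum_less nv_mult_less_1) (auto intro: less_imp_le)
qed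

text \<open>Let \<open>B\<close> be the inverse of \<open>A\<close>.  Then \<open>B C = 1 + B (C - A)\<close> is close to \<open>1\<close>, so its inverse
  \<open>C\<^sup>-\<^sup>1 A\<close> is integral and congruent to \<open>1\<close>; thus \<open>C\<^sup>-\<^sup>1 = (C\<^sup>-\<^sup>1 A) B\<close> lies in the order.\<close>

lemma near_type_group:
  assumes A: "A \<in> type_group nv e f" and C: "C \<in> carrier (GL (e * f))"
    and near: "mat_metric nv (e * f) A C < 1"
  shows "C \<in> type_group nv e f"
proof -
  let ?n = "e * f"
  obtain B where B: "A \<in> block_order nv e f" "B \<in> block_order nv e f" "A * B = 1\<^sub>m ?n" "B * A = 1\<^sub>m ?n"
    using A by (auto simp: type_group_iff)
  obtain D where D: "C \<in> carrier_mat ?n ?n" "D \<in> carrier_mat ?n ?n" "C * D = 1\<^sub>m ?n" "D * C = 1\<^sub>m ?n"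
    using C by (auto simp: carrier_GL)
  note a = block_orderD[OF B(1)] and b = block_orderD[OF B(2)]
  have close: "nv (C $$ (i, j) - A $$ (i, j)) < 1" if "i < ?n" "j < ?n" for i j
    using near that by (simp add: mat_metric_less_iff nv_diff_commute)
  have c_le: "nv (C $$ (i, j)) \<le> max (nv (A $$ (i, j))) (nv (C $$ (i, j) - A $$ (i, j)))" for i j
    using nv_ultrametric[of "A $$ (i, j)" "C $$ (i, j) - A $$ (i, j)"] by simp
  have Cin: "C \<in> block_order nv e f"
  proof (rule block_orderI[OF D(1)])
    show "nv (C $$ (i, j)) \<le> 1" if "i < ?n" "j < ?n" for i j
      using c_le[of i j] close[OF that] a(2)[OF that] by simp
    show "nv (C $$ (i, j)) < 1" if "i < ?n" "j < ?n" "j div f < i div f" for i j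
      using c_le[of i j] close[OF that(1,2)] a(3)[OF that] by simp
  qed
  let ?N = "B * C - 1\<^sub>m ?n" and ?E = "D * A"
  have N: "?N \<in> carrier_mat ?n ?n" and E: "?E \<in> carrier_mat ?n ?n"
    using D a(1) b(1) by auto
  have small: "nv (?N $$ (i, j)) < 1" if ij: "i < ?n" "j < ?n" for i j
  proof -
    have "?N $$ (i, j) = (B * C) $$ (i, j) - (B * A) $$ (i, j)"
      using ij b(1) D(1) B(4) by simp
    also have "\<dots> = (\<Sum>k<?n. B $$ (i, k) * (C $$ (k, j) - A $$ (k, j)))"
      unfolding mat_mult_entry[OF b(1) D(1) ij] mat_mult_entry[OF b(1) a(1) ij]
      by (simp add: sum_subtractf algebra_simps)
    also have "nv \<dots> < 1"
      using b(2) close ij by (intro nv_sum_less nv_mult_less_1) (auto intro: less_imp_le)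
    finally show ?thesis .
  qed
  note as = assoc_mult_mat[of _ ?n ?n _ ?n _ ?n]
  have "C * ?E = (C * D) * A"
    using a(1) D by (intro as[symmetric]) auto
  then have CE: "C * ?E = A"
    using D(3) a(1) by simp
  have "(B * C) * ?E = B * (C * ?E)"
    using b(1) D E by (intro as) auto
  then have BCE: "(B * C) * ?E = 1\<^sub>m ?n"
    using CE B(4) by simp
  have "?N * ?E = (B * C) * ?E - 1\<^sub>m ?n * ?E"
    using N E a(1) b(1) D by (intro minus_mult_distrib_mat) auto
  then have NE: "?N * ?E = 1\<^sub>m ?n - ?E"
    by (simp only: BCE left_mult_one_mat[OF E])
  have fix_E: "?E = 1\<^sub>m ?n - ?N * ?E"
    unfolding NE using E by (intro eq_matI) auto
  note near_1 = inverse_near_one[OF N E fix_E small]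
  have "?E \<in> block_order nv e f"
  proof (rule block_orderI[OF E])
    show "nv (?E $$ (i, j)) \<le> 1" if "i < ?n" "j < ?n" for i j
      using near_1(1) that by blast
    show "nv (?E $$ (i, j)) < 1" if ij: "i < ?n" "j < ?n" "j div f < i div f" for i j
    proof -
      have "i \<noteq> j"
        using ij(3) by auto
      have "?E $$ (i, j) = (1\<^sub>m ?n - ?N * ?E) $$ (i, j)"
        by (rule arg_cong[OF fix_E])
      also have "\<dots> = 1\<^sub>m ?n $$ (i, j) - (?N * ?E) $$ (i, j)"
        using ij N E by (intro index_minus_mat) auto
      also have "\<dots> = - (?N * ?E) $$ (i, j)"
        using ij \<open>i \<noteq> j\<close> by simp
      finally have "nv (?E $$ (i, j)) = nv ((?N * ?E) $$ (i, j))"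
        by (simp only: nv_minus)
      then show ?thesis
        using near_1(2)[OF _ _ ij(1,2)] by simp
    qed
  qed
  then have "?E * B \<in> block_order nv e f"
    using block_order_mult B(2) by blast
  moreover have "?E * B = D"
    using B(3) a(1) b(1) D by (simp add: as)
  ultimately show ?thesis
    using Cin D(3,4) by (auto simp: type_group_iff)
qed

lemma openin_type_group: "openin (GL_topology nv (e * f)) (type_group nv e f)"
proof -
  interpret Metric_space "carrier (GL (e * f))" "mat_metric nv (e * f)"
    by (rule GL_metric_space)
  show ?thesis
    unfolding GL_topology_eq openin_mtopology
  proof (intro conjI allI impI type_group_subset)
    fix A assume A: "A \<in> type_group nv e f"
    then show "\<exists>r>0. mball A r \<subseteq> type_group nv e f"
      using near_type_group[OF A] by (intro exI[of _ 1]) (auto simp: in_mball)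
  qed
qed

text \<open>From a sequence of matrices together with their inverses one extracts a convergent subsequence
  of both.  The limits are inverse to each other, and they lie in the order because it is closed:
  by the ultrametric inequality, elements at distance less than \<open>1\<close> from the maximal ideal belong to it.\<close>

lemma compactin_type_group: "compactin (GL_topology nv (e * f)) (type_group nv e f)"
proof -
  let ?n = "e * f"
  interpret Metric_space "carrier (GL ?n)" "mat_metric nv ?n"
    by (rule GL_metric_space)
  show ?thesis
    unfolding GL_topology_eq compactin_sequentially
  proof (intro conjI allI impI type_group_subset)
    fix \<sigma> :: "nat \<Rightarrow> 'a mat" assume "range \<sigma> \<subseteq> type_group nv e f"
    then have \<sigma>: "\<sigma> k \<in> type_group nv e f" for k by blast
    then have "\<forall>k. \<exists>C. C \<in> block_order nv e f \<and> \<sigma> k * C = 1\<^sub>m ?n \<and> C * \<sigma> k = 1\<^sub>m ?n"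
      unfolding type_group_iff by blast
    then obtain \<rho> where \<rho>: "\<And>k. \<rho> k \<in> block_order nv e f" "\<And>k. \<sigma> k * \<rho> k = 1\<^sub>m ?n" "\<And>k. \<rho> k * \<sigma> k = 1\<^sub>m ?n"
      by metis
    have \<sigma>b: "\<sigma> k \<in> block_order nv e f" for k
      using \<sigma> by (simp add: type_group_iff)
    (* one family for the matrices (index True) and their inverses (index False) *)
    define s where "s k p = (case p of (b, i, j) \<Rightarrow> if b then \<sigma> k $$ (i, j) else \<rho> k $$ (i, j))" for k and p :: "bool \<times> nat \<times> nat"
    let ?I = "(UNIV :: bool set) \<times> {..<?n} \<times> {..<?n}"
    have s_le: "nv (s k p) \<le> 1" if "p \<in> ?I" for k p
      using block_orderD(2)[OF \<sigma>b] block_orderD(2)[OF \<rho>(1)] that by (auto simp: s_def)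
    have finI: "finite ?I" by simp
    obtain l r where r: "strict_mono r"
      and l: "\<And>p. p \<in> ?I \<Longrightarrow> nv (l p) \<le> 1" "\<And>p. p \<in> ?I \<Longrightarrow> (\<lambda>k. nv (s (r k) p - l p)) \<longlonglongrightarrow> 0"
    proof (rule integer_families_sequentially_compact[of ?I s, OF finI s_le])
      fix l r
      assume "strict_mono r" "\<And>p. p \<in> ?I \<Longrightarrow> nv (l p) \<le> 1"
        "\<And>p. p \<in> ?I \<Longrightarrow> (\<lambda>k. nv (s (r k) p - l p)) \<longlonglongrightarrow> 0"
      then show thesis
        by (rule that)
    qed
    have ev: "\<forall>\<^sub>F k in sequentially. \<forall>p\<in>?I. nv (s (r k) p - l p) < \<epsilon>" if "\<epsilon> > 0" for \<epsilon>
      using order_tendstoD(2)[OF l(2) that] by (intro eventually_ball_finite) auto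
    have ev_ex: "\<exists>k. \<forall>p\<in>?I. nv (s (r k) p - l p) < \<epsilon>" if "\<epsilon> > 0" for \<epsilon>
      using eventually_happens'[OF sequentially_bot ev[OF that]] .
    define M where "M b = Matrix.mat ?n ?n (\<lambda>(i, j). l (b, i, j))" for b
    have M: "M b \<in> carrier_mat ?n ?n" "i < ?n \<Longrightarrow> j < ?n \<Longrightarrow> M b $$ (i, j) = l (b, i, j)" for b i j
      by (auto simp: M_def)
    have M_order: "M b \<in> block_order nv e f" for b
    proof (rule block_orderI[OF M(1)])
      show "nv (M b $$ (i, j)) \<le> 1" if "i < ?n" "j < ?n" for i j
        using l(1) that by (simp add: M)
      show "nv (M b $$ (i, j)) < 1" if ij: "i < ?n" "j < ?n" "j div f < i div f" for i j
      proof -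
        obtain k where k: "nv (s (r k) (b, i, j) - l (b, i, j)) < 1"
          using ev_ex[of 1] ij by auto
        have "nv (s (r k) (b, i, j)) < 1"
          using block_orderD(3)[OF \<sigma>b ij] block_orderD(3)[OF \<rho>(1) ij] by (simp add: s_def)
        then show ?thesis
          using k nv_diff[of "s (r k) (b, i, j)" "s (r k) (b, i, j) - l (b, i, j)"] ij by (simp add: M)
      qed
    qed
    have prod: "M b * M (\<not> b) = 1\<^sub>m ?n" for b
    proof (rule eq_matI)
      fix i j assume "i < dim_row (1\<^sub>m ?n :: 'a mat)" "j < dim_col (1\<^sub>m ?n :: 'a mat)"
      then have ij: "i < ?n" "j < ?n" by auto
      let ?a = "(M b * M (\<not> b)) $$ (i, j)" and ?d = "1\<^sub>m ?n $$ (i, j) :: 'a"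
      have "nv (?a - ?d) \<le> \<epsilon>" if \<epsilon>: "\<epsilon> > 0" for \<epsilon>
      proof -
        obtain k where k: "\<forall>p\<in>?I. nv (s (r k) p - l p) < \<epsilon>"
          using ev_ex[OF \<epsilon>] by blast
        let ?P = "if b then \<sigma> (r k) else \<rho> (r k)" and ?Q = "if b then \<rho> (r k) else \<sigma> (r k)"
        have PQ: "?P \<in> block_order nv e f" "?Q \<in> block_order nv e f" "?P * ?Q = 1\<^sub>m ?n"
          using \<sigma>b \<rho> by auto
        have near: "nv (?P $$ (i, t) - M b $$ (i, t)) < \<epsilon>" "nv (?Q $$ (t, j) - M (\<not> b) $$ (t, j)) < \<epsilon>" if "t < ?n" for t
          using k[rule_format, of "(b, i, t)"] k[rule_format, of "(\<not> b, t, j)"] that ij by (auto simp: s_def M)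
        have "?d = (?P * ?Q) $$ (i, j)"
          using PQ(3) by simp
        then have "?a - ?d = (\<Sum>t<?n. M b $$ (i, t) * M (\<not> b) $$ (t, j)) - (\<Sum>t<?n. ?P $$ (i, t) * ?Q $$ (t, j))"
          using mat_mult_entry[OF M(1) M(1) ij] mat_mult_entry[OF block_orderD(1)[OF PQ(1)] block_orderD(1)[OF PQ(2)] ij]
          by simp
        also have "\<dots> = (\<Sum>t<?n. M b $$ (i, t) * (M (\<not> b) $$ (t, j) - ?Q $$ (t, j)) +
            (M b $$ (i, t) - ?P $$ (i, t)) * ?Q $$ (t, j))"
          unfolding sum_subtractf[symmetric] by (intro sum.cong refl) (simp add: algebra_simps)
        also have "nv \<dots> \<le> \<epsilon>"
        proof (rule nv_sum_le)
          fix t assume "t \<in> {..<?n}"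
          then have t: "t < ?n" by simp
          have "nv (M b $$ (i, t) * (M (\<not> b) $$ (t, j) - ?Q $$ (t, j))) \<le> 1 * \<epsilon>"
            unfolding nv_mult using near(2)[OF t] block_orderD(2)[OF M_order] ij t nv_nonneg
            by (intro mult_mono) (auto simp: nv_diff_commute[of "M _ $$ _"] intro: less_imp_le)
          moreover have "nv ((M b $$ (i, t) - ?P $$ (i, t)) * ?Q $$ (t, j)) \<le> \<epsilon> * 1"
            unfolding nv_mult using near(1)[OF t] block_orderD(2)[OF PQ(2)] ij t nv_nonneg \<epsilon>
            by (intro mult_mono) (auto simp: nv_diff_commute[of "M _ $$ _"] intro: less_imp_le)
          ultimately show "nv (M b $$ (i, t) * (M (\<not> b) $$ (t, j) - ?Q $$ (t, j)) +
              (M b $$ (i, t) - ?P $$ (i, t)) * ?Q $$ (t, j)) \<le> \<epsilon>"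
            by (intro order_trans[OF nv_ultrametric]) simp
        qed (use \<epsilon> in auto)
        finally show ?thesis .
      qed
      then have "nv (?a - ?d) \<le> 0"
        by (rule field_le_epsilon[where y = 0, simplified])
      then have "nv (?a - ?d) = 0"
        using nv_nonneg[of "?a - ?d"] by linarith
      then show "?a = ?d"
        using nv_eq_0_iff by simp
    qed (use M in auto)
    have "M True \<in> type_group nv e f"
      using M_order prod[of True] prod[of False] by (auto simp: type_group_iff)
    moreover have "limitin mtopology (\<sigma> \<circ> r) (M True) sequentially"
      unfolding limitin_metric
    proof (intro conjI allI impI)
      show "M True \<in> carrier (GL ?n)"
        using calculation type_group_subset by blast
      fix \<epsilon> :: real assume \<epsilon>: "0 < \<epsilon>"
      show "\<forall>\<^sub>F k in sequentially. (\<sigma> \<circ> r) k \<in> carrier (GL ?n) \<and> mat_metric nv ?n ((\<sigma> \<circ> r) k) (M True) < \<epsilon>"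
        using ev[OF \<epsilon>]
      proof eventually_elim
        case (elim k)
        have "nv (\<sigma> (r k) $$ (i, j) - M True $$ (i, j)) < \<epsilon>" if "i < ?n" "j < ?n" for i j
          using elim[rule_format, of "(True, i, j)"] that by (simp add: s_def M)
        then show ?case
          using subsetD[OF type_group_subset \<sigma>] \<epsilon> by (simp add: mat_metric_less_iff)
      qed
    qed
    ultimately show "\<exists>l r. l \<in> type_group nv e f \<and> strict_mono r \<and> limitin mtopology (\<sigma> \<circ> r) l sequentially"
      using r by blast
  qed
qed

end


section \<open>Tensor powers of finite-dimensional representations\<close>

lemma tuples_update: "xs \<in> tuples e V \<Longrightarrow> x \<in> V \<Longrightarrow> xs[i := x] \<in> tuples e V"
  using set_update_subset_insert[of xs i x] by (auto simp: tuples_def)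

lemma pure_tensor_update_add:
  assumes "xs \<in> tuples e V" "i < e" "x \<in> V" "y \<in> V"
  shows "pure_tensor e V (xs[i := x + y]) = pure_tensor e V (xs[i := x]) + pure_tensor e V (xs[i := y])"
  using assms by (auto simp: pure_tensor_def multilinear_forms_def fun_eq_iff)

lemma pure_tensor_update_scale:
  assumes "xs \<in> tuples e V" "i < e" "x \<in> V"
  shows "pure_tensor e V (xs[i := c *\<^sub>C x]) = c *\<^sub>C pure_tensor e V (xs[i := x])"
  using assms by (auto simp: pure_tensor_def multilinear_forms_def fun_eq_iff scaleC_fun_def scaleC_complex_def)

text \<open>One coordinate after the other is expanded in terms of \<open>S\<close>.\<close>

lemma tensor_power_span:
  assumes S: "cvec.span S = V"
  shows "tensor_power e V = cvec.span (pure_tensor e V ` tuples e S)"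
proof -
  let ?T = "cvec.span (pure_tensor e V ` tuples e S)"
  have SV: "S \<subseteq> V"
    using S cvec.span_superset by blast
  have V: "cvec.subspace V"
    using S cvec.subspace_span by metis
  have "pure_tensor e V xs \<in> ?T"
    if "k \<le> e" "xs \<in> tuples e V" "\<And>i. k \<le> i \<Longrightarrow> i < e \<Longrightarrow> xs ! i \<in> S" for k xs
    using that
  proof (induction k arbitrary: xs)
    case 0
    then have "xs \<in> tuples e S"
      by (auto simp: tuples_def in_set_conv_nth)
    then show ?case
      by (intro cvec.span_base) blast
  next
    case (Suc k)
    (* the admissible k-th coordinates form a subspace that contains S *)
    let ?A = "{x \<in> V. pure_tensor e V (xs[k := x]) \<in> ?T}"
    have k: "k < e" and len: "length xs = e" and xk: "xs ! k \<in> V"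
      using Suc.prems(1,2) by (auto simp: tuples_def)
    have in_S: "s \<in> ?A" if s: "s \<in> S" for s
    proof -
      have "pure_tensor e V (xs[k := s]) \<in> ?T"
      proof (rule Suc.IH)
        show "xs[k := s] \<in> tuples e V"
          using tuples_update[OF Suc.prems(2)] s SV by blast
        show "xs[k := s] ! i \<in> S" if "k \<le> i" "i < e" for i
          using Suc.prems(3)[of i] that s len by (cases "i = k") auto
      qed (use k in simp)
      then show ?thesis
        using s SV by blast
    qed
    have "cvec.subspace ?A"
      unfolding cvec.subspace_def
    proof (intro conjI ballI allI)
      note T = cvec.subspace_span[of "pure_tensor e V ` tuples e S"]
      have V0: "0 \<in> V"
        using cvec.subspace_0[OF V] .
      have "pure_tensor e V (xs[k := 0 *\<^sub>C 0]) = 0 *\<^sub>C pure_tensor e V (xs[k := 0])"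
        by (rule pure_tensor_update_scale[OF Suc.prems(2) k V0])
      then have "pure_tensor e V (xs[k := 0]) = 0" by simp
      then show "0 \<in> ?A"
        using V0 cvec.subspace_0[OF T] by simp
      show "x + y \<in> ?A" if "x \<in> ?A" "y \<in> ?A" for x y
        using that cvec.subspace_add[OF V] cvec.subspace_add[OF T] pure_tensor_update_add[OF Suc.prems(2) k]
        by simp
      show "c *\<^sub>C x \<in> ?A" if "x \<in> ?A" for c x
        using that cvec.subspace_scale[OF V] cvec.subspace_scale[OF T] pure_tensor_update_scale[OF Suc.prems(2) k]
        by simp
    qed
    then have "cvec.span S \<subseteq> ?A"
      using in_S by (intro cvec.span_minimal) auto
    then have "pure_tensor e V (xs[k := xs ! k]) \<in> ?T"
      using xk S by blast
    then show ?case by simp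
  qed
  from this[of e] have "pure_tensor e V ` tuples e V \<subseteq> ?T"
    by auto
  moreover have "tuples e S \<subseteq> tuples e V"
    using SV by (auto simp: tuples_def)
  ultimately show ?thesis
    unfolding tensor_power_def
    by (intro subset_antisym cvec.span_minimal cvec.subspace_span cvec.span_mono image_mono)
qed

lemma finite_tuples: "finite S \<Longrightarrow> finite (tuples e S)"
  using finite_lists_length_eq[of S e] by (simp add: tuples_def conj_commute)

lemma tensor_op_cong:
  assumes "\<And>i. i < e \<Longrightarrow> A i = C i"
  shows "tensor_op e V A = tensor_op e V C"
proof -
  have "map (\<lambda>i. A i (xs ! i)) [0..<e] = map (\<lambda>i. C i (xs ! i)) [0..<e]" for xs
    using assms by simp
  note eq = this
  show ?thesis
    unfolding tensor_op_def eq ..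
qed

lemma tensor_op_add: "tensor_op e V A (v + w) = tensor_op e V A v + tensor_op e V A w"
  and tensor_op_scale: "tensor_op e V A (c *\<^sub>C v) = c *\<^sub>C tensor_op e V A v"
  by (simp_all add: tensor_op_def fun_eq_iff scaleC_fun_def scaleC_complex_def)

lemma tensor_op_zero: "tensor_op e V A 0 = 0"
  by (simp add: tensor_op_def fun_eq_iff)

lemma tensor_power_induct:
  assumes "w \<in> tensor_power e V" and "cvec.subspace {w. P w}"
    and "\<And>xs. xs \<in> tuples e V \<Longrightarrow> P (pure_tensor e V xs)"
  shows "P w"
proof -
  have "tensor_power e V \<subseteq> {w. P w}"
    unfolding tensor_power_def using assms(2,3) by (intro cvec.span_minimal) auto
  then show ?thesis
    using assms(1) by blast
qed

lemma tensor_op_linear: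
  assumes A: "\<And>i. i < e \<Longrightarrow> linear_from_to V V (A i)" and V: "cvec.subspace V"
  shows "linear_from_to (tensor_power e V) (tensor_power e V) (tensor_op e V A)"
proof -
  have sub: "cvec.subspace (tensor_power e V)"
    unfolding tensor_power_def by (rule cvec.subspace_span)
  have "tensor_op e V A w \<in> tensor_power e V" if "w \<in> tensor_power e V" for w
    using that
  proof (rule tensor_power_induct)
    show "cvec.subspace {w. tensor_op e V A w \<in> tensor_power e V}"
      using sub by (auto simp: cvec.subspace_def tensor_op_add tensor_op_scale tensor_op_zero)
    fix xs assume xs: "xs \<in> tuples e V"
    have "A i (xs ! i) \<in> V" if "i < e" for i
      using A[OF that] xs that by (auto simp: tuples_def linear_from_to_def subset_iff)
    then have "map (\<lambda>i. A i (xs ! i)) [0..<e] \<in> tuples e V"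
      by (auto simp: tuples_def)
    then have "pure_tensor e V (map (\<lambda>i. A i (xs ! i)) [0..<e]) \<in> tensor_power e V"
      unfolding tensor_power_def by (intro cvec.span_base imageI)
    then show "tensor_op e V A (pure_tensor e V xs) \<in> tensor_power e V"
      using tensor_op_pure_tensor[of e V A xs, OF A V xs] by simp
  qed
  then show ?thesis
    by (simp add: linear_from_to_def tensor_op_add tensor_op_scale)
qed

text \<open>A representation of a group pulled back along homomorphisms \<open>r 0, \<dots>, r (e - 1)\<close> gives
  a representation on the tensor power.\<close>

lemma representation_tensor_power:
  assumes rep: "representation H V \<rho>"
    and r: "\<And>i x. i < e \<Longrightarrow> x \<in> carrier K \<Longrightarrow> r i x \<in> carrier H"
    and r1: "\<And>i. i < e \<Longrightarrow> r i \<one>\<^bsub>K\<^esub> = \<one>\<^bsub>H\<^esub>"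
    and rm: "\<And>i x y. i < e \<Longrightarrow> x \<in> carrier K \<Longrightarrow> y \<in> carrier K \<Longrightarrow> r i (x \<otimes>\<^bsub>K\<^esub> y) = r i x \<otimes>\<^bsub>H\<^esub> r i y"
  shows "representation K (tensor_power e V) (\<lambda>x. tensor_op e V (\<lambda>i. \<rho> (r i x)))"
proof -
  have V: "cvec.subspace V" and lin: "\<And>g. g \<in> carrier H \<Longrightarrow> linear_from_to V V (\<rho> g)"
    and one: "\<And>v. v \<in> V \<Longrightarrow> \<rho> \<one>\<^bsub>H\<^esub> v = v"
    and mult: "\<And>g h v. g \<in> carrier H \<Longrightarrow> h \<in> carrier H \<Longrightarrow> v \<in> V \<Longrightarrow> \<rho> (g \<otimes>\<^bsub>H\<^esub> h) v = \<rho> g (\<rho> h v)"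
    using rep by (auto simp: representation_def)
  have lin': "linear_from_to V V (\<rho> (r i x))" if "x \<in> carrier K" "i < e" for x i
    using lin r that by blast
  show ?thesis
    unfolding representation_def
  proof (intro conjI ballI)
    show "cvec.subspace (tensor_power e V)"
      unfolding tensor_power_def by (rule cvec.subspace_span)
    show "linear_from_to (tensor_power e V) (tensor_power e V) (tensor_op e V (\<lambda>i. \<rho> (r i x)))"
      if "x \<in> carrier K" for x
      using lin'[OF that] V by (intro tensor_op_linear) auto
    show "tensor_op e V (\<lambda>i. \<rho> (r i \<one>\<^bsub>K\<^esub>)) w = w" if "w \<in> tensor_power e V" for w
      using that
    proof (rule tensor_power_induct)
      show "cvec.subspace {w. tensor_op e V (\<lambda>i. \<rho> (r i \<one>\<^bsub>K\<^esub>)) w = w}"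
        by (simp add: cvec.subspace_def tensor_op_add tensor_op_scale tensor_op_zero)
      fix xs assume xs: "xs \<in> tuples e V"
      have idl: "linear_from_to V V (\<lambda>v. v)"
        by (simp add: linear_from_to_def)
      have len: "length xs = e" and inV: "\<And>i. i < e \<Longrightarrow> xs ! i \<in> V"
        using xs by (auto simp: tuples_def)
      have l1: "linear_from_to V V (\<rho> (r i \<one>\<^bsub>K\<^esub>))" if "i < e" for i
        using V one cvec.subspace_add[OF V] cvec.subspace_scale[OF V] r1[OF that]
        by (simp add: linear_from_to_def)
      have "map (\<lambda>i. \<rho> (r i \<one>\<^bsub>K\<^esub>) (xs ! i)) [0..<e] = xs"
        using len inV one r1 by (intro nth_equalityI) auto
      then show "tensor_op e V (\<lambda>i. \<rho> (r i \<one>\<^bsub>K\<^esub>)) (pure_tensor e V xs) = pure_tensor e V xs"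
        using tensor_op_pure_tensor[of e V "\<lambda>i. \<rho> (r i \<one>\<^bsub>K\<^esub>)", OF l1 V xs] by simp
    qed
    show "tensor_op e V (\<lambda>i. \<rho> (r i (x \<otimes>\<^bsub>K\<^esub> y))) w =
        tensor_op e V (\<lambda>i. \<rho> (r i x)) (tensor_op e V (\<lambda>i. \<rho> (r i y)) w)"
      if x: "x \<in> carrier K" and y: "y \<in> carrier K" and w: "w \<in> tensor_power e V" for x y w
      using w
    proof (rule tensor_power_induct)
      show "cvec.subspace {w. tensor_op e V (\<lambda>i. \<rho> (r i (x \<otimes>\<^bsub>K\<^esub> y))) w =
          tensor_op e V (\<lambda>i. \<rho> (r i x)) (tensor_op e V (\<lambda>i. \<rho> (r i y)) w)}"
        by (simp add: cvec.subspace_def tensor_op_add tensor_op_scale tensor_op_zero)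
      fix xs assume xs: "xs \<in> tuples e V"
      let ?ys = "map (\<lambda>i. \<rho> (r i y) (xs ! i)) [0..<e]"
      have inV: "\<And>i. i < e \<Longrightarrow> xs ! i \<in> V"
        using xs by (auto simp: tuples_def)
      have ys: "?ys \<in> tuples e V"
        using lin'[OF y] inV by (auto simp: tuples_def linear_from_to_def)
      have lxy: "linear_from_to V V (\<rho> (r i (x \<otimes>\<^bsub>K\<^esub> y)))" if i: "i < e" for i
        using lin'[OF x i] lin'[OF y i] mult[OF r[OF i x] r[OF i y]] rm[OF i x y]
          cvec.subspace_add[OF V] cvec.subspace_scale[OF V] by (simp add: linear_from_to_def)
      have "map (\<lambda>i. \<rho> (r i (x \<otimes>\<^bsub>K\<^esub> y)) (xs ! i)) [0..<e] = map (\<lambda>i. \<rho> (r i x) (?ys ! i)) [0..<e]"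
        using inV r x y rm mult by simp
      note eq = this
      show "tensor_op e V (\<lambda>i. \<rho> (r i (x \<otimes>\<^bsub>K\<^esub> y))) (pure_tensor e V xs) =
          tensor_op e V (\<lambda>i. \<rho> (r i x)) (tensor_op e V (\<lambda>i. \<rho> (r i y)) (pure_tensor e V xs))"
        using tensor_op_pure_tensor[of e V "\<lambda>i. \<rho> (r i (x \<otimes>\<^bsub>K\<^esub> y))", OF lxy V xs]
          tensor_op_pure_tensor[of e V "\<lambda>i. \<rho> (r i y)", OF lin'[OF y] V xs]
          tensor_op_pure_tensor[of e V "\<lambda>i. \<rho> (r i x)", OF lin'[OF x] V ys]
        by (simp only: eq)
    qed
  qed
qed

text \<open>The span of the orbit of any nonzero vector is invariant.\<close>

lemma irreducible_rep_finite_span: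
  assumes irr: "irreducible_rep H V \<rho>" and H: "group H" "finite (carrier H)"
  obtains S where "finite S" "cvec.span S = V"
proof -
  interpret group H by (rule H)
  have rep: "representation H V \<rho>" and nz: "V \<noteq> {0}"
    and min: "\<And>U. cvec.subspace U \<Longrightarrow> U \<subseteq> V \<Longrightarrow> (\<And>g u. g \<in> carrier H \<Longrightarrow> u \<in> U \<Longrightarrow> \<rho> g u \<in> U) \<Longrightarrow> U = {0} \<or> U = V"
    using irr unfolding irreducible_rep_def by blast+
  have V: "cvec.subspace V" and lin: "\<And>g. g \<in> carrier H \<Longrightarrow> linear_from_to V V (\<rho> g)"
    and one: "\<And>v. v \<in> V \<Longrightarrow> \<rho> \<one>\<^bsub>H\<^esub> v = v"
    and mult: "\<And>g h v. g \<in> carrier H \<Longrightarrow> h \<in> carrier H \<Longrightarrow> v \<in> V \<Longrightarrow> \<rho> (g \<otimes>\<^bsub>H\<^esub> h) v = \<rho> g (\<rho> h v)"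
    using rep by (auto simp: representation_def)
  obtain v where v: "v \<in> V" "v \<noteq> 0"
    using nz cvec.subspace_0[OF V] by blast
  let ?S = "(\<lambda>g. \<rho> g v) ` carrier H"
  have SV: "?S \<subseteq> V"
    using lin v by (auto simp: linear_from_to_def)
  then have spV: "cvec.span ?S \<subseteq> V"
    by (intro cvec.span_minimal V)
  have "\<rho> g u \<in> cvec.span ?S" if g: "g \<in> carrier H" and u: "u \<in> cvec.span ?S" for g u
  proof -
    let ?A = "{u \<in> V. \<rho> g u \<in> cvec.span ?S}"
    note sp = cvec.subspace_span[of ?S]
    have "cvec.subspace ?A"
      using lin[OF g] linear_from_to_0[OF lin[OF g] V] cvec.subspace_add[OF V] cvec.subspace_scale[OF V]
        cvec.subspace_0[OF V] cvec.subspace_add[OF sp] cvec.subspace_scale[OF sp] cvec.subspace_0[OF sp]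
      unfolding cvec.subspace_def[of ?A] by (simp add: linear_from_to_def)
    moreover have "?S \<subseteq> ?A"
    proof
      fix s assume "s \<in> ?S"
      then obtain h where h: "h \<in> carrier H" "s = \<rho> h v" by blast
      have "\<rho> g s = \<rho> (g \<otimes>\<^bsub>H\<^esub> h) v"
        using mult g h v by simp
      then have "\<rho> g s \<in> cvec.span ?S"
        using g h by (auto intro: cvec.span_base)
      then show "s \<in> ?A"
        using SV \<open>s \<in> ?S\<close> by blast
    qed
    ultimately have "cvec.span ?S \<subseteq> ?A"
      by (intro cvec.span_minimal)
    then show ?thesis
      using u by blast
  qed
  then have "cvec.span ?S = {0} \<or> cvec.span ?S = V"
    by (intro min cvec.subspace_span spV)
  moreover have "v \<in> cvec.span ?S"
    using one[OF v(1)] by (intro cvec.span_base) force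
  ultimately have "cvec.span ?S = V"
    using v by auto
  then show thesis
    using that H(2) by blast
qed


section \<open>The simple type\<close>

context nonarch_local_field
begin

lemma finite_carrier_mat_residue: "finite (carrier_mat m m :: 'k mat set)"
proof (rule finite_subset)
  let ?F = "({..<m} \<times> {..<m}) \<rightarrow>\<^sub>E (UNIV :: 'k set)"
  show "carrier_mat m m \<subseteq> Matrix.mat m m ` ?F"
  proof
    fix A :: "'k mat" assume A: "A \<in> carrier_mat m m"
    show "A \<in> Matrix.mat m m ` ?F"
    proof (rule image_eqI)
      show "A = Matrix.mat m m (restrict (\<lambda>p. A $$ p) ({..<m} \<times> {..<m}))"
        using A by (intro eq_matI) auto
    qed auto
  qed
  show "finite (Matrix.mat m m ` ?F)"
    using finite_residue_field by (intro finite_imageI finite_PiE) auto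
qed

abbreviation reduced_block :: "nat \<Rightarrow> nat \<Rightarrow> 'a mat \<Rightarrow> 'k mat" where
  "reduced_block f i A \<equiv> map_mat red (diag_block f i A)"

lemma reduced_block_carrier: "reduced_block f i A \<in> carrier_mat f f"
  by (simp add: diag_block_def)

lemma block_index:
  assumes "i < e" "s < (f :: nat)"
  shows "i * f + s < e * f" "(i * f + s) div f = i"
proof -
  have "i * f + s < (i + 1) * f"
    using assms by simp
  also have "\<dots> \<le> e * f"
    using assms by (intro mult_right_mono) auto
  finally show "i * f + s < e * f" .
  show "(i * f + s) div f = i"
    using assms by simp
qed

text \<open>In the product of the \<open>i\<close>-th block row of \<open>A\<close> with the \<open>i\<close>-th block column of \<open>C\<close>, the terms outside
  the diagonal block contain a factor from below the block diagonal and vanish under reduction.\<close>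

lemma reduced_block_mult:
  assumes A: "A \<in> block_order nv e f" and C: "C \<in> block_order nv e f" and i: "i < e"
  shows "reduced_block f i (A * C) = reduced_block f i A * reduced_block f i C"
proof (rule eq_matI)
  note a = block_orderD[OF A] and c = block_orderD[OF C]
  fix s t assume "s < dim_row (reduced_block f i A * reduced_block f i C)"
    "t < dim_col (reduced_block f i A * reduced_block f i C)"
  then have s: "s < f" and t: "t < f"
    by (auto simp: diag_block_def)
  note bs = block_index[OF i s] and bt = block_index[OF i t]
  have "reduced_block f i (A * C) $$ (s, t) = red (\<Sum>k<e * f. A $$ (i * f + s, k) * C $$ (k, i * f + t))"
    using s t mat_mult_entry[OF a(1) c(1) bs(1) bt(1)] by (simp add: diag_block_def)
  also have "\<dots> = (\<Sum>k<e * f. red (A $$ (i * f + s, k) * C $$ (k, i * f + t)))"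
    using a(2) c(2) bs(1) bt(1) by (intro red_sum nv_mult_le_1) auto
  also have "\<dots> = (\<Sum>k\<in>{i * f..<i * f + f}. red (A $$ (i * f + s, k) * C $$ (k, i * f + t)))"
  proof (rule sum.mono_neutral_right)
    show "{i * f..<i * f + f} \<subseteq> {..<e * f}"
    proof
      fix k assume "k \<in> {i * f..<i * f + f}"
      then have "k - i * f < f" "k = i * f + (k - i * f)" by auto
      then show "k \<in> {..<e * f}"
        using block_index(1)[OF i] by (metis lessThan_iff)
    qed
    show "\<forall>k\<in>{..<e * f} - {i * f..<i * f + f}. red (A $$ (i * f + s, k) * C $$ (k, i * f + t)) = 0"
    proof
      fix k assume k: "k \<in> {..<e * f} - {i * f..<i * f + f}"
      have "k div f \<noteq> i"
      proof
        assume "k div f = i"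
        moreover have "k = k div f * f + k mod f" "k mod f < f"
          using s by auto
        ultimately have "k \<in> {i * f..<i * f + f}"
          by (metis add_less_cancel_left atLeastLessThan_iff le_add1)
        then show False
          using k by blast
      qed
      then have "k div f < i \<or> i < k div f" by linarith
      then have "nv (A $$ (i * f + s, k) * C $$ (k, i * f + t)) < 1"
        using k a(2,3) c(2,3) bs bt by (intro nv_mult_less_1) auto
      then show "red (A $$ (i * f + s, k) * C $$ (k, i * f + t)) = 0"
        using red_eq_0_iff by simp
    qed
  qed auto
  also have "\<dots> = (\<Sum>k<f. red (A $$ (i * f + s, i * f + k) * C $$ (i * f + k, i * f + t)))"
    by (rule sum.reindex_bij_witness[of _ "\<lambda>k. i * f + k" "\<lambda>k. k - i * f"]) auto
  also have "\<dots> = (\<Sum>k<f. reduced_block f i A $$ (s, k) * reduced_block f i C $$ (k, t))"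
    using a(2) c(2) bs(1) bt(1) block_index(1)[OF i] s t
    by (intro sum.cong refl) (simp add: diag_block_def red_mult)
  also have "\<dots> = (reduced_block f i A * reduced_block f i C) $$ (s, t)"
    by (rule mat_mult_entry[OF reduced_block_carrier reduced_block_carrier s t, symmetric])
  finally show "reduced_block f i (A * C) $$ (s, t) = (reduced_block f i A * reduced_block f i C) $$ (s, t)" .
qed (auto simp: diag_block_def)

lemma reduced_block_one:
  assumes i: "i < e"
  shows "reduced_block f i (1\<^sub>m (e * f)) = 1\<^sub>m f"
  using block_index(1)[OF i] red_one by (intro eq_matI) (auto simp: diag_block_def)

lemma reduced_block_GL:
  assumes A: "A \<in> type_group nv e f" and i: "i < e"
  shows "reduced_block f i A \<in> carrier (GL f)"
proof -
  obtain C where C: "A \<in> block_order nv e f" "C \<in> block_order nv e f" "A * C = 1\<^sub>m (e * f)" "C * A = 1\<^sub>m (e * f)"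
    using A by (auto simp: type_group_iff)
  have "reduced_block f i A * reduced_block f i C = 1\<^sub>m f" "reduced_block f i C * reduced_block f i A = 1\<^sub>m f"
    using reduced_block_mult[OF C(1,2) i] reduced_block_mult[OF C(2,1) i] reduced_block_one[OF i] C(3,4) by simp_all
  then show ?thesis
    unfolding carrier_GL using reduced_block_carrier by blast
qed

lemma type_rep_representation:
  assumes rep: "representation (GL f) X0 lam0"
  shows "representation ((GL (e * f))\<lparr>carrier := type_group nv e f\<rparr>) (tensor_power e X0) (type_rep red e f X0 lam0)"
proof -
  have eq: "type_rep red e f X0 lam0 = (\<lambda>j. tensor_op e X0 (\<lambda>i. lam0 (reduced_block f i j)))"
    by (simp add: type_rep_def inflation_def fun_eq_iff)
  show ?thesis
    unfolding eq
  proof (rule representation_tensor_power[OF rep, where r = "reduced_block f"])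
    show "reduced_block f i A \<in> carrier (GL f)"
      if "i < e" "A \<in> carrier ((GL (e * f))\<lparr>carrier := type_group nv e f\<rparr>)" for i A
      using reduced_block_GL that by simp
    show "reduced_block f i \<one>\<^bsub>(GL (e * f))\<lparr>carrier := type_group nv e f\<rparr>\<^esub> = \<one>\<^bsub>GL f\<^esub>" if "i < e" for i
      using reduced_block_one[OF that] by simp
    show "reduced_block f i (A \<otimes>\<^bsub>(GL (e * f))\<lparr>carrier := type_group nv e f\<rparr>\<^esub> C) =
        reduced_block f i A \<otimes>\<^bsub>GL f\<^esub> reduced_block f i C"
      if "i < e" "A \<in> carrier ((GL (e * f))\<lparr>carrier := type_group nv e f\<rparr>)"
        "C \<in> carrier ((GL (e * f))\<lparr>carrier := type_group nv e f\<rparr>)" for i A C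
      using reduced_block_mult[of A e f C i] that by (simp add: type_group_iff)
  qed
qed

text \<open>The operators depend on \<open>A\<close> through matrices over the finite residue field.\<close>

lemma finite_type_rep: "finite (type_rep red e f X0 lam0 ` J)"
proof (rule finite_subset)
  let ?F = "{..<e} \<rightarrow>\<^sub>E (carrier_mat f f :: 'k mat set)"
  let ?T = "\<lambda>r. tensor_op e X0 (\<lambda>i. lam0 (r i))"
  show "type_rep red e f X0 lam0 ` J \<subseteq> ?T ` ?F"
  proof
    fix T assume "T \<in> type_rep red e f X0 lam0 ` J"
    then obtain A where T: "T = type_rep red e f X0 lam0 A" by blast
    show "T \<in> ?T ` ?F"
    proof (rule image_eqI)
      show "T = ?T (restrict (\<lambda>i. reduced_block f i A) {..<e})"
        unfolding T type_rep_def inflation_def by (intro tensor_op_cong) simp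
      show "restrict (\<lambda>i. reduced_block f i A) {..<e} \<in> ?F"
        using reduced_block_carrier by (simp only: restrict_PiE_iff) blast
    qed
  qed
  show "finite (?T ` ?F)"
    using finite_carrier_mat_residue by (intro finite_imageI finite_PiE) auto
qed

end

theorem corollary3p7:
  fixes nv :: "'a::field \<Rightarrow> real" and red :: "'a \<Rightarrow> 'k::field"
    and n e f :: nat
    and X0 :: "'x::complex_vector set" and lam0 :: "'k mat \<Rightarrow> 'x \<Rightarrow> 'x" and Lam0 :: "'a mat \<Rightarrow> 'x \<Rightarrow> 'x"
    and T :: "'t::complex_vector set" and \<tau> :: "'a mat \<Rightarrow> 't \<Rightarrow> 't"
    and V :: "'v::complex_vector set" and \<pi> :: "'a mat \<Rightarrow> 'v \<Rightarrow> 'v"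
    and J :: "'a mat set" and W :: "(('x list \<Rightarrow> complex) \<Rightarrow> complex) set"
    and lam :: "'a mat \<Rightarrow> (('x list \<Rightarrow> complex) \<Rightarrow> complex) \<Rightarrow> ('x list \<Rightarrow> complex) \<Rightarrow> complex"
    and chi :: "('a mat \<Rightarrow> ((('x list \<Rightarrow> complex) \<Rightarrow> complex) \<Rightarrow> complex) \<Rightarrow>
                (('x list \<Rightarrow> complex) \<Rightarrow> complex) \<Rightarrow> complex) \<Rightarrow> complex"
  assumes "nonarch_local_field nv red"
    and "n \<ge> 2" and "e \<ge> 1" and "f \<ge> 1" and "e * f = n"
    and "level_zero_supercuspidal nv red f X0 lam0 Lam0 T \<tau>"
    and "unitary_rep (GL f) T \<tau>"
    and "generalized_steinberg nv e f T \<tau> V \<pi>"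
    and "J = type_group nv e f"
    and "W = tensor_power e X0"
    and "lam = type_rep red e f X0 lam0"
    and "afforded_character (GL n) (GL_topology nv n) J W lam V \<pi> chi"
  shows "cvec.dim (hecke_bar_eigenspace (GL n) (GL_topology nv n) J W lam chi) = 1"
proof -
  interpret nonarch_local_field nv red by fact
  have n: "n = e * f" and J: "J = type_group nv e f" and W: "W = tensor_power e X0"
    and lam: "lam = type_rep red e f X0 lam0"
    using assms by simp_all
  have irr: "irreducible_rep (GL f) X0 lam0"
    using assms(6) by (simp add: level_zero_supercuspidal_def)
  have rep0: "representation (GL f) X0 lam0"
    using irr by (simp add: irreducible_rep_def)
  have V_rep: "representation (GL n) V \<pi>"
    using assms(8) by (simp add: generalized_steinberg_def irreducible_rep_def n)
  have "finite (carrier (GL f) :: 'k mat set)"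
    by (rule finite_subset[OF _ finite_carrier_mat_residue[of f]]) (auto simp: carrier_GL)
  then obtain S where S: "finite S" "cvec.span S = X0"
    using irreducible_rep_finite_span[OF irr group_GL] by blast
  have "finite (pure_tensor e X0 ` tuples e S)" "cvec.span (pure_tensor e X0 ` tuples e S) = W"
    using finite_tuples[OF S(1)] tensor_power_span[OF S(2)] W by auto
  then obtain B where B: "based_space W B"
    by (rule based_space_exists)
  have sub: "subgroup J (GL n)"
    using subgroup_type_group by (simp add: J n)
  interpret GS: group_with_subgroup "GL n :: 'a mat monoid" J
    by (intro group_with_subgroup.intro group_with_subgroup_axioms.intro group_GL sub)
  interpret BS: based_space W B by (rule B)
  have opn: "openin (GL_topology nv n) J" and cmp: "compactin (GL_topology nv n) J"
    using openin_type_group[of e f] compactin_type_group[of e f] by (simp_all add: J n)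
  have tr: "continuous_map (GL_topology nv n) (GL_topology nv n) (\<lambda>x. g \<otimes>\<^bsub>GL n\<^esub> x)"
    "continuous_map (GL_topology nv n) (GL_topology nv n) (\<lambda>x. x \<otimes>\<^bsub>GL n\<^esub> g)" if "g \<in> carrier (GL n)" for g
    using translation_continuous_GL[OF that] by simp_all
  note cosets = GS.compact_open_cosets[OF topspace_GL opn cmp tr]
  interpret hecke_module "GL n :: 'a mat monoid" J W B "GL_topology nv n" lam V \<pi>
  proof unfold_locales
    show "representation ((GL n)\<lparr>carrier := J\<rparr>) W lam"
      using type_rep_representation[OF rep0, of e] by (simp add: J W lam n)
    show "finite (lam ` J)"
      unfolding lam by (rule finite_type_rep)
  qed (fact V_rep | rule cosets; assumption)+
  show ?thesis
    using dim_hecke_bar_eigenspace assms(12) by blast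
qed

end
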